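(* Let $G$ be a graph whose feedback edge set number equals $k$. Then the RDS instance $\{G,\emptyset\}$ can be reduced in linear time to an RDS instance $\{G',W'\}$ where $G'$ has size $O(k)$.
   Context: All graphs are simple, finite and undirected. The feedback edge set number of $G$ is the minimum size of $F\subseteq E(G)$ such that $G-F$ is a forest. For a graph $G$ and $W\subseteq V(G)$, a set $S\subseteq V(G)$ is a $\{G,W\}$-dominating set if every vertex of $V(G)\setminus W$ lies in $S$ or has a neighbor in $S$ (vertices of $W$ need not be dominated). An RDS instance is a pair $\{G,W\}$ of a graph $G$ and $W\subseteq V(G)$. For RDS instances $\{G,W\}$ and $\{G',W'\}$ with $V(G')\subseteq V(G)$, $\{G,W\}$ reduces to $\{G',W'\}$ if one can compute a set $S\subseteq V(G)\setminus V(G')$ such that the union of $S$ with any minimum(-size) $\{G',W'\}$-dominating set is a minimum $\{G,W\}$-dominating set.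
   Formalization: In "reduces to", the set S may depend on the given minimum {G',W'}-dominating set and is computed from it and G in linear time; a single S serving all minimum sets, computed in linear time with a kernel of size O(k), would imply P = NP. *)

theory Defs
  imports Main
begin

text \<open>Graphs are pairs of a vertex set and a set of two-element edges.\<close>

definition simple_graph :: "'a set \<Rightarrow> 'a set set \<Rightarrow> bool" where
  "simple_graph V E \<longleftrightarrow> finite V \<and> (\<forall>e\<in>E. e \<subseteq> V \<and> card e = 2)"

definition is_cycle :: "'a set set \<Rightarrow> 'a list \<Rightarrow> bool" where
  "is_cycle E p \<longleftrightarrow> 3 \<le> length p \<and> distinct p \<and>
     (\<forall>i<length p. {p ! i, p ! (Suc i mod length p)} \<in> E)"

definition forest :: "'a set set \<Rightarrow> bool" where
  "forest E \<longleftrightarrow> (\<nexists>p. is_cycle E p)"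

definition feedback_edge_set :: "'a set set \<Rightarrow> 'a set set \<Rightarrow> bool" where
  "feedback_edge_set E F \<longleftrightarrow> F \<subseteq> E \<and> forest (E - F)"

definition feedback_edge_set_number :: "'a set set \<Rightarrow> nat" where
  "feedback_edge_set_number E = (LEAST k. \<exists>F. feedback_edge_set E F \<and> card F = k)"

definition rds_instance :: "'a set \<Rightarrow> 'a set set \<Rightarrow> 'a set \<Rightarrow> bool" where
  "rds_instance V E W \<longleftrightarrow> simple_graph V E \<and> W \<subseteq> V"

definition dominating :: "'a set \<Rightarrow> 'a set set \<Rightarrow> 'a set \<Rightarrow> 'a set \<Rightarrow> bool" where
  "dominating V E W S \<longleftrightarrow> S \<subseteq> V \<and> (\<forall>v\<in>V - W. v \<in> S \<or> (\<exists>u\<in>S. {u, v} \<in> E))"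

definition minimum_dominating :: "'a set \<Rightarrow> 'a set set \<Rightarrow> 'a set \<Rightarrow> 'a set \<Rightarrow> bool" where
  "minimum_dominating V E W S \<longleftrightarrow>
     dominating V E W S \<and> (\<forall>T. dominating V E W T \<longrightarrow> card S \<le> card T)"


text \<open>
  Running time is measured on a structured random access machine with finitely many (per program)
  named registers and arrays, all cells holding natural numbers. Every assignment, store
  and test costs one step; expressions in a program have fixed size, so this agrees with
  charging every elementary operation up to a constant factor. The only arithmetic is
  increment and decrement: after \<open>t\<close> steps no cell exceeds the largest initial value or program
  constant by more than a constant times \<open>t\<close>, so a linear-time program only
  handles words of logarithmic length.
\<close>

datatype exp = Const nat | Reg string | Arr string exp | Inc exp | Dec exp

datatype test = Less exp exp | Neg test | Conj test test

datatype prog =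
    Skip
  | Assign string exp
  | Store string exp exp
  | Seq prog prog
  | Cond test prog prog
  | While test prog

datatype store = Mem (regs: "string \<Rightarrow> nat") (arrs: "string \<Rightarrow> nat \<Rightarrow> nat")

fun eval_exp :: "exp \<Rightarrow> store \<Rightarrow> nat" where
  "eval_exp (Const c) s = c"
| "eval_exp (Reg x) s = regs s x"
| "eval_exp (Arr a e) s = arrs s a (eval_exp e s)"
| "eval_exp (Inc e) s = eval_exp e s + 1"
| "eval_exp (Dec e) s = eval_exp e s - 1"

fun eval_test :: "test \<Rightarrow> store \<Rightarrow> bool" where
  "eval_test (Less e f) s \<longleftrightarrow> eval_exp e s < eval_exp f s"
| "eval_test (Neg b) s \<longleftrightarrow> \<not> eval_test b s"
| "eval_test (Conj b d) s \<longleftrightarrow> eval_test b s \<and> eval_test d s"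

text \<open>\<open>exec p s t s'\<close>: started in \<open>s\<close>, program \<open>p\<close> halts in \<open>s'\<close> after exactly \<open>t\<close> steps.\<close>

inductive exec :: "prog \<Rightarrow> store \<Rightarrow> nat \<Rightarrow> store \<Rightarrow> bool" where
  Skip: "exec Skip s 1 s"
| Assign: "exec (Assign x e) s 1 (Mem ((regs s)(x := eval_exp e s)) (arrs s))"
| Store: "exec (Store a e f) s 1
    (Mem (regs s) ((arrs s)(a := (arrs s a)(eval_exp e s := eval_exp f s))))"
| Seq: "exec p s t s' \<Longrightarrow> exec q s' t' s'' \<Longrightarrow> exec (Seq p q) s (t + t') s''"
| CondTrue: "eval_test b s \<Longrightarrow> exec p s t s' \<Longrightarrow> exec (Cond b p q) s (1 + t) s'"
| CondFalse: "\<not> eval_test b s \<Longrightarrow> exec q s t s' \<Longrightarrow> exec (Cond b p q) s (1 + t) s'"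
| WhileFalse: "\<not> eval_test b s \<Longrightarrow> exec (While b p) s 1 s"
| WhileTrue: "eval_test b s \<Longrightarrow> exec p s t s' \<Longrightarrow> exec (While b p) s' t' s'' \<Longrightarrow>
    exec (While b p) s (1 + t + t') s''"


text \<open>
  Input graphs have vertex set \<open>{0..<n}\<close> and are given by \<open>n\<close> and a list \<open>es\<close> containing every edge
  exactly once, in arbitrary order and orientation.
\<close>

definition edges_of :: "(nat \<times> nat) list \<Rightarrow> nat set set" where
  "edges_of es = (\<lambda>(u, v). {u, v}) ` set es"

definition graph_code :: "nat \<Rightarrow> (nat \<times> nat) list \<Rightarrow> bool" where
  "graph_code n es \<longleftrightarrow> simple_graph {0..<n} (edges_of es) \<and> distinct (map (\<lambda>(u, v). {u, v}) es)"

definition array_of :: "nat list \<Rightarrow> nat \<Rightarrow> nat" where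
  "array_of xs i = (if i < length xs then xs ! i else 0)"

text \<open>
  Initial memory holding the graph \<open>(n, es)\<close> and a list \<open>ds\<close> of vertices (empty if the
  input consists of a graph only); all other cells are zero.
\<close>

definition input :: "nat \<Rightarrow> (nat \<times> nat) list \<Rightarrow> nat list \<Rightarrow> store" where
  "input n es ds = Mem
     ((\<lambda>_. 0)(''n'' := n, ''m'' := length es, ''d'' := length ds))
     ((\<lambda>_ _. 0)(''src'' := array_of (map fst es), ''dst'' := array_of (map snd es),
                ''D'' := array_of ds))"

text \<open>
  A set is output as a list: register \<open>x\<close> contains its length, array \<open>x\<close> its entries. Edges are
  output as two parallel lists of end points, with the length in register \<open>''E''\<close>.
\<close>

definition out_set :: "string \<Rightarrow> store \<Rightarrow> nat set" where
  "out_set x s = arrs s x ` {..<regs s x}"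

definition out_edges :: "store \<Rightarrow> nat set set" where
  "out_edges s = (\<lambda>i. {arrs s ''E1'' i, arrs s ''E2'' i}) ` {..<regs s ''E''}"

text \<open>
  \<open>kernelizes P T n es V' E' W'\<close>: within \<open>T\<close> steps \<open>P\<close> maps the graph \<open>(n, es)\<close> to the
  instance \<open>{(V', E'), W'}\<close>.
\<close>

definition kernelizes ::
    "prog \<Rightarrow> nat \<Rightarrow> nat \<Rightarrow> (nat \<times> nat) list \<Rightarrow> nat set \<Rightarrow> nat set set \<Rightarrow> nat set \<Rightarrow> bool" where
  "kernelizes P T n es V' E' W' \<longleftrightarrow>
     (\<exists>t s. exec P (input n es []) t s \<and> t \<le> T \<and>
        V' = out_set ''V'' s \<and> E' = out_edges s \<and> W' = out_set ''W'' s)"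

text \<open>
  \<open>reduces_to Q T n es V' E' W'\<close>: the instance \<open>{G, {}}\<close>, \<open>G = (n, es)\<close>, reduces to
  \<open>{(V', E'), W'}\<close>, where \<open>Q\<close> computes \<open>S\<close> within \<open>T\<close> steps. \<open>Q\<close> reads \<open>G\<close> and the minimum
  \<open>{(V', E'), W'}\<close>-dominating set that \<open>S\<close> has to complete, listed in any order. A single
  set \<open>S\<close> serving all those sets cannot be intended: together with a kernel of size \<open>O(k)\<close> and
  polynomial time it yields a polynomial algorithm for Dominating Set. (Replace each edge
  of \<open>H\<close> by a path with \<open>3 r\<close> inner vertices, \<open>r\<close> large; then the domination number grows by
  exactly \<open>r\<close> per edge, and \<open>S\<close> has to meet each of the paths, so that
  completing \<open>S\<close> optimally is a problem on forests.)
\<close>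

definition reduces_to ::
    "prog \<Rightarrow> nat \<Rightarrow> nat \<Rightarrow> (nat \<times> nat) list \<Rightarrow> nat set \<Rightarrow> nat set set \<Rightarrow> nat set \<Rightarrow> bool" where
  "reduces_to Q T n es V' E' W' \<longleftrightarrow>
     rds_instance V' E' W' \<and> V' \<subseteq> {0..<n} \<and>
     (\<forall>ds. distinct ds \<and> minimum_dominating V' E' W' (set ds) \<longrightarrow>
        (\<exists>t s. exec Q (input n es ds) t s \<and> t \<le> T \<and>
           out_set ''S'' s \<subseteq> {0..<n} - V' \<and>
           minimum_dominating {0..<n} (edges_of es) {} (out_set ''S'' s \<union> set ds)))"

end

theory Submission
  imports Defs
begin

text \<open>
  First, leaves are stripped. A leaf that need not be dominated is deleted; for any other leaf its
  neighbour is selected and deleted, and the other neighbours of that vertex join \<open>W\<close>. This leaves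
  a core of minimum degree two, in which the degrees exceed two by at most \<open>2 k\<close> in total. Vertices
  of degree at least three, and one vertex of every component that is a cycle, are hubs; the rest
  of the core consists of \<open>O(k)\<close> paths between hubs. Write such a path as a word, \<open>N\<close> for a vertex
  that has to be dominated and \<open>W\<close> for one that has not. Deleting a factor \<open>NNN\<close>, replacing
  \<open>WNNW\<close> or \<open>WNWNW\<close> by \<open>W\<close>, and replacing \<open>WWW\<close> or \<open>WWNWW\<close> by \<open>WW\<close> (joining the remaining
  neighbours by an edge) changes the domination number by a constant, and a dominating set is
  lifted back by adding a deleted vertex that depends only on whether the two end points are
  selected. A word without these factors has length at most 10. The path is read once, with the kept
  vertices on a stack; the lifts are logged and undone in reverse order.
\<close>

section \<open>Programs and step budgets\<close>

text \<open>Why the kernel is linear in \<open>k\<close>: without a feedback edge set of size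
  \<open>k\<close> the core \<open>A\<close> is a forest, so it has at most \<open>|A| + k\<close>
  edges; since no degree is below 2, the handshake lemma bounds the excess over 2. Each component
  that is a cycle contains its own edge of the feedback set. This gives at most \<open>3 k\<close>
  hubs of total degree at most \<open>8 k\<close>, hence at most \<open>8 k\<close> paths. The word
  rules compose because \<open>reduction\<close> compares all dominating sets, with one additive
  constant, and never mentions the domination number. A rule that needs a vertex of \<open>W\<close>
  ahead of the deleted segment is tried just before that vertex is pushed, the others just after; at
  most one rule fires each time, so a vertex costs constant time apart from the scan of its
  neighbours. The completion \<open>S\<close> depends on the given dominating set of the kernel.
  \<open>Complete\<close> therefore repeats the run of \<open>Kernelize\<close> and undoes its log;
  \<open>exec_agree\<close> shows that the additional input does not change that run.\<close>

definition setr :: "string \<Rightarrow> nat \<Rightarrow> store \<Rightarrow> store" where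
  "setr x v s = Mem ((regs s)(x := v)) (arrs s)"

definition seta :: "string \<Rightarrow> nat \<Rightarrow> nat \<Rightarrow> store \<Rightarrow> store" where
  "seta a i v s = Mem (regs s) ((arrs s)(a := (arrs s a)(i := v)))"

lemma setr_sel [simp]: "regs (setr x v s) = (regs s)(x := v)" "arrs (setr x v s) = arrs s"
  by (simp_all add: setr_def)

lemma seta_sel [simp]: "regs (seta a i v s) = regs s"
    "arrs (seta a i v s) = (arrs s)(a := (arrs s a)(i := v))"
  by (simp_all add: seta_def)

inductive_cases exec_SkipE: "exec Skip s t s'"
inductive_cases exec_AssignE: "exec (Assign x e) s t s'"
inductive_cases exec_StoreE: "exec (Store a e f) s t s'"
inductive_cases exec_SeqE: "exec (Seq p q) s t s'"
inductive_cases exec_CondE: "exec (Cond b p q) s t s'"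

text \<open>The number \<open>k\<close> is a budget of steps; the postcondition receives what is left of it, so that
  amortised bounds become invariants of the form \<open>potential \<le> budget\<close>.\<close>

definition wp :: "prog \<Rightarrow> (nat \<Rightarrow> store \<Rightarrow> bool) \<Rightarrow> nat \<Rightarrow> store \<Rightarrow> bool" where
  "wp p Q k s \<longleftrightarrow> (\<exists>t s'. exec p s t s' \<and> t \<le> k \<and> Q (k - t) s')"

lemma wp_Skip [simp]: "wp Skip Q k s \<longleftrightarrow> 1 \<le> k \<and> Q (k - 1) s"
  unfolding wp_def
  by (metis exec.Skip exec_SkipE)

lemma wp_Assign [simp]:
  "wp (Assign x e) Q k s \<longleftrightarrow> 1 \<le> k \<and> Q (k - 1) (setr x (eval_exp e s) s)"
  unfolding wp_def setr_def
  by (metis exec.Assign exec_AssignE)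

lemma wp_Store [simp]:
  "wp (Store a e f) Q k s \<longleftrightarrow> 1 \<le> k \<and> Q (k - 1) (seta a (eval_exp e s) (eval_exp f s) s)"
  unfolding wp_def seta_def
  by (metis exec.Store exec_StoreE)

lemma wp_Seq [simp]: "wp (Seq p q) Q k s \<longleftrightarrow> wp p (wp q Q) k s"
proof
  assume "wp (Seq p q) Q k s"
  then obtain t s' where "exec (Seq p q) s t s'" "t \<le> k" "Q (k - t) s'" by (auto simp: wp_def)
  then obtain t1 t2 r where "exec p s t1 r" "exec q r t2 s'" "t = t1 + t2"
    by (auto elim: exec_SeqE)
  then show "wp p (wp q Q) k s" using \<open>t \<le> k\<close> \<open>Q (k - t) s'\<close>
    unfolding wp_def
    by (intro exI[of _ t1] exI[of _ r] conjI exI[of _ t2] exI[of _ s']) auto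
next
  assume "wp p (wp q Q) k s"
  then obtain t1 r t2 s' where *: "exec p s t1 r" "t1 \<le> k" "exec q r t2 s'" "t2 \<le> k - t1"
      "Q (k - t1 - t2) s'" by (auto simp: wp_def)
  then show "wp (Seq p q) Q k s" unfolding wp_def
    by (intro exI[of _ "t1 + t2"] exI[of _ s']) (auto intro: exec.Seq)
qed

lemma wp_Cond [simp]: "wp (Cond b p q) Q k s \<longleftrightarrow>
  1 \<le> k \<and> (if eval_test b s then wp p Q (k - 1) s else wp q Q (k - 1) s)"
proof
  assume "wp (Cond b p q) Q k s"
  then obtain t s' where "exec (Cond b p q) s t s'" "t \<le> k" "Q (k - t) s'" by (auto simp: wp_def)
  then show "1 \<le> k \<and> (if eval_test b s then wp p Q (k - 1) s else wp q Q (k - 1) s)"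
    unfolding wp_def by (cases rule: exec_CondE) (auto 0 4)
next
  assume a: "1 \<le> k \<and> (if eval_test b s then wp p Q (k - 1) s else wp q Q (k - 1) s)"
  show "wp (Cond b p q) Q k s"
  proof (cases "eval_test b s")
    case True
    with a obtain t s' where "exec p s t s'" "t \<le> k - 1" "Q (k - 1 - t) s'" by (auto simp: wp_def)
    with True a show ?thesis unfolding wp_def
      by (intro exI[of _ "1 + t"] exI[of _ s']) (auto intro: exec.CondTrue[of b s, simplified])
  next
    case False
    with a obtain t s' where "exec q s t s'" "t \<le> k - 1" "Q (k - 1 - t) s'" by (auto simp: wp_def)
    with False a show ?thesis unfolding wp_def
      by (intro exI[of _ "1 + t"] exI[of _ s']) (auto intro: exec.CondFalse[of b s, simplified])
  qed
qed

lemma wp_mono: "wp p Q k s \<Longrightarrow> (\<And>k' s'. Q k' s' \<Longrightarrow> Q' k' s') \<Longrightarrow> wp p Q' k s"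
  unfolding wp_def by blast

text \<open>For use inside loops: \<open>c\<close> steps are set aside for what follows, and a
  statement proved with the smaller budget hands them on.\<close>

lemma wp_pay: "wp p Q (k - c) s \<Longrightarrow> c \<le> k \<Longrightarrow> wp p (\<lambda>k' s'. c \<le> k' \<and> Q (k' - c) s') k s"
  unfolding wp_def by (metis Nat.le_diff_conv2 add.commute diff_commute le_diff_conv2 le_trans diff_le_self)

text \<open>Every evaluation of the test costs a step, so the budget strictly decreases from round
  to round. Induction on it yields termination, running time and correctness together.\<close>

lemma wp_While:
  assumes "I k s" and "\<And>k s. I k s \<Longrightarrow> 1 \<le> k"
    and "\<And>k s. I k s \<Longrightarrow> eval_test b s \<Longrightarrow> wp p I (k - 1) s"
    and "\<And>k s. I k s \<Longrightarrow> \<not> eval_test b s \<Longrightarrow> Q (k - 1) s"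
  shows "wp (While b p) Q k s"
  using assms(1)
proof (induction k arbitrary: s rule: less_induct)
  case (less k)
  show ?case
  proof (cases "eval_test b s")
    case True
    obtain t s' where 1: "exec p s t s'" "t \<le> k - 1" "I (k - 1 - t) s'"
      using assms(3)[OF less.prems True] by (auto simp: wp_def)
    have "1 \<le> k" using assms(2) less.prems by blast
    then have "wp (While b p) Q (k - 1 - t) s'" using 1 by (intro less.IH) auto
    then obtain t' s'' where 2: "exec (While b p) s' t' s''" "t' \<le> k - 1 - t" "Q (k - 1 - t - t') s''"
      by (auto simp: wp_def)
    show ?thesis unfolding wp_def
      using exec.WhileTrue[OF True 1(1) 2(1)] 1 2 \<open>1 \<le> k\<close>
      by (intro exI[of _ "1 + t + t'"] exI[of _ s'']) auto
  next
    case False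
    then show ?thesis unfolding wp_def
      using exec.WhileFalse[OF False] assms(4)[OF less.prems False] assms(2)[OF less.prems] by blast
  qed
qed

section \<open>Frame conditions, and runs on memories that agree wherever the program reads\<close>

fun wregs :: "prog \<Rightarrow> string set" where
  "wregs (Assign x e) = {x}"
| "wregs (Seq p q) = wregs p \<union> wregs q"
| "wregs (Cond b p q) = wregs p \<union> wregs q"
| "wregs (While b p) = wregs p"
| "wregs _ = {}"

fun warrs :: "prog \<Rightarrow> string set" where
  "warrs (Store a e f) = {a}"
| "warrs (Seq p q) = warrs p \<union> warrs q"
| "warrs (Cond b p q) = warrs p \<union> warrs q"
| "warrs (While b p) = warrs p"
| "warrs _ = {}"

lemma exec_frame:
  "exec p s t s' \<Longrightarrow> (\<forall>x. x \<notin> wregs p \<longrightarrow> regs s' x = regs s x) \<and>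
     (\<forall>a. a \<notin> warrs p \<longrightarrow> arrs s' a = arrs s a)"
  by (induction rule: exec.induct) auto

text \<open>Spares the invariants a list of unchanged cells: what a program does not write is
  recovered from its text afterwards.\<close>

lemma wp_frame:
  assumes "wp p Q k s"
    and "\<And>k' s'. Q k' s' \<Longrightarrow> (\<And>x. x \<notin> wregs p \<Longrightarrow> regs s' x = regs s x) \<Longrightarrow>
          (\<And>a. a \<notin> warrs p \<Longrightarrow> arrs s' a = arrs s a) \<Longrightarrow> Q' k' s'"
  shows "wp p Q' k s"
  using assms exec_frame unfolding wp_def by blast

fun eregs :: "exp \<Rightarrow> string set" where
  "eregs (Const c) = {}"
| "eregs (Reg x) = {x}"
| "eregs (Arr a e) = eregs e"
| "eregs (Inc e) = eregs e"
| "eregs (Dec e) = eregs e"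

fun earrs :: "exp \<Rightarrow> string set" where
  "earrs (Const c) = {}"
| "earrs (Reg x) = {}"
| "earrs (Arr a e) = insert a (earrs e)"
| "earrs (Inc e) = earrs e"
| "earrs (Dec e) = earrs e"

fun tregs :: "test \<Rightarrow> string set" where
  "tregs (Less e f) = eregs e \<union> eregs f"
| "tregs (Neg b) = tregs b"
| "tregs (Conj b d) = tregs b \<union> tregs d"

fun tarrs :: "test \<Rightarrow> string set" where
  "tarrs (Less e f) = earrs e \<union> earrs f"
| "tarrs (Neg b) = tarrs b"
| "tarrs (Conj b d) = tarrs b \<union> tarrs d"

fun rregs :: "prog \<Rightarrow> string set" where
  "rregs Skip = {}"
| "rregs (Assign x e) = eregs e"
| "rregs (Store a e f) = eregs e \<union> eregs f"
| "rregs (Seq p q) = rregs p \<union> rregs q"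
| "rregs (Cond b p q) = tregs b \<union> rregs p \<union> rregs q"
| "rregs (While b p) = tregs b \<union> rregs p"

fun rarrs :: "prog \<Rightarrow> string set" where
  "rarrs Skip = {}"
| "rarrs (Assign x e) = earrs e"
| "rarrs (Store a e f) = insert a (earrs e \<union> earrs f)"
| "rarrs (Seq p q) = rarrs p \<union> rarrs q"
| "rarrs (Cond b p q) = tarrs b \<union> rarrs p \<union> rarrs q"
| "rarrs (While b p) = tarrs b \<union> rarrs p"

definition agree :: "string set \<Rightarrow> string set \<Rightarrow> store \<Rightarrow> store \<Rightarrow> bool" where
  "agree X Y s r \<longleftrightarrow> (\<forall>x. x \<notin> X \<longrightarrow> regs s x = regs r x) \<and> (\<forall>a. a \<notin> Y \<longrightarrow> arrs s a = arrs r a)"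

lemma eval_exp_agree:
  "agree X Y s r \<Longrightarrow> eregs e \<inter> X = {} \<Longrightarrow> earrs e \<inter> Y = {} \<Longrightarrow> eval_exp e s = eval_exp e r"
  by (induction e) (auto simp: agree_def)

lemma eval_test_agree:
  "agree X Y s r \<Longrightarrow> tregs b \<inter> X = {} \<Longrightarrow> tarrs b \<inter> Y = {} \<Longrightarrow> eval_test b s = eval_test b r"
  by (induction b) (auto simp: eval_exp_agree Int_Un_distrib2)

text \<open>Transfers the run of \<open>Kernelize\<close> to a memory that also holds a dominating
  set of the kernel; time, output and log stay the same.\<close>

lemma exec_agree:
  assumes "exec p s t s'" "agree X Y s r" "rregs p \<inter> X = {}" "rarrs p \<inter> Y = {}"
  shows "\<exists>r'. exec p r t r' \<and> agree X Y s' r'"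
  using assms
proof (induction arbitrary: r rule: exec.induct)
  case (Skip s)
  then show ?case using exec.Skip by blast
next
  case (Assign x e s)
  then have "eval_exp e s = eval_exp e r" by (auto intro: eval_exp_agree)
  then have "agree X Y (Mem ((regs s)(x := eval_exp e s)) (arrs s))
      (Mem ((regs r)(x := eval_exp e r)) (arrs r))"
    using Assign.prems(1) by (auto simp: agree_def)
  then show ?case using exec.Assign by blast
next
  case (Store a e f s)
  then have "eval_exp e s = eval_exp e r" "eval_exp f s = eval_exp f r"
    by (auto intro!: eval_exp_agree)
  then have "agree X Y (Mem (regs s) ((arrs s)(a := (arrs s a)(eval_exp e s := eval_exp f s))))
      (Mem (regs r) ((arrs r)(a := (arrs r a)(eval_exp e r := eval_exp f r))))"
    using Store.prems by (auto simp: agree_def)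
  then show ?case using exec.Store by blast
next
  case (Seq p s t s' q t' s'')
  obtain r' where 1: "exec p r t r'" "agree X Y s' r'" using Seq.IH(1)[OF Seq.prems(1)] Seq.prems by (auto simp: Int_Un_distrib2)
  obtain r'' where 2: "exec q r' t' r''" "agree X Y s'' r''"
    using Seq.IH(2)[OF 1(2)] Seq.prems by (auto simp: Int_Un_distrib2)
  show ?case using exec.Seq[OF 1(1) 2(1)] 2 by blast
next
  case (CondTrue b s p t s' q)
  moreover have "eval_test b r"
    using eval_test_agree[OF CondTrue.prems(1), of b] CondTrue by (auto simp: Int_Un_distrib2)
  ultimately show ?case by (metis Int_Un_distrib2 Un_empty exec.CondTrue rregs.simps(5) rarrs.simps(5))
next
  case (CondFalse b s q t s' p)
  moreover have "\<not> eval_test b r"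
    using eval_test_agree[OF CondFalse.prems(1), of b] CondFalse by (auto simp: Int_Un_distrib2)
  ultimately show ?case by (metis Int_Un_distrib2 Un_empty exec.CondFalse rregs.simps(5) rarrs.simps(5))
next
  case (WhileFalse b s p)
  moreover have "\<not> eval_test b r"
    using eval_test_agree[OF WhileFalse.prems(1), of b] WhileFalse by (auto simp: Int_Un_distrib2)
  ultimately show ?case using exec.WhileFalse by blast
next
  case (WhileTrue b s p t s' t' s'')
  have b: "eval_test b r"
    using eval_test_agree[OF WhileTrue.prems(1), of b] WhileTrue by (auto simp: Int_Un_distrib2)
  obtain r' where 1: "exec p r t r'" "agree X Y s' r'" using WhileTrue.IH(1)[OF WhileTrue.prems(1)] WhileTrue.prems by (auto simp: Int_Un_distrib2)
  obtain r'' where 2: "exec (While b p) r' t' r''" "agree X Y s'' r''"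
    using WhileTrue.IH(2)[OF 1(2)] WhileTrue.prems by auto
  show ?case using exec.WhileTrue[OF b 1(1) 2(1)] 2 by blast
qed

section \<open>Counting loops and traversal of adjacency lists\<close>

definition Loop :: "string \<Rightarrow> string \<Rightarrow> prog \<Rightarrow> prog" where
  "Loop i n b = Seq (Assign i (Const 0))
     (While (Less (Reg i) (Reg n)) (Seq b (Assign i (Inc (Reg i)))))"

text \<open>The invariant is indexed by the number of completed rounds, and \<open>ins\<close> makes
  it blind to the counter register. The 2 steps charged per round are the test and the
  increment.\<close>

lemma wp_Loop:
  assumes fr: "i \<notin> wregs b" "n \<notin> wregs b" "i \<noteq> n" and N: "regs s n = N"
    and ins: "\<And>c k s x. I c k s \<Longrightarrow> I c k (setr i x s)"
    and init: "1 \<le> k" "I 0 (k - 1) s"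
    and step: "\<And>c k s. I c k s \<Longrightarrow> regs s i = c \<Longrightarrow> regs s n = N \<Longrightarrow> c < N \<Longrightarrow>
        2 \<le> k \<and> wp b (I (Suc c)) (k - 2) s"
    and fin: "\<And>k s. I N k s \<Longrightarrow> 1 \<le> k \<and> Q (k - 1) s"
  shows "wp (Loop i n b) Q k s"
proof -
  let ?J = "\<lambda>k s. regs s i \<le> N \<and> regs s n = N \<and> I (regs s i) k s"
  have "wp (While (Less (Reg i) (Reg n)) (Seq b (Assign i (Inc (Reg i))))) Q (k - 1) (setr i 0 s)"
  proof (rule wp_While[where I = ?J])
    show "?J (k - 1) (setr i 0 s)" using ins init(2) N fr by auto
  next
    fix k s assume "?J k s"
    then show "1 \<le> k" using step[of "regs s i" k s] fin[of k s] by (cases "regs s i < N") auto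
  next
    fix k s assume J: "?J k s" and "eval_test (Less (Reg i) (Reg n)) s"
    then have lt: "regs s i < N" by simp
    have k2: "2 \<le> k" and w: "wp b (I (Suc (regs s i))) (k - 2) s"
      using step[of "regs s i" k s] J lt by auto
    have "wp b (\<lambda>k' s'. 1 \<le> k' \<and> I (Suc (regs s i)) (k' - 1) s') (k - 1) s"
      using wp_pay[of b "I (Suc (regs s i))" "k - 1" 1 s] w k2 by (simp add: numeral_2_eq_2)
    then show "wp (Seq b (Assign i (Inc (Reg i)))) ?J (k - 1) s"
      unfolding wp_Seq by (rule wp_frame) (use J lt fr ins in auto)
  next
    fix k s assume "?J k s" "\<not> eval_test (Less (Reg i) (Reg n)) s"
    then show "Q (k - 1) s" using fin by auto
  qed
  then show ?thesis unfolding Loop_def using init by simp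
qed

text \<open>Zero is the null pointer: cells are numbered from 1, so fresh memory represents empty
  lists.\<close>

fun linked :: "(nat \<Rightarrow> nat) \<Rightarrow> nat \<Rightarrow> nat list \<Rightarrow> bool" where
  "linked f j [] \<longleftrightarrow> j = 0"
| "linked f j (h # hs) \<longleftrightarrow> j = h \<and> 0 < h \<and> linked f (f h) hs"

definition adj :: "store \<Rightarrow> nat \<Rightarrow> nat list \<Rightarrow> bool" where
  "adj s v ys \<longleftrightarrow> (\<exists>hs. linked (arrs s ''nx'') (arrs s ''hd'' v) hs \<and> map (arrs s ''to'') hs = ys)"

definition ForNb :: "string \<Rightarrow> string \<Rightarrow> string \<Rightarrow> prog \<Rightarrow> prog" where
  "ForNb j y v b = Seq (Assign j (Arr ''hd'' (Reg v)))
     (While (Less (Const 0) (Reg j)) (Seq (Assign y (Arr ''to'' (Reg j)))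
        (Seq b (Assign j (Arr ''nx'' (Reg j))))))"

text \<open>The invariant is indexed by the neighbours still to come. The 3 steps charged per round
  are the test and the assignments to \<open>y\<close> and \<open>j\<close>.\<close>

lemma wp_ForNb:
  assumes fr: "j \<notin> wregs b" "''nx'' \<notin> warrs b" "''to'' \<notin> warrs b" "j \<noteq> y"
    and adj: "adj s (regs s v) ys"
    and ins: "\<And>zs k s x. I zs k s \<Longrightarrow> I zs k (setr j x s)"
    and insy: "\<And>zs k s x. I zs k s \<Longrightarrow> I zs k (setr y x s)"
    and init: "1 \<le> k" "I ys (k - 1) s"
    and step: "\<And>z zs k s. I (z # zs) k s \<Longrightarrow> regs s y = z \<Longrightarrow>
        3 \<le> k \<and> wp b (I zs) (k - 3) s"
    and fin: "\<And>k s. I [] k s \<Longrightarrow> 1 \<le> k \<and> Q (k - 1) s"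
  shows "wp (ForNb j y v b) Q k s"
proof -
  obtain hs where hs: "linked (arrs s ''nx'') (arrs s ''hd'' (regs s v)) hs"
      "map (arrs s ''to'') hs = ys" using adj by (auto simp: adj_def)
  define nx to' where "nx = arrs s ''nx''" and "to' = arrs s ''to''"
  let ?J = "\<lambda>k s. arrs s ''nx'' = nx \<and> arrs s ''to'' = to' \<and>
     (\<exists>hs. linked nx (regs s j) hs \<and> I (map to' hs) k s)"
  have pos: "1 \<le> k" if "I zs k s" for zs k s
  proof (cases zs)
    case Nil
    then show ?thesis using fin that by blast
  next
    case (Cons z zs')
    then show ?thesis using step[of z zs' k "setr y z s"] insy[OF that] by auto
  qed
  have "wp (While (Less (Const 0) (Reg j)) (Seq (Assign y (Arr ''to'' (Reg j)))
        (Seq b (Assign j (Arr ''nx'' (Reg j)))))) Q (k - 1) (setr j (arrs s ''hd'' (regs s v)) s)"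
  proof (rule wp_While[where I = ?J])
    show "?J (k - 1) (setr j (arrs s ''hd'' (regs s v)) s)" using ins init(2) hs fr
      by (auto simp: nx_def to'_def)
  next
    fix k s assume "?J k s"
    then show "1 \<le> k" using pos by blast
  next
    fix k s assume J: "?J k s" and "eval_test (Less (Const 0) (Reg j)) s"
    then obtain h hs where h: "linked nx (regs s j) (h # hs)" "I (map to' (h # hs)) k s"
      by (metis bot_nat_0.not_eq_extremum eval_exp.simps(1,2) eval_test.simps(1) less_irrefl
          linked.simps(1) neq_Nil_conv)
    let ?s = "setr y (to' h) s"
    have k3: "3 \<le> k" and w: "wp b (I (map to' hs)) (k - 3) ?s"
      using step[of "to' h" "map to' hs" k ?s] h(2) insy by auto
    have "wp b (\<lambda>k' s'. 1 \<le> k' \<and> I (map to' hs) (k' - 1) s') (k - 2) ?s"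
      using wp_pay[of b "I (map to' hs)" "k - 2" 1 ?s] w k3 by (simp add: numeral_eq_Suc)
    then have "wp (Seq b (Assign j (Arr ''nx'' (Reg j)))) ?J (k - 2) ?s"
      unfolding wp_Seq
    proof (rule wp_frame)
      fix k' s' assume a: "1 \<le> k' \<and> I (map to' hs) (k' - 1) s'"
        and f: "\<And>x. x \<notin> wregs b \<Longrightarrow> regs s' x = regs ?s x"
        "\<And>a. a \<notin> warrs b \<Longrightarrow> arrs s' a = arrs ?s a"
      have "regs s' j = h" "arrs s' ''nx'' = nx" "arrs s' ''to'' = to'"
        using f fr J h by auto
      then show "wp (Assign j (Arr ''nx'' (Reg j))) ?J k' s'"
        using a ins h by auto
    qed
    then show "wp (Seq (Assign y (Arr ''to'' (Reg j))) (Seq b (Assign j (Arr ''nx'' (Reg j))))) ?J (k - 1) s"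
      using J k3 h by (simp add: numeral_2_eq_2)
  next
    fix k s assume J: "?J k s" "\<not> eval_test (Less (Const 0) (Reg j)) s"
    then obtain hs where h: "linked nx 0 hs" "I (map to' hs) k s" by auto
    then have "hs = []" by (cases hs) auto
    then show "Q (k - 1) s" using fin h by auto
  qed
  then show ?thesis unfolding ForNb_def using init by simp
qed

section \<open>Forests and reductions of instances\<close>

definition nbh :: "'a set set \<Rightarrow> 'a \<Rightarrow> 'a set" where
  "nbh E v = {y. {v, y} \<in> E}"

definition ind :: "'a set set \<Rightarrow> 'a set \<Rightarrow> 'a set set" where
  "ind E A = {e \<in> E. e \<subseteq> A}"

lemma simple_graphD:
  assumes "simple_graph V E" "{u, v} \<in> E"
  shows "u \<noteq> v" "u \<in> V" "v \<in> V"
proof -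
  have "{u, v} \<subseteq> V" "card {u, v} = 2" using assms unfolding simple_graph_def by blast+
  then show "u \<noteq> v" "u \<in> V" "v \<in> V" by auto
qed

lemma simple_graph_edge:
  assumes "simple_graph V E" "e \<in> E"
  obtains u v where "e = {u, v}" "u \<noteq> v" "u \<in> V" "v \<in> V"
  using assms unfolding simple_graph_def by (metis card_2_iff insert_subset)

lemma simple_graph_finite: "simple_graph V E \<Longrightarrow> finite E"
  unfolding simple_graph_def by (rule finite_subset[of _ "Pow V"]) auto

lemma nbh_subset: "simple_graph V E \<Longrightarrow> nbh E v \<subseteq> V - {v}"
  by (auto simp: nbh_def dest: simple_graphD)

lemma nbh_sym: "y \<in> nbh E v \<longleftrightarrow> v \<in> nbh E y"
  by (simp add: nbh_def insert_commute)

lemma nbh_ind: "v \<in> A \<Longrightarrow> nbh (ind E A) v = nbh E v \<inter> A"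
  by (auto simp: nbh_def ind_def)

lemma simple_graph_ind: "simple_graph V E \<Longrightarrow> A \<subseteq> V \<Longrightarrow> simple_graph A (ind E A)"
  unfolding simple_graph_def ind_def using finite_subset by auto

lemma card_nbh: assumes "simple_graph V E" shows "card (nbh E v) = card {e \<in> E. v \<in> e}"
proof (rule bij_betw_same_card[of "\<lambda>y. {v, y}"], rule bij_betwI')
  fix e assume e: "e \<in> {e \<in> E. v \<in> e}"
  then obtain a b where "e = {a, b}" using simple_graph_edge[OF assms] by blast
  with e have "e = {v, a} \<or> e = {v, b}" by auto
  with e show "\<exists>x\<in>nbh E v. e = {v, x}" by (auto simp: nbh_def)
qed (auto simp: nbh_def doubleton_eq_iff)

lemma handshake:
  assumes "simple_graph V E" shows "(\<Sum>v\<in>V. card (nbh E v)) = 2 * card E"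
proof -
  have fV: "finite V" using assms by (simp add: simple_graph_def)
  have "card {v \<in> V. v \<in> e} = 2" if "e \<in> E" for e
  proof -
    have "e \<subseteq> V" "card e = 2" using that assms by (auto simp: simple_graph_def)
    then have "{v \<in> V. v \<in> e} = e" by auto
    then show ?thesis using \<open>card e = 2\<close> by simp
  qed
  then show ?thesis
    using sum_multicount[OF fV simple_graph_finite[OF assms], of "\<lambda>v e. v \<in> e" 2]
    by (simp add: card_nbh[OF assms])
qed

definition walk :: "'a set set \<Rightarrow> 'a list \<Rightarrow> bool" where
  "walk E p \<longleftrightarrow> distinct p \<and> (\<forall>i. Suc i < length p \<longrightarrow> {p ! i, p ! Suc i} \<in> E)"

text \<open>Take a longest path. All neighbours of its first vertex lie on it, and one other than
  the second vertex would close a cycle.\<close>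

lemma forest_has_leaf:
  assumes g: "simple_graph V E" and f: "forest E" and "V \<noteq> {}"
  shows "\<exists>v\<in>V. card (nbh E v) \<le> 1"
proof (rule ccontr)
  assume "\<not> ?thesis"
  then have deg: "\<And>v. v \<in> V \<Longrightarrow> 2 \<le> card (nbh E v)" by force
  have fV: "finite V" using g by (simp add: simple_graph_def)
  let ?P = "\<lambda>p. walk E p \<and> set p \<subseteq> V \<and> p \<noteq> []"
  have len: "length p \<le> card V" if "?P p" for p
    using that fV by (metis card_mono distinct_card walk_def)
  obtain v where "v \<in> V" using \<open>V \<noteq> {}\<close> by blast
  then have "?P [v]" by (simp add: walk_def)
  then obtain p where p: "?P p" and mx: "\<And>q. ?P q \<Longrightarrow> length q \<le> length p"
    using ex_has_greatest_nat[of ?P "[v]" length "Suc (card V)"] len le_imp_less_Suc by blast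
  obtain x ps where xp: "p = x # ps" using p by (cases p) auto
  have "x \<in> V" using p xp by auto
  have "nbh E x \<subseteq> set p"
  proof
    fix y assume y: "y \<in> nbh E x"
    show "y \<in> set p"
    proof (rule ccontr)
      assume "y \<notin> set p"
      then have "?P (y # p)" using p y xp nbh_subset[OF g, of x]
        by (auto simp: walk_def nbh_def insert_commute nth_Cons split: nat.splits)
      then show False using mx by force
    qed
  qed
  obtain y where y: "y \<in> nbh E x" "y \<noteq> p ! 1"
  proof -
    have "\<not> nbh E x \<subseteq> {p ! 1}"
      using deg[OF \<open>x \<in> V\<close>] card_mono[of "{p ! 1}" "nbh E x"] by auto
    then show ?thesis using that by blast
  qed
  obtain i where i: "i < length p" "p ! i = y" using y(1) \<open>nbh E x \<subseteq> set p\<close> by (metis in_set_conv_nth subsetD)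
  have "y \<noteq> x" using nbh_subset[OF g, of x] y by blast
  \<comment> \<open>\<open>y\<close> is neither the first nor the second entry, so the prefix that
    ends in \<open>y\<close> has the three vertices that a cycle requires.\<close>
  then have i2: "2 \<le> i" using i y xp by (cases i; cases "i - 1") auto
  let ?c = "take (Suc i) p"
  have "{?c ! j, ?c ! (Suc j mod length ?c)} \<in> E" if "j < length ?c" for j
  proof (cases "j = i")
    case True
    then have "?c ! j = y" using i nth_take[of i "Suc i" p] by simp
    moreover have "?c ! (Suc j mod length ?c) = x" using True i xp by auto
    ultimately have "?c ! j = y" "?c ! (Suc j mod length ?c) = x" by blast+
    then show ?thesis using y by (simp add: nbh_def insert_commute)
  next
    case False
    then have "j < i" using that by simp
    then show ?thesis using i p by (auto simp: walk_def)
  qed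
  then have "is_cycle E ?c" using i i2 p unfolding is_cycle_def walk_def by auto
  then show False using f by (auto simp: forest_def)
qed

lemma forest_mono: "forest E \<Longrightarrow> E' \<subseteq> E \<Longrightarrow> forest E'"
  unfolding forest_def is_cycle_def by (meson subsetD)

text \<open>Deleting a vertex of degree at most one removes at most one edge.\<close>

lemma forest_card:
  assumes "simple_graph V E" "forest E" "V \<noteq> {}"
  shows "card E < card V"
  using assms
proof (induction "card V" arbitrary: V E rule: less_induct)
  case less
  have fV: "finite V" using less.prems by (simp add: simple_graph_def)
  obtain v where v: "v \<in> V" "card (nbh E v) \<le> 1" using forest_has_leaf less.prems by metis
  let ?V = "V - {v}" and ?E = "{e \<in> E. v \<notin> e}"
  have g': "simple_graph ?V ?E" using less.prems(1) by (auto simp: simple_graph_def)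
  have "E = ?E \<union> {e \<in> E. v \<in> e}" by auto
  then have cE: "card E \<le> card ?E + card (nbh E v)"
    using card_nbh[OF less.prems(1)] card_Un_le by metis
  show ?case
  proof (cases "?V = {}")
    case True
    then have "V = {v}" using v by auto
    then have "E = {}" using less.prems(1) simple_graph_edge by (metis all_not_in_conv singletonD)
    then show ?thesis using \<open>V = {v}\<close> by simp
  next
    case False
    have "card ?V < card V" using v fV by (meson card_Diff1_less)
    then have "card ?E < card ?V"
      using less.hyps[OF _ g' forest_mono[OF less.prems(2)] False] by blast
    then show ?thesis using cE v \<open>card ?V < card V\<close> by linarith
  qed
qed

section \<open>Reductions as maps between dominating sets, and the leaf rules\<close>

text \<open>\<open>L\<close> is the lift, and \<open>r\<close> is the amount by which the domination
  numbers differ. Both inequalities range over all dominating sets, which makes them compose;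
  \<open>L D \<inter> V' = D\<close> ensures that a lift only adds vertices outside the smaller
  instance, as the set \<open>S\<close> must.\<close>

definition reduction ::
  "'a set \<Rightarrow> 'a set set \<Rightarrow> 'a set \<Rightarrow> 'a set \<Rightarrow> 'a set set \<Rightarrow> 'a set \<Rightarrow> ('a set \<Rightarrow> 'a set) \<Rightarrow> bool" where
  "reduction V E W V' E' W' L \<longleftrightarrow> V' \<subseteq> V \<and>
     (\<forall>D. dominating V' E' W' D \<longrightarrow> dominating V E W (L D) \<and> L D \<inter> V' = D) \<and>
     (\<exists>r. (\<forall>D. dominating V' E' W' D \<longrightarrow> card (L D) \<le> card D + r) \<and>
          (\<forall>T. dominating V E W T \<longrightarrow> (\<exists>D. dominating V' E' W' D \<and> card D + r \<le> card T)))"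

lemma reductionI:
  assumes "V' \<subseteq> V"
    and "\<And>D. dominating V' E' W' D \<Longrightarrow> dominating V E W (L D)"
    and "\<And>D. dominating V' E' W' D \<Longrightarrow> L D \<inter> V' = D"
    and "\<And>D. dominating V' E' W' D \<Longrightarrow> card (L D) \<le> card D + r"
    and "\<And>T. dominating V E W T \<Longrightarrow> \<exists>D. dominating V' E' W' D \<and> card D + r \<le> card T"
  shows "reduction V E W V' E' W' L"
  using assms unfolding reduction_def by blast

lemma reduction_refl: "reduction V E W V E W (\<lambda>D. D)"
  by (rule reductionI[of _ _ _ _ _ _ _ 0]) (auto simp: dominating_def)

lemma reduction_trans:
  assumes "reduction V E W V' E' W' L" "reduction V' E' W' V'' E'' W'' M"
  shows "reduction V E W V'' E'' W'' (\<lambda>D. L (M D))"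
proof -
  obtain r q where r: "\<And>D. dominating V' E' W' D \<Longrightarrow> card (L D) \<le> card D + r"
      "\<And>T. dominating V E W T \<Longrightarrow> \<exists>D. dominating V' E' W' D \<and> card D + r \<le> card T"
    and q: "\<And>D. dominating V'' E'' W'' D \<Longrightarrow> card (M D) \<le> card D + q"
      "\<And>T. dominating V' E' W' T \<Longrightarrow> \<exists>D. dominating V'' E'' W'' D \<and> card D + q \<le> card T"
    using assms unfolding reduction_def by metis
  have V: "V' \<subseteq> V" "V'' \<subseteq> V'" using assms by (auto simp: reduction_def)
  have d: "dominating V' E' W' (M D)" "M D \<inter> V'' = D" if "dominating V'' E'' W'' D" for D
    using assms(2) that by (auto simp: reduction_def)
  have e: "dominating V E W (L D)" "L D \<inter> V' = D" if "dominating V' E' W' D" for D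
    using assms(1) that by (auto simp: reduction_def)
  show ?thesis
  proof (rule reductionI[of _ _ _ _ _ _ _ "r + q"])
    fix D assume D: "dominating V'' E'' W'' D"
    have "L (M D) \<inter> V'' = L (M D) \<inter> V' \<inter> V''" using V by auto
    then show "L (M D) \<inter> V'' = D" using d[OF D] e by simp
    show "card (L (M D)) \<le> card D + (r + q)" using r(1)[OF d(1)[OF D]] q(1)[OF D] by linarith
  next
    fix T assume "dominating V E W T"
    then obtain D where D: "dominating V' E' W' D" "card D + r \<le> card T" using r by blast
    then obtain D' where "dominating V'' E'' W'' D'" "card D' + q \<le> card D" using q by blast
    then show "\<exists>D. dominating V'' E'' W'' D \<and> card D + (r + q) \<le> card T"
      using D by (intro exI[of _ D']) auto
  qed (use V d e in auto)
qed

text \<open>For any \<open>T\<close> and the set \<open>D'\<close> derived from it: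
  \<open>card (L D) <= card D + r <= card D' + r <= card T\<close>.\<close>

lemma reduction_minimum:
  assumes "reduction V E W V' E' W' L" "minimum_dominating V' E' W' D"
  shows "minimum_dominating V E W (L D)" "L D \<inter> V' = D"
proof -
  have D: "dominating V' E' W' D" and m: "\<And>T. dominating V' E' W' T \<Longrightarrow> card D \<le> card T"
    using assms(2) by (auto simp: minimum_dominating_def)
  obtain r where r: "\<And>D. dominating V' E' W' D \<Longrightarrow> card (L D) \<le> card D + r"
      "\<And>T. dominating V E W T \<Longrightarrow> \<exists>D. dominating V' E' W' D \<and> card D + r \<le> card T"
    using assms(1) unfolding reduction_def by metis
  have "card (L D) \<le> card T" if "dominating V E W T" for T
    using r(2)[OF that] m r(1)[OF D] by (meson add_le_mono1 order_trans)
  then show "minimum_dominating V E W (L D)"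
    using assms(1) D by (simp add: minimum_dominating_def reduction_def)
  show "L D \<inter> V' = D" using assms(1) D by (simp add: reduction_def)
qed

lemma dominating_Int: "dominating V E (W \<inter> V) D \<longleftrightarrow> dominating V E W D"
  unfolding dominating_def by auto

lemma dominating_finite: "finite V \<Longrightarrow> dominating V E W D \<Longrightarrow> finite D"
  using finite_subset by (auto simp: dominating_def)

lemma dominating_ind:
  "dominating A (ind E A) W D \<longleftrightarrow> D \<subseteq> A \<and> (\<forall>v\<in>A - W. v \<in> D \<or> nbh E v \<inter> D \<noteq> {})"
  unfolding dominating_def ind_def nbh_def by (auto simp: insert_commute)

text \<open>A selected leaf can be exchanged for its neighbour, if there is one: the neighbour is
  all that an exempt leaf is good for.\<close>

lemma reduction_free_leaf:
  assumes g: "simple_graph V E" and A: "A \<subseteq> V" and v: "v \<in> A" "v \<in> W" and c: "card (nbh E v \<inter> A) \<le> 1"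
  shows "reduction A (ind E A) W (A - {v}) (ind E (A - {v})) W (\<lambda>D. D)"
proof (rule reductionI[of _ _ _ _ _ _ _ 0])
  fix D assume "dominating (A - {v}) (ind E (A - {v})) W D"
  then show "dominating A (ind E A) W D" using v unfolding dominating_ind by auto
next
  fix T assume T: "dominating A (ind E A) W T"
  have fT: "finite T" using T A g by (meson dominating_finite finite_subset simple_graph_def)
  show "\<exists>D. dominating (A - {v}) (ind E (A - {v})) W D \<and> card D + 0 \<le> card T"
  proof (cases "v \<in> T")
    case True
    let ?D = "T - {v} \<union> (nbh E v \<inter> A)"
    have "v \<notin> nbh E v" using nbh_subset[OF g, of v] by auto
    moreover have "u \<in> nbh E v" if "v \<in> nbh E u" for u using that by (simp add: nbh_sym)
    ultimately have "dominating (A - {v}) (ind E (A - {v})) W ?D"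
      using T unfolding dominating_ind by auto
    moreover have "card ?D \<le> card (T - {v}) + 1" using c card_Un_le[of "T - {v}" "nbh E v \<inter> A"] by linarith
    moreover have "card (T - {v}) + 1 = card T" using True fT by (metis Suc_eq_plus1 card_Suc_Diff1)
    ultimately show ?thesis by auto
  next
    case False
    then have "dominating (A - {v}) (ind E (A - {v})) W T" using T unfolding dominating_ind by auto
    then show ?thesis by auto
  qed
qed (auto simp: dominating_def)

lemma reduction_isolated:
  assumes g: "simple_graph V E" and A: "A \<subseteq> V" and v: "v \<in> A" "v \<notin> W" and c: "nbh E v \<inter> A = {}"
  shows "reduction A (ind E A) W (A - {v}) (ind E (A - {v})) W (\<lambda>D. insert v D)"
proof (rule reductionI[of _ _ _ _ _ _ _ 1])
  fix D assume D: "dominating (A - {v}) (ind E (A - {v})) W D"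
  then show "dominating A (ind E A) W (insert v D)" using v unfolding dominating_ind by auto
  have "finite D" using D A g by (meson dominating_finite finite_subset simple_graph_def finite_Diff)
  then show "card (insert v D) \<le> card D + 1" by (simp add: card_insert_if)
next
  fix T assume T: "dominating A (ind E A) W T"
  have fT: "finite T" using T A g by (meson dominating_finite finite_subset simple_graph_def)
  have "v \<in> T" using T c v unfolding dominating_ind by blast
  moreover have "v \<notin> nbh E u" if "u \<in> A" for u using c that by (auto simp: nbh_sym)
  ultimately have "dominating (A - {v}) (ind E (A - {v})) W (T - {v})"
    using T unfolding dominating_ind by auto
  moreover have "card (T - {v}) + 1 = card T" using \<open>v \<in> T\<close> fT by (metis Suc_eq_plus1 card_Suc_Diff1)
  ultimately show "\<exists>D. dominating (A - {v}) (ind E (A - {v})) W D \<and> card D + 1 \<le> card T" by (intro exI[of _ "T - {v}"]) simp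
qed (auto simp: dominating_def)

text \<open>Domination of \<open>v\<close> forces a choice from \<open>{v, p}\<close>, and
  \<open>p\<close> is the better one because it dominates whatever \<open>v\<close> dominates.
  Removing both from \<open>T\<close> gains at least one vertex, and everything that they dominated
  in the rest is now exempt.\<close>

lemma reduction_leaf:
  assumes g: "simple_graph V E" and A: "A \<subseteq> V" and v: "v \<in> A" "v \<notin> W" and c: "nbh E v \<inter> A = {p}"
  shows "reduction A (ind E A) W (A - {v} - {p}) (ind E (A - {v} - {p})) (W \<union> nbh E p) (\<lambda>D. insert p D)"
proof (rule reductionI[of _ _ _ _ _ _ _ 1])
  have p: "p \<in> A" "p \<in> nbh E v" "v \<in> nbh E p" "p \<noteq> v" using c nbh_subset[OF g, of v] by (auto simp: nbh_sym)
  show "A - {v} - {p} \<subseteq> A" by auto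
  fix D assume D: "dominating (A - {v} - {p}) (ind E (A - {v} - {p})) (W \<union> nbh E p) D"
  have "D \<subseteq> A" using D by (auto simp: dominating_def)
  moreover have "u \<in> insert p D \<or> nbh E u \<inter> insert p D \<noteq> {}" if "u \<in> A - W" for u
  proof (cases "u = v \<or> u = p \<or> u \<in> nbh E p")
    case True
    then show ?thesis using p by (auto simp: nbh_sym)
  next
    case False
    then show ?thesis using D that unfolding dominating_ind by auto
  qed
  ultimately show "dominating A (ind E A) W (insert p D)" using p unfolding dominating_ind by auto
  have "finite D" using D A g by (meson dominating_finite finite_subset simple_graph_def finite_Diff)
  then show "card (insert p D) \<le> card D + 1" by (simp add: card_insert_if)
  show "insert p D \<inter> (A - {v} - {p}) = D" using D by (auto simp: dominating_def)
next
  fix T assume T: "dominating A (ind E A) W T"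
  have fT: "finite T" using T A g by (meson dominating_finite finite_subset simple_graph_def)
  have u: "nbh E u \<inter> (T - {v, p}) \<noteq> {}"
    if u: "u \<in> A" "u \<notin> W" "u \<noteq> v" "u \<noteq> p" "u \<notin> nbh E p" "u \<notin> T" for u
  proof -
    obtain t where t: "t \<in> nbh E u" "t \<in> T" using T u unfolding dominating_ind by blast
    have "t \<noteq> v" using t u c nbh_sym[of t E u] by blast
    moreover have "t \<noteq> p" using t u nbh_sym[of t E u] by blast
    ultimately show ?thesis using t by blast
  qed
  have "T \<inter> {v, p} \<noteq> {}" using T v c unfolding dominating_ind by blast
  then have "card (T - {v, p}) < card T" using fT by (intro psubset_card_mono) auto
  moreover have "dominating (A - {v} - {p}) (ind E (A - {v} - {p})) (W \<union> nbh E p) (T - {v, p})"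
    unfolding dominating_ind using T u by (auto simp: dominating_def)
  ultimately show "\<exists>D. dominating (A - {v} - {p}) (ind E (A - {v} - {p})) (W \<union> nbh E p) D \<and> card D + 1 \<le> card T"
    by (intro exI[of _ "T - {v, p}"]) simp
qed

section \<open>Replacing a segment of a path by an edge\<close>

text \<open>The difference \<open>{{p, z}} - {{p}}\<close> is empty exactly if \<open>p = z\<close>;
  it keeps a path that returns to its own end from becoming a loop.\<close>

definition cut :: "'a set set \<Rightarrow> 'a set \<Rightarrow> 'a \<Rightarrow> 'a \<Rightarrow> 'a set set" where
  "cut E R p z = {e \<in> E. e \<inter> R = {}} \<union> ({{p, z}} - {{p}})"

text \<open>Common argument of all word rules for a segment \<open>R\<close> with first vertex
  \<open>a\<close> and last vertex \<open>c\<close>. Upwards, \<open>X D\<close> dominates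
  \<open>R\<close>, and if an end was dominated over the new edge only, \<open>X D\<close> contains
  the vertex of \<open>R\<close> next to that end. Downwards, a set either spends more than
  \<open>r\<close> vertices on \<open>R\<close>, or it spends at least \<open>r\<close> and the ends
  do not need its help.\<close>

lemma reduction_cut:
  assumes fin: "finite V" and R: "R \<subseteq> V" "p \<in> V - R" "z \<in> V - R" "a \<in> R" "c \<in> R"
    and bd: "\<And>u v. u \<in> R \<Longrightarrow> v \<notin> R \<Longrightarrow> {u, v} \<in> E \<Longrightarrow> v = p \<and> u = a \<or> v = z \<and> u = c"
    and ed: "{a, p} \<in> E" "{c, z} \<in> E"
    and X: "\<And>D. X D \<subseteq> R" "\<And>D. card (X D) \<le> r"
    and inner: "\<And>D v. v \<in> R - W \<Longrightarrow> v \<in> X D \<or> (\<exists>u\<in>D \<union> X D. {u, v} \<in> E)"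
    and outer: "\<And>D. p \<notin> D \<Longrightarrow> z \<in> D \<Longrightarrow> p \<notin> W \<Longrightarrow> a \<in> X D"
      "\<And>D. z \<notin> D \<Longrightarrow> p \<in> D \<Longrightarrow> z \<notin> W \<Longrightarrow> c \<in> X D"
    and drop: "\<And>T. (\<And>v. v \<in> R - W \<Longrightarrow> v \<in> T \<or> (\<exists>u\<in>T. {u, v} \<in> E)) \<Longrightarrow>
      r < card (T \<inter> R) \<or> r \<le> card (T \<inter> R) \<and> (a \<in> T \<longrightarrow> p \<in> W \<union> T \<or> z \<in> T) \<and> (c \<in> T \<longrightarrow> z \<in> W \<union> T \<or> p \<in> T)"
  shows "reduction V E W (V - R) (cut E R p z) W (\<lambda>D. D \<union> X D)"
proof (rule reductionI[of _ _ _ _ _ _ _ r])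
  fix D assume D: "dominating (V - R) (cut E R p z) W D"
  then have DV: "D \<subseteq> V - R" by (simp add: dominating_def)
  have "v \<in> D \<union> X D \<or> (\<exists>u\<in>D \<union> X D. {u, v} \<in> E)" if v: "v \<in> V - W" for v
  proof (cases "v \<in> R")
    case True
    then show ?thesis using inner v by blast
  next
    case False
    then consider "v \<in> D" | u where "u \<in> D" "{u, v} \<in> cut E R p z" using D v by (auto simp: dominating_def)
    then show ?thesis
    proof cases
      case (2 u)
      show ?thesis
      proof (cases "{u, v} \<in> E")
        case True
        then show ?thesis using 2 by blast
      next
        case False
        then have "{u, v} = {p, z}" using 2 by (auto simp: cut_def)
        then have "u = p \<and> v = z \<or> u = z \<and> v = p" by (auto simp: doubleton_eq_iff)
        then show ?thesis using 2 outer[of D] v ed by auto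
      qed
    qed auto
  qed
  then show "dominating V E W (D \<union> X D)" using DV X(1)[of D] R(1) unfolding dominating_def by blast
  show "(D \<union> X D) \<inter> (V - R) = D" using DV X(1)[of D] by blast
  show "card (D \<union> X D) \<le> card D + r" using card_Un_le[of D "X D"] X(2)[of D] by linarith
next
  fix T assume T: "dominating V E W T"
  have fT: "finite T" using T fin dominating_finite by metis
  have cT: "card T = card (T - R) + card (T \<inter> R)"
    using fT by (metis Int_Diff_Un Int_Diff_disjoint Int_commute add.commute card_Un_disjoint finite_Diff finite_Int)
  have key: "v \<in> T - R \<or> (\<exists>u\<in>T - R. {u, v} \<in> cut E R p z) \<or> v = p \<and> a \<in> T \<or> v = z \<and> c \<in> T"
    if v: "v \<in> V - R - W" for v
  proof (cases "v \<in> T")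
    case False
    then obtain u where u: "u \<in> T" "{u, v} \<in> E" using T v by (auto simp: dominating_def)
    show ?thesis
    proof (cases "u \<in> R")
      case True
      then show ?thesis using bd u v by blast
    next
      case False
      then have "{u, v} \<in> cut E R p z" using u v by (auto simp: cut_def)
      then show ?thesis using u False by blast
    qed
  qed (use v in auto)
  have pz: "p \<noteq> z \<Longrightarrow> {p, z} \<in> cut E R p z" "p \<noteq> z \<Longrightarrow> {z, p} \<in> cut E R p z"
    by (auto simp: cut_def)
  have TV: "T \<subseteq> V" using T by (simp add: dominating_def)
  have "v \<in> T \<or> (\<exists>u\<in>T. {u, v} \<in> E)" if "v \<in> R - W" for v
    using T R(1) that by (auto simp: dominating_def)
  then consider "r < card (T \<inter> R)" | "r \<le> card (T \<inter> R)" "a \<in> T \<Longrightarrow> p \<in> W \<union> T \<or> z \<in> T"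
      "c \<in> T \<Longrightarrow> z \<in> W \<union> T \<or> p \<in> T"
    using drop[of T] by blast
  then show "\<exists>D. dominating (V - R) (cut E R p z) W D \<and> card D + r \<le> card T"
  proof cases
    \<comment> \<open>One vertex saved in \<open>R\<close> pays for \<open>p\<close>, which
      dominates itself and, over the new edge, also \<open>z\<close>.\<close>
    case 1
    have "card (insert p (T - R)) \<le> card (T - R) + 1" using fT by (simp add: card_insert_if)
    moreover have "dominating (V - R) (cut E R p z) W (insert p (T - R))"
      unfolding dominating_def
    proof (intro conjI ballI)
      fix v assume "v \<in> V - R - W"
      then show "v \<in> insert p (T - R) \<or> (\<exists>u\<in>insert p (T - R). {u, v} \<in> cut E R p z)"
        using key[of v] pz by auto
    qed (use TV R in auto)
    ultimately show ?thesis using 1 cT by (intro exI[of _ "insert p (T - R)"]) auto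
  next
    \<comment> \<open>An end that was dominated from \<open>R\<close> is exempt, selected, or
      adjacent to the other end, which is selected.\<close>
    case 2
    have "dominating (V - R) (cut E R p z) W (T - R)"
      unfolding dominating_def
    proof (intro conjI ballI)
      fix v assume "v \<in> V - R - W"
      then show "v \<in> T - R \<or> (\<exists>u\<in>T - R. {u, v} \<in> cut E R p z)"
        using key[of v] pz 2 R by (cases "p = z") auto
    qed (use TV R in auto)
    then show ?thesis using 2 cT by (intro exI[of _ "T - R"]) auto
  qed
qed auto

text \<open>One record format for all lifts: the ends of the deleted segment and the vertex to add
  in each case, where a selected \<open>p\<close> takes precedence over \<open>z\<close>. A lift is
  then a table lookup in constant time.\<close>

fun lstep :: "'a \<times> 'a \<times> 'a \<times> 'a \<times> 'a \<Rightarrow> 'a set \<Rightarrow> 'a set" where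
  "lstep (p, z, a, b, c) D = D \<union> {if p \<in> D then a else if z \<in> D then b else c}"

text \<open>A selected end dominates the vertex next to it, so the far vertex of the segment is
  added; it covers the remaining two and the other end, just as the new edge did. If neither end is
  selected, the middle vertex covers all three. Conversely, a single selected \<open>a\<close>
  leaves \<open>c\<close> to \<open>z\<close> unless \<open>c\<close> is exempt, and a single
  selected \<open>c\<close> leaves \<open>a\<close> to \<open>p\<close>.\<close>

lemma reduction_path3:
  assumes fin: "finite V" and R: "{a, b, c} \<subseteq> V" "p \<in> V - {a, b, c}" "z \<in> V - {a, b, c}" "distinct [a, b, c]"
    and inc: "{e \<in> E. e \<inter> {a, b, c} \<noteq> {}} = {{p, a}, {a, b}, {b, c}, {c, z}}"
    and lab: "a \<notin> W" "b \<notin> W" "c \<in> W \<Longrightarrow> p \<in> W"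
  shows "reduction V E W (V - {a, b, c}) (cut E {a, b, c} p z) W (lstep (p, z, c, a, b))"
proof -
  have "{u, v} \<in> E \<longleftrightarrow> {u, v} \<in> {{p, a}, {a, b}, {b, c}, {c, z}}" if "v \<in> {a, b, c}" for u v
    using that unfolding inc[symmetric] by auto
  from this[of a] this[of b] this[of c]
  have N: "{u, a} \<in> E \<longleftrightarrow> u = p \<or> u = b" "{u, b} \<in> E \<longleftrightarrow> u = a \<or> u = c" "{u, c} \<in> E \<longleftrightarrow> u = b \<or> u = z" for u
    using R by (auto simp: doubleton_eq_iff)
  have N': "{a, u} \<in> E \<longleftrightarrow> u = p \<or> u = b" "{b, u} \<in> E \<longleftrightarrow> u = a \<or> u = c" "{c, u} \<in> E \<longleftrightarrow> u = b \<or> u = z" for u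
    using N by (metis insert_commute)+
  have eq: "lstep (p, z, c, a, b) = (\<lambda>D. D \<union> {if p \<in> D then c else if z \<in> D then a else b})"
    by (rule ext) simp
  show ?thesis unfolding eq
  proof (rule reduction_cut[where a = a and c = c and r = 1])
    fix T assume T: "\<And>v. v \<in> {a, b, c} - W \<Longrightarrow> v \<in> T \<or> (\<exists>u\<in>T. {u, v} \<in> E)"
    show "1 < card (T \<inter> {a, b, c}) \<or> 1 \<le> card (T \<inter> {a, b, c}) \<and>
      (a \<in> T \<longrightarrow> p \<in> W \<union> T \<or> z \<in> T) \<and> (c \<in> T \<longrightarrow> z \<in> W \<union> T \<or> p \<in> T)"
      using T[of a] T[of b] T[of c] lab R(4) N
      by (cases "a \<in> T"; cases "b \<in> T"; cases "c \<in> T"; cases "c \<in> W") (auto simp: Int_insert_right)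
  next
    fix D v assume "v \<in> {a, b, c} - W"
    then show "v \<in> {if p \<in> D then c else if z \<in> D then a else b} \<or>
      (\<exists>u\<in>D \<union> {if p \<in> D then c else if z \<in> D then a else b}. {u, v} \<in> E)"
      using lab N by auto
  qed (use fin R N N' in auto)
qed

text \<open>Only \<open>a\<close> and \<open>c\<close> need domination, and \<open>b\<close> serves
  both. If \<open>p\<close> is selected, it serves \<open>a\<close>, so \<open>d\<close> can serve
  \<open>c\<close> and \<open>z\<close> instead. As \<open>p\<close> is exempt, nothing has to be
  done for \<open>p\<close>.\<close>

lemma reduction_path4:
  assumes fin: "finite V" and R: "{a, b, c, d} \<subseteq> V" "p \<in> V - {a, b, c, d}" "z \<in> V - {a, b, c, d}"
      "distinct [a, b, c, d]"
    and inc: "{e \<in> E. e \<inter> {a, b, c, d} \<noteq> {}} = {{p, a}, {a, b}, {b, c}, {c, d}, {d, z}}"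
    and lab: "a \<notin> W" "b \<in> W" "c \<notin> W" "d \<in> W" "p \<in> W"
  shows "reduction V E W (V - {a, b, c, d}) (cut E {a, b, c, d} p z) W (lstep (p, z, d, b, b))"
proof -
  have "{u, v} \<in> E \<longleftrightarrow> {u, v} \<in> {{p, a}, {a, b}, {b, c}, {c, d}, {d, z}}" if "v \<in> {a, b, c, d}" for u v
    using that unfolding inc[symmetric] by auto
  from this[of a] this[of b] this[of c] this[of d]
  have N: "{u, a} \<in> E \<longleftrightarrow> u = p \<or> u = b" "{u, b} \<in> E \<longleftrightarrow> u = a \<or> u = c"
    "{u, c} \<in> E \<longleftrightarrow> u = b \<or> u = d" "{u, d} \<in> E \<longleftrightarrow> u = c \<or> u = z" for u
    using R by (auto simp: doubleton_eq_iff)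
  have N': "{a, u} \<in> E \<longleftrightarrow> u = p \<or> u = b" "{b, u} \<in> E \<longleftrightarrow> u = a \<or> u = c"
    "{c, u} \<in> E \<longleftrightarrow> u = b \<or> u = d" "{d, u} \<in> E \<longleftrightarrow> u = c \<or> u = z" for u
    using N by (metis insert_commute)+
  have eq: "lstep (p, z, d, b, b) = (\<lambda>D. D \<union> {if p \<in> D then d else b})"
    by (rule ext) simp
  show ?thesis unfolding eq
  proof (rule reduction_cut[where a = a and c = d and r = 1])
    fix T assume T: "\<And>v. v \<in> {a, b, c, d} - W \<Longrightarrow> v \<in> T \<or> (\<exists>u\<in>T. {u, v} \<in> E)"
    show "1 < card (T \<inter> {a, b, c, d}) \<or> 1 \<le> card (T \<inter> {a, b, c, d}) \<and>
      (a \<in> T \<longrightarrow> p \<in> W \<union> T \<or> z \<in> T) \<and> (d \<in> T \<longrightarrow> z \<in> W \<union> T \<or> p \<in> T)"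
      using T[of a] T[of c] lab R(4) N
      by (cases "a \<in> T"; cases "b \<in> T"; cases "c \<in> T"; cases "d \<in> T") (auto simp: Int_insert_right)
  next
    fix D v assume "v \<in> {a, b, c, d} - W"
    then show "v \<in> {if p \<in> D then d else b} \<or> (\<exists>u\<in>D \<union> {if p \<in> D then d else b}. {u, v} \<in> E)"
      using lab N by auto
  qed (use fin R N N' lab in auto)
qed

text \<open>Everything around \<open>b\<close> is exempt, including both ends, so the choice of
  \<open>b\<close> is independent of the rest.\<close>

lemma reduction_path3_free:
  assumes fin: "finite V" and R: "{a, b, c} \<subseteq> V" "p \<in> V - {a, b, c}" "z \<in> V - {a, b, c}" "distinct [a, b, c]"
    and inc: "{e \<in> E. e \<inter> {a, b, c} \<noteq> {}} = {{p, a}, {a, b}, {b, c}, {c, z}}"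
    and lab: "a \<in> W" "b \<notin> W" "c \<in> W" "p \<in> W" "z \<in> W"
  shows "reduction V E W (V - {a, b, c}) (cut E {a, b, c} p z) W (lstep (p, z, b, b, b))"
proof -
  have "{u, v} \<in> E \<longleftrightarrow> {u, v} \<in> {{p, a}, {a, b}, {b, c}, {c, z}}" if "v \<in> {a, b, c}" for u v
    using that unfolding inc[symmetric] by auto
  from this[of a] this[of b] this[of c]
  have N: "{u, a} \<in> E \<longleftrightarrow> u = p \<or> u = b" "{u, b} \<in> E \<longleftrightarrow> u = a \<or> u = c" "{u, c} \<in> E \<longleftrightarrow> u = b \<or> u = z" for u
    using R by (auto simp: doubleton_eq_iff)
  have N': "{a, u} \<in> E \<longleftrightarrow> u = p \<or> u = b" "{b, u} \<in> E \<longleftrightarrow> u = a \<or> u = c" "{c, u} \<in> E \<longleftrightarrow> u = b \<or> u = z" for u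
    using N by (metis insert_commute)+
  have eq: "lstep (p, z, b, b, b) = (\<lambda>D. D \<union> {b})"
    by (rule ext) simp
  show ?thesis unfolding eq
  proof (rule reduction_cut[where a = a and c = c and r = 1])
    fix T assume T: "\<And>v. v \<in> {a, b, c} - W \<Longrightarrow> v \<in> T \<or> (\<exists>u\<in>T. {u, v} \<in> E)"
    have "T \<inter> {a, b, c} \<noteq> {}" using T[of b] lab N by auto
    then have "1 \<le> card (T \<inter> {a, b, c})" by (simp add: Suc_le_eq card_gt_0_iff)
    then show "1 < card (T \<inter> {a, b, c}) \<or> 1 \<le> card (T \<inter> {a, b, c}) \<and>
      (a \<in> T \<longrightarrow> p \<in> W \<union> T \<or> z \<in> T) \<and> (c \<in> T \<longrightarrow> z \<in> W \<union> T \<or> p \<in> T)" using lab by auto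
  qed (use fin R N N' lab in auto)
qed

text \<open>The deleted vertex and all its neighbours are exempt: it has nothing to dominate, and
  the lift adds nothing.\<close>

lemma reduction_path1_free:
  assumes fin: "finite V" and R: "a \<in> V" "p \<in> V - {a}" "z \<in> V - {a}"
    and inc: "{e \<in> E. e \<inter> {a} \<noteq> {}} = {{p, a}, {a, z}}"
    and lab: "a \<in> W" "p \<in> W" "z \<in> W"
  shows "reduction V E W (V - {a}) (cut E {a} p z) W (\<lambda>D. D)"
proof -
  have "{u, a} \<in> E \<longleftrightarrow> {u, a} \<in> {{p, a}, {a, z}}" for u
    unfolding inc[symmetric] by auto
  then have N: "{u, a} \<in> E \<longleftrightarrow> u = p \<or> u = z" for u
    using R by (auto simp: doubleton_eq_iff)
  then have N': "{a, u} \<in> E \<longleftrightarrow> u = p \<or> u = z" for u by (metis insert_commute)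
  have "reduction V E W (V - {a}) (cut E {a} p z) W (\<lambda>D. D \<union> {})"
    by (rule reduction_cut[where a = a and c = a and r = 0 and X = "\<lambda>_. {}"])
      (use fin R N N' lab in auto)
  then show ?thesis by simp
qed

section \<open>Reading a path\<close>

text \<open>The default \<open>u\<close> is the hub where the path starts: it lies below the bottom
  of the stack.\<close>

fun peek :: "'a list \<Rightarrow> 'a \<Rightarrow> 'a" where
  "peek [] u = u"
| "peek (x # xs) u = x"

fun chained :: "('a \<Rightarrow> 'a) \<Rightarrow> 'a list \<Rightarrow> 'a \<Rightarrow> bool" where
  "chained f [] u \<longleftrightarrow> True"
| "chained f (x # xs) u \<longleftrightarrow> f x = peek xs u \<and> chained f xs u"

lemma chained_upd: "x \<notin> set xs \<Longrightarrow> chained (f(x := y)) xs u \<longleftrightarrow> chained f xs u"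
  by (induction xs) auto

lemma chained_mem: "chained f xs u \<Longrightarrow> x \<in> set xs \<Longrightarrow> f x \<in> insert u (set xs)"
  by (induction xs) (auto, metis peek.elims list.set_intros(1))

lemma chained_append: "chained f (xs @ ys) u \<longleftrightarrow> chained f xs (peek ys u) \<and> chained f ys u"
proof (induction xs)
  case (Cons x xs)
  have "peek (xs @ ys) u = peek xs (peek ys u)" by (cases xs) auto
  then show ?case using Cons by auto
qed simp

lemma peek_in: "peek xs u \<in> insert u (set xs)"
  by (cases xs) auto

text \<open>Some vertices \<open>Vis\<close> of the core \<open>A\<close> have been visited, those in \<open>K\<close> are kept, and \<open>lf x\<close> is
  the kept vertex or hub that precedes \<open>x\<close> on its path.\<close>

definition curV :: "'a set \<Rightarrow> 'a set \<Rightarrow> 'a set \<Rightarrow> 'a set" where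
  "curV A Vis K = (A - Vis) \<union> K"

text \<open>Edges not yet touched by a walk, the edge from each kept vertex to its predecessor, and
  in \<open>Em\<close> the edges by which finished paths reach their final hub.\<close>

definition curE :: "'a set set \<Rightarrow> 'a set \<Rightarrow> 'a set \<Rightarrow> 'a set \<Rightarrow> ('a \<Rightarrow> 'a) \<Rightarrow> 'a set set \<Rightarrow> 'a set set" where
  "curE E A Vis K lf Em = {e \<in> ind E A. e \<inter> Vis = {}} \<union> (\<lambda>x. {x, lf x}) ` K \<union> Em"

definition kbase where
  "kbase A H Vis K lf Em \<longleftrightarrow> H \<subseteq> A \<and> Vis \<subseteq> A - H \<and> K \<subseteq> Vis \<and>
     (\<forall>x\<in>K. lf x \<in> K \<union> H \<and> lf x \<noteq> x) \<and> (\<forall>e\<in>Em. e \<subseteq> K \<union> H \<and> card e = 2)"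

text \<open>The state between two walks. The closure condition says that a path between hubs is
  visited either completely or not at all.\<close>

definition kinv where
  "kinv E A W H Vis K lf Em log \<longleftrightarrow> kbase A H Vis K lf Em \<and>
     (\<forall>x\<in>Vis. nbh E x \<inter> A \<subseteq> Vis \<union> H) \<and>
     reduction A (ind E A) W (curV A Vis K) (curE E A Vis K lf Em) W (foldr lstep log)"

text \<open>While the path from the hub \<open>u\<close> through \<open>pr\<close> to the next vertex \<open>cu\<close> is being read, the kept vertices
  of the part already read form the stack \<open>ss\<close> (top first), joined to \<open>cu\<close> by an edge.\<close>

definition winv where
  "winv E A W H Vis K lf Em log u ss pr cu \<longleftrightarrow> kbase A H Vis K lf Em \<and>
     u \<in> H \<and> set ss \<subseteq> K \<and> distinct ss \<and> chained lf ss u \<and>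
     (\<forall>x\<in>K - set ss. lf x \<notin> set ss) \<and> (\<forall>e\<in>Em. e \<inter> set ss = {}) \<and>
     cu \<in> A - Vis \<and> cu \<in> nbh E pr \<and> (pr \<in> Vis \<or> pr = u \<and> ss = []) \<and>
     (\<forall>x\<in>Vis. nbh E x \<inter> A \<subseteq> Vis \<union> H \<union> (if x = pr then {cu} else {})) \<and>
     reduction A (ind E A) W (curV A Vis K)
       (curE E A Vis K lf Em \<union> ({{peek ss u, cu}} - {{peek ss u}})) W (foldr lstep log)"

lemma winvD:
  assumes "winv E A W H Vis K lf Em log u ss pr cu"
  shows "kbase A H Vis K lf Em" "u \<in> H" "set ss \<subseteq> K" "distinct ss" "chained lf ss u"
    "\<forall>x\<in>K - set ss. lf x \<notin> set ss" "\<forall>e\<in>Em. e \<inter> set ss = {}"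
    "cu \<in> A - Vis" "cu \<in> nbh E pr" "pr \<in> Vis \<or> pr = u \<and> ss = []"
    "\<forall>x\<in>Vis. nbh E x \<inter> A \<subseteq> Vis \<union> H \<union> (if x = pr then {cu} else {})"
    "reduction A (ind E A) W (curV A Vis K)
       (curE E A Vis K lf Em \<union> ({{peek ss u, cu}} - {{peek ss u}})) W (foldr lstep log)"
  using assms unfolding winv_def by - (elim conjE, assumption)+

lemma kbaseD:
  assumes "kbase A H Vis K lf Em"
  shows "H \<subseteq> A" "Vis \<subseteq> A - H" "K \<subseteq> Vis" "\<And>x. x \<in> K \<Longrightarrow> lf x \<in> K \<union> H \<and> lf x \<noteq> x"
    "\<And>e. e \<in> Em \<Longrightarrow> e \<subseteq> K \<union> H \<and> card e = 2"
  using assms unfolding kbase_def by simp_all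

lemma winv_start:
  assumes k: "kinv E A W H Vis K lf Em log" and u: "u \<in> H" and y: "y \<in> nbh E u" "y \<in> A" "y \<notin> Vis"
  shows "winv E A W H Vis K lf Em log u [] u y"
proof -
  have b: "H \<subseteq> A" "Vis \<subseteq> A - H" using k by (auto simp: kinv_def kbase_def)
  have "{u, y} \<in> curE E A Vis K lf Em" using u y b by (auto simp: curE_def ind_def nbh_def)
  then have "curE E A Vis K lf Em \<union> ({{peek [] u, y}} - {{peek [] u}}) = curE E A Vis K lf Em" by auto
  then show ?thesis using k u y unfolding winv_def kinv_def by auto
qed

text \<open>The pending edge becomes permanent in \<open>Em\<close>. A path that has come back to
  its hub with an empty stack contributes no edge, because the difference removes the
  singleton.\<close>

lemma winv_finish:
  assumes w: "winv E A W H Vis K lf Em log u ss pr cu" and cu: "cu \<in> H"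
  shows "kinv E A W H Vis K lf (Em \<union> ({{peek ss u, cu}} - {{peek ss u}})) log"
proof -
  note b = winvD(1)[OF w] and s = winvD(3,2)[OF w]
  have t: "peek ss u \<in> K \<union> H" using peek_in[of ss u] s by auto
  have "kbase A H Vis K lf (Em \<union> ({{peek ss u, cu}} - {{peek ss u}}))"
  proof -
    have "e \<subseteq> K \<union> H \<and> card e = 2" if "e \<in> {{peek ss u, cu}} - {{peek ss u}}" for e
    proof -
      have "e = {peek ss u, cu}" "peek ss u \<noteq> cu" using that by auto
      then show ?thesis using t cu by simp
    qed
    then show ?thesis using b unfolding kbase_def by blast
  qed
  moreover have "curE E A Vis K lf Em \<union> X = curE E A Vis K lf (Em \<union> X)" for X
    by (auto simp: curE_def)
  moreover have "nbh E x \<inter> A \<subseteq> Vis \<union> H" if "x \<in> Vis" for x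
  proof -
    have "nbh E x \<inter> A \<subseteq> Vis \<union> H \<union> (if x = pr then {cu} else {})"
      using winvD(11)[OF w] that by blast
    then show ?thesis using cu by (auto split: if_splits)
  qed
  ultimately show ?thesis using winvD(12)[OF w] unfolding kinv_def by simp
qed

text \<open>A push leaves the current graph and the log as they are and only redescribes the graph:
  the pending edge turns into the predecessor edge of \<open>cu\<close>, and the original edge from
  \<open>cu\<close> to the next vertex becomes the pending one.\<close>

lemma winv_push:
  assumes g: "simple_graph V E" and w: "winv E A W H Vis K lf Em log u ss pr cu" and cu: "cu \<notin> H"
    and nz: "nbh E cu \<inter> A = {pr, nz}" "nz \<noteq> pr"
  shows "winv E A W H (insert cu Vis) (insert cu K) (lf(cu := peek ss u)) Em log u (cu # ss) cu nz"
proof -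
  have b: "kbase A H Vis K lf Em" and s: "set ss \<subseteq> K" "u \<in> H" "distinct ss" "chained lf ss u"
    and sk: "\<And>x. x \<in> K - set ss \<Longrightarrow> lf x \<notin> set ss" and em: "\<And>e. e \<in> Em \<Longrightarrow> e \<inter> set ss = {}"
    and c: "cu \<in> A" "cu \<notin> Vis" "cu \<in> nbh E pr" and pr: "pr \<in> Vis \<or> pr = u \<and> ss = []"
    and cl: "\<And>x. x \<in> Vis \<Longrightarrow> nbh E x \<inter> A \<subseteq> Vis \<union> H \<union> (if x = pr then {cu} else {})"
    and red: "reduction A (ind E A) W (curV A Vis K)
       (curE E A Vis K lf Em \<union> ({{peek ss u, cu}} - {{peek ss u}})) W (foldr lstep log)"
    using winvD[OF w] by blast+
  have b1: "H \<subseteq> A" "Vis \<subseteq> A - H" "K \<subseteq> Vis" and b2: "\<And>x. x \<in> K \<Longrightarrow> lf x \<in> K \<union> H \<and> lf x \<noteq> x"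
    and b3: "\<And>e. e \<in> Em \<Longrightarrow> e \<subseteq> K \<union> H \<and> card e = 2" using kbaseD[OF b] by blast+
  have cuK: "cu \<notin> K" using c b1 by auto
  have t: "peek ss u \<in> K \<union> H" "peek ss u \<noteq> cu" using peek_in[of ss u] s c b1 cu cuK by auto
  have nzA: "nz \<in> A" "nz \<in> nbh E cu" "pr \<in> A" using nz by auto
  have nzcu: "nz \<noteq> cu" using nzA nbh_subset[OF g, of cu] by auto
  \<comment> \<open>A visited vertex has no unvisited neighbour outside \<open>H\<close>, except
    that \<open>pr\<close> may have \<open>cu\<close>; and the next vertex differs from
    \<open>pr\<close>.\<close>
  have nzV: "nz \<notin> Vis"
  proof
    assume "nz \<in> Vis"
    moreover have "cu \<in> nbh E nz" using nzA nbh_sym by metis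
    ultimately have "cu \<in> Vis \<union> H" using cl[of nz] nz(2) c by auto
    then show False using c cu by auto
  qed
  have prcu: "pr \<noteq> cu" using c nbh_subset[OF g, of cu] nbh_subset[OF g, of pr] by auto
  have kb: "kbase A H (insert cu Vis) (insert cu K) (lf(cu := peek ss u)) Em"
  proof -
    have "\<forall>e\<in>Em. e \<subseteq> insert cu K \<union> H \<and> card e = 2" using b3 by blast
    moreover have "\<forall>x\<in>insert cu K. (lf(cu := peek ss u)) x \<in> insert cu K \<union> H \<and> (lf(cu := peek ss u)) x \<noteq> x"
      using b2 t cuK by auto
    moreover have "insert cu Vis \<subseteq> A - H" "insert cu K \<subseteq> insert cu Vis" using b1 c cu by auto
    ultimately show ?thesis unfolding kbase_def using b1(1) by blast
  qed
  have V: "curV A (insert cu Vis) (insert cu K) = curV A Vis K" using c cuK by (auto simp: curV_def)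
  \<comment> \<open>Among the untouched edges only those at \<open>cu\<close> matter. The one to
    \<open>pr\<close> is touched already if \<open>pr\<close> is visited; otherwise
    \<open>pr\<close> is the hub under an empty stack, and the edge coincides with the pending
    one.\<close>
  have I: "{e \<in> ind E A. e \<inter> Vis = {}} \<union> {{peek ss u, cu}} =
      {e \<in> ind E A. e \<inter> insert cu Vis = {}} \<union> {{peek ss u, cu}, {cu, nz}}"
  proof
    show "{e \<in> ind E A. e \<inter> Vis = {}} \<union> {{peek ss u, cu}} \<subseteq>
      {e \<in> ind E A. e \<inter> insert cu Vis = {}} \<union> {{peek ss u, cu}, {cu, nz}}"
    proof
      fix e assume e: "e \<in> {e \<in> ind E A. e \<inter> Vis = {}} \<union> {{peek ss u, cu}}"
      show "e \<in> {e \<in> ind E A. e \<inter> insert cu Vis = {}} \<union> {{peek ss u, cu}, {cu, nz}}"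
      proof (cases "e \<in> {e \<in> ind E A. e \<inter> Vis = {}} \<and> cu \<in> e")
        case True
        then have "e \<in> E" "e \<subseteq> A" by (auto simp: ind_def)
        then obtain a b where "e = {a, b}" using simple_graph_edge[OF g] by blast
        then obtain y where y: "e = {cu, y}" using True by auto
        then have "y \<in> nbh E cu \<inter> A" using \<open>e \<in> E\<close> \<open>e \<subseteq> A\<close> by (auto simp: nbh_def)
        then have "y = pr \<or> y = nz" using nz by auto
        then show ?thesis using y pr True by auto
      qed (use e in auto)
    qed
    show "{e \<in> ind E A. e \<inter> insert cu Vis = {}} \<union> {{peek ss u, cu}, {cu, nz}} \<subseteq>
      {e \<in> ind E A. e \<inter> Vis = {}} \<union> {{peek ss u, cu}}"
      using nzA nzV c by (auto simp: ind_def nbh_def)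
  qed
  have im: "(\<lambda>x. {x, (lf(cu := peek ss u)) x}) ` insert cu K = insert {peek ss u, cu} ((\<lambda>x. {x, lf x}) ` K)"
    using cuK by (auto simp: image_iff)
  have un: "X' \<union> insert a Y \<union> Z \<union> {b} = X \<union> Y \<union> Z \<union> {a}" if "X \<union> {a} = X' \<union> {a, b}"
    for X X' Y Z :: "'a set set" and a b using that by blast
  have si: "{{cu, nz}} - {{cu}} = {{cu, nz}}" "{{peek ss u, cu}} - {{peek ss u}} = {{peek ss u, cu}}"
    using t(2) nzcu by auto
  have Eq: "curE E A (insert cu Vis) (insert cu K) (lf(cu := peek ss u)) Em \<union> ({{cu, nz}} - {{cu}})
    = curE E A Vis K lf Em \<union> ({{peek ss u, cu}} - {{peek ss u}})"
    unfolding curE_def im si by (rule un[OF I])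
  have cl': "nbh E x \<inter> A \<subseteq> insert cu Vis \<union> H \<union> (if x = cu then {nz} else {})" if "x \<in> insert cu Vis" for x
  proof (cases "x = cu")
    case True
    then show ?thesis using nz pr s by auto
  next
    case False
    then show ?thesis using cl[of x] that by (auto split: if_splits)
  qed
  have "\<forall>x\<in>insert cu K - set (cu # ss). (lf(cu := peek ss u)) x \<notin> set (cu # ss)"
    using sk b2 cuK cu by auto
  moreover have "\<forall>e\<in>Em. e \<inter> set (cu # ss) = {}"
  proof
    fix e assume e: "e \<in> Em"
    then have "cu \<notin> e" using b3 cuK cu by blast
    then show "e \<inter> set (cu # ss) = {}" using em[OF e] by simp
  qed
  moreover have "chained (lf(cu := peek ss u)) (cu # ss) u" using s cuK chained_upd[of cu ss] by auto
  ultimately show ?thesis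
    unfolding winv_def using kb s cuK nzA nzV nzcu cl' red V Eq by auto
qed

text \<open>No remaining vertex has its predecessor in the popped segment and no edge of
  \<open>Em\<close> meets it, so only the path edges are incident with it. This supplies the
  incidence hypothesis of the word rules, and it identifies \<open>cut\<close> with the shorter
  stack.\<close>

lemma winv_pop_edges:
  assumes w: "winv E A W H Vis K lf Em log u (rs @ ss) pr cu" and rs: "rs \<noteq> []"
  defines "G \<equiv> curE E A Vis K lf Em \<union> ({{peek (rs @ ss) u, cu}} - {{peek (rs @ ss) u}})"
  shows "{e \<in> G. e \<inter> set rs \<noteq> {}} = insert {hd rs, cu} ((\<lambda>x. {x, lf x}) ` set rs)"
    and "cut G (set rs) (peek ss u) cu = curE E A Vis (K - set rs) lf Em \<union> ({{peek ss u, cu}} - {{peek ss u}})"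
proof -
  have b: "kbase A H Vis K lf Em" and s: "set (rs @ ss) \<subseteq> K" "u \<in> H" "distinct (rs @ ss)" "chained lf (rs @ ss) u"
    and sk: "\<And>x. x \<in> K - set (rs @ ss) \<Longrightarrow> lf x \<notin> set (rs @ ss)" and em: "\<And>e. e \<in> Em \<Longrightarrow> e \<inter> set (rs @ ss) = {}"
    and c: "cu \<in> A" "cu \<notin> Vis"
    using winvD[OF w] by blast+
  note b1 = kbaseD(1-3)[OF b]
  have h: "peek (rs @ ss) u = hd rs" "hd rs \<in> set rs" using rs by (cases rs; auto)+
  have cr: "cu \<notin> set rs" using s c b1 by auto
  then have ne: "hd rs \<noteq> cu" using h by auto
  have ss: "lf x \<notin> set rs" if "x \<in> set ss" for x
    using chained_mem[of lf ss u x] s that b1 by (auto simp: chained_append)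
  have lfr: "lf x \<notin> set rs" if "x \<in> K - set rs" for x using ss sk that by (cases "x \<in> set ss") auto
  have G: "G = {e \<in> ind E A. e \<inter> Vis = {}} \<union> (\<lambda>x. {x, lf x}) ` K \<union> Em \<union> {{hd rs, cu}}"
    unfolding G_def curE_def h using ne by auto
  have rV: "set rs \<subseteq> Vis" "set rs \<subseteq> K" using s b1 by auto
  have split: "{e \<in> X \<union> Y \<union> Z \<union> U. P e} = {e \<in> X. P e} \<union> {e \<in> Y. P e} \<union> {e \<in> Z. P e} \<union> {e \<in> U. P e}"
    for X Y Z U :: "'a set set" and P by auto
  have 1: "{e \<in> G. e \<inter> set rs = {}} = {e \<in> ind E A. e \<inter> Vis = {}} \<union> (\<lambda>x. {x, lf x}) ` (K - set rs) \<union> Em"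
  proof -
    have "{e \<in> {e \<in> ind E A. e \<inter> Vis = {}}. e \<inter> set rs = {}} = {e \<in> ind E A. e \<inter> Vis = {}}" using rV by blast
    moreover have "{e \<in> (\<lambda>x. {x, lf x}) ` K. e \<inter> set rs = {}} = (\<lambda>x. {x, lf x}) ` (K - set rs)"
      using lfr by auto
    moreover have "{e \<in> Em. e \<inter> set rs = {}} = Em" using em by auto
    moreover have "{e \<in> {{hd rs, cu}}. e \<inter> set rs = {}} = {}" using h by auto
    ultimately show ?thesis unfolding G split by (simp only: Un_empty_right Un_empty_left Un_insert_right)
  qed
  show "cut G (set rs) (peek ss u) cu = curE E A Vis (K - set rs) lf Em \<union> ({{peek ss u, cu}} - {{peek ss u}})"
    unfolding cut_def 1 curE_def by simp
  have "{e \<in> {e \<in> ind E A. e \<inter> Vis = {}}. e \<inter> set rs \<noteq> {}} = {}" using rV by blast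
  moreover have "{e \<in> (\<lambda>x. {x, lf x}) ` K. e \<inter> set rs \<noteq> {}} = (\<lambda>x. {x, lf x}) ` set rs"
    using lfr rV by auto
  moreover have "{e \<in> Em. e \<inter> set rs \<noteq> {}} = {}" using em by auto
  moreover have "{e \<in> {{hd rs, cu}}. e \<inter> set rs \<noteq> {}} = {{hd rs, cu}}" using h by auto
  ultimately show "{e \<in> G. e \<inter> set rs \<noteq> {}} = insert {hd rs, cu} ((\<lambda>x. {x, lf x}) ` set rs)"
    unfolding G split by (simp only: Un_empty_right Un_empty_left Un_insert_right)
qed

text \<open>Any reduction that deletes the top segment \<open>rs\<close> can be appended. New
  records go to the end of the log because \<open>foldr\<close> applies the last one first.\<close>

lemma winv_pop:
  assumes w: "winv E A W H Vis K lf Em log u (rs @ ss) pr cu" and rs: "rs \<noteq> []"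
    and G: "G = curE E A Vis K lf Em \<union> ({{peek (rs @ ss) u, cu}} - {{peek (rs @ ss) u}})"
    and red: "reduction (curV A Vis K) G W (curV A Vis K - set rs) (cut G (set rs) (peek ss u) cu) W L"
    and log: "\<And>D. foldr lstep log' D = foldr lstep log (L D)"
  shows "winv E A W H Vis (K - set rs) lf Em log' u ss pr cu"
proof -
  have b: "kbase A H Vis K lf Em" and s: "set (rs @ ss) \<subseteq> K" "u \<in> H" "distinct (rs @ ss)" "chained lf (rs @ ss) u"
    and sk: "\<And>x. x \<in> K - set (rs @ ss) \<Longrightarrow> lf x \<notin> set (rs @ ss)" and em: "\<And>e. e \<in> Em \<Longrightarrow> e \<inter> set (rs @ ss) = {}"
    and c: "cu \<in> A" "cu \<notin> Vis" "cu \<in> nbh E pr" and pr: "pr \<in> Vis"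
    and cl: "\<forall>x\<in>Vis. nbh E x \<inter> A \<subseteq> Vis \<union> H \<union> (if x = pr then {cu} else {})"
    and r: "reduction A (ind E A) W (curV A Vis K) G W (foldr lstep log)"
    using winvD[OF w] rs unfolding G by auto
  have b1: "H \<subseteq> A" "Vis \<subseteq> A - H" "K \<subseteq> Vis" and b2: "\<And>x. x \<in> K \<Longrightarrow> lf x \<in> K \<union> H \<and> lf x \<noteq> x"
    and b3: "\<And>e. e \<in> Em \<Longrightarrow> e \<subseteq> K \<union> H \<and> card e = 2" using kbaseD[OF b] by blast+
  have ss: "lf x \<in> insert u (set ss)" if "x \<in> set ss" for x
    using chained_mem[of lf ss u x] s that by (auto simp: chained_append)
  have lfr: "lf x \<notin> set rs" if "x \<in> K - set rs" for x using ss[of x] sk[of x] that s b1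
    by (cases "x \<in> set ss") auto
  have V: "curV A Vis K - set rs = curV A Vis (K - set rs)" using s b1 by (auto simp: curV_def)
  have "reduction A (ind E A) W (curV A Vis (K - set rs))
       (curE E A Vis (K - set rs) lf Em \<union> ({{peek ss u, cu}} - {{peek ss u}})) W (foldr lstep log')"
  proof -
    have "foldr lstep log' = (\<lambda>D. foldr lstep log (L D))" using log by (rule ext)
    then show ?thesis
      using reduction_trans[OF r red] unfolding V G winv_pop_edges(2)[OF w rs] by (simp only:)
  qed
  moreover have "kbase A H Vis (K - set rs) lf Em"
  proof -
    have "e \<subseteq> (K - set rs) \<union> H \<and> card e = 2" if "e \<in> Em" for e
    proof -
      have "e \<inter> set rs = {}" using em[OF that] by auto
      then show ?thesis using b3[OF that] by blast
    qed
    moreover have "lf x \<in> (K - set rs) \<union> H \<and> lf x \<noteq> x" if "x \<in> K - set rs" for x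
      using b2[of x] lfr[OF that] that by blast
    ultimately show ?thesis unfolding kbase_def using b1 by blast
  qed
  moreover have "\<forall>x\<in>K - set rs - set ss. lf x \<notin> set ss" using sk by auto
  moreover have "\<forall>e\<in>Em. e \<inter> set ss = {}" using em by fastforce
  moreover have "set ss \<subseteq> K - set rs" "distinct ss" "chained lf ss u" using s by (auto simp: chained_append)
  ultimately show ?thesis unfolding winv_def using s(2) c pr cl by blast
qed

lemma winv_pop_facts:
  assumes w: "winv E A W H Vis K lf Em log u (rs @ ss) pr cu" and fin: "finite A"
  shows "finite (curV A Vis K)" "set rs \<subseteq> curV A Vis K" "peek ss u \<in> curV A Vis K - set rs"
    "cu \<in> curV A Vis K - set rs"
proof -
  note b1 = kbaseD(1-3)[OF winvD(1)[OF w]]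
  have K: "K \<subseteq> A" using b1 by blast
  show "finite (curV A Vis K)" unfolding curV_def using fin K finite_subset by auto
  have s: "set (rs @ ss) \<subseteq> K" "distinct (rs @ ss)" "u \<in> H" using winvD[OF w] by blast+
  show "set rs \<subseteq> curV A Vis K" unfolding curV_def using s by auto
  have "u \<notin> set rs" "u \<in> A - Vis" using s b1 by auto
  then show "peek ss u \<in> curV A Vis K - set rs"
    unfolding curV_def using s peek_in[of ss u] by auto
  show "cu \<in> curV A Vis K - set rs" unfolding curV_def using s b1 winvD(8)[OF w] by auto
qed

text \<open>The stack lists the path backwards: \<open>a2\<close>, \<open>a1\<close>,
  \<open>a0\<close>, then \<open>cu\<close>. Both \<open>NNN\<close> and \<open>WNNW\<close> are
  instances; in the latter the first \<open>W\<close> is the vertex below the segment and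
  stays.\<close>

lemma winv_pop3:
  assumes w: "winv E A W H Vis K lf Em log u (a0 # a1 # a2 # ss) pr cu" and fin: "finite A"
    and lab: "a2 \<notin> W" "a1 \<notin> W" "a0 \<in> W \<Longrightarrow> peek ss u \<in> W"
  shows "winv E A W H Vis (K - {a0, a1, a2}) lf Em (log @ [(peek ss u, cu, a0, a2, a1)]) u ss pr cu"
proof -
  define G where "G = curE E A Vis K lf Em \<union> ({{peek ([a0, a1, a2] @ ss) u, cu}} - {{peek ([a0, a1, a2] @ ss) u}})"
  have w': "winv E A W H Vis K lf Em log u ([a0, a1, a2] @ ss) pr cu" using w by simp
  note f = winv_pop_facts[OF w' fin]
  have l: "lf a0 = a1" "lf a1 = a2" "lf a2 = peek ss u" using winvD(5)[OF w] by auto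
  have inc: "{e \<in> G. e \<inter> {a2, a1, a0} \<noteq> {}} = {{peek ss u, a2}, {a2, a1}, {a1, a0}, {a0, cu}}"
    using winv_pop_edges(1)[OF w'] l unfolding G_def by (simp add: insert_commute)
  have d: "distinct [a2, a1, a0]" using winvD(4)[OF w] by auto
  have S: "set [a0, a1, a2] = {a2, a1, a0}" by auto
  have "winv E A W H Vis (K - set [a0, a1, a2]) lf Em (log @ [(peek ss u, cu, a0, a2, a1)]) u ss pr cu"
  proof (rule winv_pop[OF w' _ G_def, where L = "lstep (peek ss u, cu, a0, a2, a1)"])
    show "reduction (curV A Vis K) G W (curV A Vis K - set [a0, a1, a2])
      (cut G (set [a0, a1, a2]) (peek ss u) cu) W (lstep (peek ss u, cu, a0, a2, a1))"
      unfolding S by (rule reduction_path3[OF f(1) _ _ _ d inc lab]) (use f(2-4) in auto)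
  qed auto
  then show ?thesis by simp
qed

text \<open>The rule for \<open>WNWNW\<close>, whose first letter is the vertex below the
  segment.\<close>

lemma winv_pop4:
  assumes w: "winv E A W H Vis K lf Em log u (a0 # a1 # a2 # a3 # ss) pr cu" and fin: "finite A"
    and lab: "a3 \<notin> W" "a2 \<in> W" "a1 \<notin> W" "a0 \<in> W" "peek ss u \<in> W"
  shows "winv E A W H Vis (K - {a0, a1, a2, a3}) lf Em (log @ [(peek ss u, cu, a0, a2, a2)]) u ss pr cu"
proof -
  define G where "G = curE E A Vis K lf Em \<union>
    ({{peek ([a0, a1, a2, a3] @ ss) u, cu}} - {{peek ([a0, a1, a2, a3] @ ss) u}})"
  have w': "winv E A W H Vis K lf Em log u ([a0, a1, a2, a3] @ ss) pr cu" using w by simp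
  note f = winv_pop_facts[OF w' fin]
  have l: "lf a0 = a1" "lf a1 = a2" "lf a2 = a3" "lf a3 = peek ss u" using winvD(5)[OF w] by auto
  have inc: "{e \<in> G. e \<inter> {a3, a2, a1, a0} \<noteq> {}} = {{peek ss u, a3}, {a3, a2}, {a2, a1}, {a1, a0}, {a0, cu}}"
    using winv_pop_edges(1)[OF w'] l unfolding G_def by (simp add: insert_commute)
  have d: "distinct [a3, a2, a1, a0]" using winvD(4)[OF w] by auto
  have S: "set [a0, a1, a2, a3] = {a3, a2, a1, a0}" by auto
  have "winv E A W H Vis (K - set [a0, a1, a2, a3]) lf Em (log @ [(peek ss u, cu, a0, a2, a2)]) u ss pr cu"
  proof (rule winv_pop[OF w' _ G_def, where L = "lstep (peek ss u, cu, a0, a2, a2)"])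
    show "reduction (curV A Vis K) G W (curV A Vis K - set [a0, a1, a2, a3])
      (cut G (set [a0, a1, a2, a3]) (peek ss u) cu) W (lstep (peek ss u, cu, a0, a2, a2))"
      unfolding S by (rule reduction_path4[OF f(1) _ _ _ d inc lab]) (use f(2-4) in auto)
  qed auto
  then show ?thesis by simp
qed

text \<open>The rule for \<open>WWNWW\<close>: the outer letters are the vertex below the segment
  and \<open>cu\<close>, and both stay.\<close>

lemma winv_pop3_free:
  assumes w: "winv E A W H Vis K lf Em log u (a0 # a1 # a2 # ss) pr cu" and fin: "finite A"
    and lab: "a2 \<in> W" "a1 \<notin> W" "a0 \<in> W" "peek ss u \<in> W" "cu \<in> W"
  shows "winv E A W H Vis (K - {a0, a1, a2}) lf Em (log @ [(peek ss u, cu, a1, a1, a1)]) u ss pr cu"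
proof -
  define G where "G = curE E A Vis K lf Em \<union> ({{peek ([a0, a1, a2] @ ss) u, cu}} - {{peek ([a0, a1, a2] @ ss) u}})"
  have w': "winv E A W H Vis K lf Em log u ([a0, a1, a2] @ ss) pr cu" using w by simp
  note f = winv_pop_facts[OF w' fin]
  have l: "lf a0 = a1" "lf a1 = a2" "lf a2 = peek ss u" using winvD(5)[OF w] by auto
  have inc: "{e \<in> G. e \<inter> {a2, a1, a0} \<noteq> {}} = {{peek ss u, a2}, {a2, a1}, {a1, a0}, {a0, cu}}"
    using winv_pop_edges(1)[OF w'] l unfolding G_def by (simp add: insert_commute)
  have d: "distinct [a2, a1, a0]" using winvD(4)[OF w] by auto
  have S: "set [a0, a1, a2] = {a2, a1, a0}" by auto
  have "winv E A W H Vis (K - set [a0, a1, a2]) lf Em (log @ [(peek ss u, cu, a1, a1, a1)]) u ss pr cu"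
  proof (rule winv_pop[OF w' _ G_def, where L = "lstep (peek ss u, cu, a1, a1, a1)"])
    show "reduction (curV A Vis K) G W (curV A Vis K - set [a0, a1, a2])
      (cut G (set [a0, a1, a2]) (peek ss u) cu) W (lstep (peek ss u, cu, a1, a1, a1))"
      unfolding S by (rule reduction_path3_free[OF f(1) _ _ _ d inc lab]) (use f(2-4) in auto)
  qed auto
  then show ?thesis by simp
qed

lemma winv_pop1_free:
  assumes w: "winv E A W H Vis K lf Em log u (a0 # ss) pr cu" and fin: "finite A"
    and lab: "a0 \<in> W" "peek ss u \<in> W" "cu \<in> W"
  shows "winv E A W H Vis (K - {a0}) lf Em log u ss pr cu"
proof -
  define G where "G = curE E A Vis K lf Em \<union> ({{peek ([a0] @ ss) u, cu}} - {{peek ([a0] @ ss) u}})"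
  have w': "winv E A W H Vis K lf Em log u ([a0] @ ss) pr cu" using w by simp
  note f = winv_pop_facts[OF w' fin]
  have l: "lf a0 = peek ss u" using winvD(5)[OF w] by auto
  have inc: "{e \<in> G. e \<inter> {a0} \<noteq> {}} = {{peek ss u, a0}, {a0, cu}}"
    using winv_pop_edges(1)[OF w'] l unfolding G_def by (simp add: insert_commute)
  have S: "set [a0] = {a0}" by auto
  have "winv E A W H Vis (K - set [a0]) lf Em log u ss pr cu"
  proof (rule winv_pop[OF w' _ G_def, where L = "\<lambda>D. D"])
    show "reduction (curV A Vis K) G W (curV A Vis K - set [a0])
      (cut G (set [a0]) (peek ss u) cu) W (\<lambda>D. D)"
      unfolding S by (rule reduction_path1_free[OF f(1) _ _ _ inc lab]) (use f(2-4) in auto)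
  qed auto
  then show ?thesis by simp
qed

text \<open>Labels of a stack, top first; \<open>True\<close> marks a vertex of \<open>W\<close>.\<close>

fun bad :: "bool list \<Rightarrow> bool" where
  "bad (False # False # False # _) = True"
| "bad (True # False # False # True # _) = True"
| "bad (True # False # True # False # True # _) = True"
| "bad (True # True # True # _) = True"
| "bad (True # True # False # True # True # _) = True"
| "bad _ = False"

fun irr :: "bool list \<Rightarrow> bool" where
  "irr [] = True"
| "irr (x # xs) \<longleftrightarrow> irr xs \<and> \<not> bad (x # xs)"

text \<open>Executable enumeration of the irreducible words of a given length. Prefixing suffices
  because a suffix of an irreducible word is irreducible.\<close>

fun irrs :: "nat \<Rightarrow> bool list list" where
  "irrs 0 = [[]]"
| "irrs (Suc n) = filter (\<lambda>xs. \<not> bad xs) (map ((#) True) (irrs n) @ map ((#) False) (irrs n))"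

lemma irr_irrs: "irr xs \<Longrightarrow> xs \<in> set (irrs (length xs))"
  by (induction xs) auto

lemma irr_drop: "irr xs \<Longrightarrow> irr (drop n xs)"
proof (induction xs arbitrary: n)
  case (Cons x xs)
  then show ?case by (cases n) auto
qed simp

text \<open>A longer word would have an irreducible suffix of length 11, and evaluation shows that
  there is none.\<close>

lemma irr_length: assumes "irr xs" shows "length xs \<le> 10"
proof (rule ccontr)
  assume "\<not> ?thesis"
  then have "length (drop (length xs - 11) xs) = 11" by simp
  moreover have "irrs 11 = []" by code_simp
  ultimately show False using irr_irrs[OF irr_drop[OF assms, of "length xs - 11"]] by simp
qed

section \<open>Adjacency lists\<close>

fun seqs :: "prog list \<Rightarrow> prog" where
  "seqs [] = Skip"
| "seqs [p] = p"
| "seqs (p # q # ps) = Seq p (seqs (q # ps))"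

definition EqT :: "exp \<Rightarrow> exp \<Rightarrow> test" where
  "EqT e f = Conj (Neg (Less e f)) (Neg (Less f e))"

lemma eval_EqT [simp]: "eval_test (EqT e f) s \<longleftrightarrow> eval_exp e s = eval_exp f s"
  by (auto simp: EqT_def)

fun nbs :: "(nat \<times> nat) list \<Rightarrow> nat \<Rightarrow> nat list" where
  "nbs [] v = []"
| "nbs ((a, b) # es) v = (if b = v then [a] else []) @ (if a = v then [b] else []) @ nbs es v"

lemma set_nbs: "set (nbs es v) = nbh (edges_of es) v"
  by (induction es v rule: nbs.induct)
    (auto simp: edges_of_def nbh_def doubleton_eq_iff split: if_splits)

lemma distinct_nbs:
  assumes "distinct (map (\<lambda>(u, v). {u, v}) es)" "\<forall>(a, b)\<in>set es. a \<noteq> b"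
  shows "distinct (nbs es v)"
  using assms
proof (induction es v rule: nbs.induct)
  case (2 a b es v)
  have "{a, b} \<notin> edges_of es" using "2.prems" by (force simp: edges_of_def)
  then have "a = v \<Longrightarrow> b \<notin> set (nbs es v)" "b = v \<Longrightarrow> a \<notin> set (nbs es v)"
    by (auto simp: set_nbs nbh_def insert_commute)
  then show ?case using 2 by auto
qed simp

text \<open>The bound \<open>c\<close> on the cells in use makes cell \<open>Suc c\<close> fresh, so
  that writing to it disturbs no list.\<close>

definition adjs :: "(nat \<Rightarrow> nat) \<Rightarrow> (nat \<Rightarrow> nat) \<Rightarrow> (nat \<Rightarrow> nat) \<Rightarrow> nat \<Rightarrow> (nat \<Rightarrow> nat list) \<Rightarrow> bool" where
  "adjs to' nx hd' c L \<longleftrightarrow>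
     (\<forall>v. \<exists>hs. linked nx (hd' v) hs \<and> map to' hs = L v \<and> (\<forall>h\<in>set hs. h \<le> c))"

lemma linked_cong: "(\<And>h. h \<in> set hs \<Longrightarrow> f h = g h) \<Longrightarrow> linked f j hs \<longleftrightarrow> linked g j hs"
  by (induction hs arbitrary: j) auto

lemma adjs_cons:
  assumes "adjs to' nx hd' c L"
  shows "adjs (to'(Suc c := b)) (nx(Suc c := hd' a)) (hd'(a := Suc c)) (Suc c) (L(a := b # L a))"
  unfolding adjs_def
proof
  fix v
  obtain hs where hs: "linked nx (hd' v) hs" "map to' hs = L v" "\<forall>h\<in>set hs. h \<le> c"
    using assms by (auto simp: adjs_def)
  then have l: "linked (nx(Suc c := hd' a)) (hd' v) hs"
    using linked_cong[of hs nx "nx(Suc c := hd' a)" "hd' v"] by fastforce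
  have m: "map (to'(Suc c := b)) hs = L v" using hs by (auto simp flip: hs(2))
  show "\<exists>hs. linked (nx(Suc c := hd' a)) ((hd'(a := Suc c)) v) hs \<and>
    map (to'(Suc c := b)) hs = (L(a := b # L a)) v \<and> (\<forall>h\<in>set hs. h \<le> Suc c)"
  proof (cases "v = a")
    case True
    then show ?thesis using hs l m by (intro exI[of _ "Suc c # hs"]) auto
  next
    case False
    then show ?thesis using hs l m by (intro exI[of _ hs]) auto
  qed
qed

definition Build :: prog where
  "Build = Seq (Assign ''c'' (Const 0)) (Loop ''i'' ''m'' (seqs
     [Assign ''u'' (Arr ''src'' (Reg ''i'')), Assign ''v'' (Arr ''dst'' (Reg ''i'')),
      Assign ''c'' (Inc (Reg ''c'')), Store ''to'' (Reg ''c'') (Reg ''v''),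
      Store ''nx'' (Reg ''c'') (Arr ''hd'' (Reg ''u'')), Store ''hd'' (Reg ''u'') (Reg ''c''),
      Store ''dg'' (Reg ''u'') (Inc (Arr ''dg'' (Reg ''u''))),
      Assign ''c'' (Inc (Reg ''c'')), Store ''to'' (Reg ''c'') (Reg ''u''),
      Store ''nx'' (Reg ''c'') (Arr ''hd'' (Reg ''v'')), Store ''hd'' (Reg ''v'') (Reg ''c''),
      Store ''dg'' (Reg ''v'') (Inc (Arr ''dg'' (Reg ''v'')))]))"

locale graph_input =
  fixes n :: nat and es :: "(nat \<times> nat) list"
  assumes code: "graph_code n es"
begin

abbreviation "E \<equiv> edges_of es"
abbreviation "N \<equiv> nbh E"

lemma sg: "simple_graph {0..<n} E"
  using code by (simp add: graph_code_def)

lemma es_neq: "\<forall>(a, b)\<in>set es. a \<noteq> b"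
  using simple_graphD(1)[OF sg] by (force simp: edges_of_def)

text \<open>\<open>Build\<close> inserts new entries at the front of the lists, hence the
  reversal.\<close>

definition nb :: "nat \<Rightarrow> nat list" where
  "nb v = nbs (rev es) v"

lemma set_nb [simp]: "set (nb v) = N v"
  by (simp add: nb_def set_nbs edges_of_def)

lemma distinct_nb: "distinct (nb v)"
  unfolding nb_def using code es_neq
  by (intro distinct_nbs) (auto simp: graph_code_def rev_map[symmetric])

lemma length_nb: "length (nb v) = card (N v)"
  using distinct_card[OF distinct_nb] by simp

lemma N_lt: "y \<in> N v \<Longrightarrow> y < n"
  using nbh_subset[OF sg, of v] by auto

lemma card_E: "card E \<le> length es"
  unfolding edges_of_def by (meson List.finite_set card_image_le card_length le_trans)

lemma sum_nb: "(\<Sum>v\<in>{0..<n}. length (nb v)) \<le> 2 * length es"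
  using handshake[OF sg] card_E by (simp add: length_nb)

definition adj_ok :: "store \<Rightarrow> bool" where
  "adj_ok s \<longleftrightarrow> (\<forall>v. adj s v (nb v)) \<and> regs s ''n'' = n \<and> regs s ''m'' = length es \<and>
     arrs s ''src'' = array_of (map fst es) \<and> arrs s ''dst'' = array_of (map snd es)"

lemma wp_Build:
  assumes s: "s = input n es ds" and k: "14 * length es + 3 \<le> k"
    and Q: "\<And>k' s'. k \<le> k' + 14 * length es + 3 \<Longrightarrow> adj_ok s' \<Longrightarrow>
      \<forall>v. arrs s' ''dg'' v = length (nb v) \<Longrightarrow>
      (\<And>x. x \<notin> wregs Build \<Longrightarrow> regs s' x = regs s x) \<Longrightarrow>
      (\<And>a. a \<notin> warrs Build \<Longrightarrow> arrs s' a = arrs s a) \<Longrightarrow> Q k' s'"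
  shows "wp Build Q k s"
proof -
  define L where "L i = nbs (rev (take i es))" for i
  let ?I = "\<lambda>i k' s. k \<le> k' + 14 * i + 2 \<and>
     regs s ''n'' = n \<and> regs s ''m'' = length es \<and>
     arrs s ''src'' = array_of (map fst es) \<and> arrs s ''dst'' = array_of (map snd es) \<and>
     adjs (arrs s ''to'') (arrs s ''nx'') (arrs s ''hd'') (regs s ''c'') (L i) \<and>
     (\<forall>v. arrs s ''dg'' v = length (L i v))"
  let ?P = "\<lambda>k' s'. k \<le> k' + 14 * length es + 3 \<and> adj_ok s' \<and> (\<forall>v. arrs s' ''dg'' v = length (nb v))"
  have "wp Build ?P k s"
    unfolding Build_def wp_Seq wp_Assign
  proof (intro conjI, goal_cases)
    case 1
    then show ?case using k by simp
  next
    case 2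
    show ?case
    proof (rule wp_Loop[where I = "?I" and N = "length es"])
      fix c k' s assume I: "?I c k' s" and c: "regs s ''i'' = c" "c < length es" "regs s ''m'' = length es"
      obtain a b where ab: "es ! c = (a, b)" by (cases "es ! c")
      have ne: "a \<noteq> b" using es_neq nth_mem[OF c(2)] ab by fastforce
      have src: "arrs s ''src'' c = a" "arrs s ''dst'' c = b"
        using I c ab by (auto simp: array_of_def)
      have L': "L (Suc c) = (L c)(a := b # L c a, b := a # L c b)"
        unfolding L_def using c ab ne by (auto simp: take_Suc_conv_app_nth)
      have adj': "adjs ((arrs s ''to'')(Suc (regs s ''c'') := b, Suc (Suc (regs s ''c'')) := a))
        ((arrs s ''nx'')(Suc (regs s ''c'') := arrs s ''hd'' a, Suc (Suc (regs s ''c'')) := arrs s ''hd'' b))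
        ((arrs s ''hd'')(a := Suc (regs s ''c''), b := Suc (Suc (regs s ''c''))))
        (Suc (Suc (regs s ''c''))) (L (Suc c))"
        using adjs_cons[OF adjs_cons[of "arrs s ''to''" "arrs s ''nx''" "arrs s ''hd''" "regs s ''c''" "L c" b a], of a b]
          I ne unfolding L' by auto
      have dg: "\<forall>v. ((arrs s ''dg'')(a := Suc (arrs s ''dg'' a), b := Suc (arrs s ''dg'' b))) v = length (L (Suc c) v)"
        unfolding L' using I ne by auto
      show "2 \<le> k' \<and> wp (seqs [Assign ''u'' (Arr ''src'' (Reg ''i'')), Assign ''v'' (Arr ''dst'' (Reg ''i'')),
      Assign ''c'' (Inc (Reg ''c'')), Store ''to'' (Reg ''c'') (Reg ''v''),
      Store ''nx'' (Reg ''c'') (Arr ''hd'' (Reg ''u'')), Store ''hd'' (Reg ''u'') (Reg ''c''),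
      Store ''dg'' (Reg ''u'') (Inc (Arr ''dg'' (Reg ''u''))),
      Assign ''c'' (Inc (Reg ''c'')), Store ''to'' (Reg ''c'') (Reg ''u''),
      Store ''nx'' (Reg ''c'') (Arr ''hd'' (Reg ''v'')), Store ''hd'' (Reg ''v'') (Reg ''c''),
      Store ''dg'' (Reg ''v'') (Inc (Arr ''dg'' (Reg ''v'')))]) (?I (Suc c)) (k' - 2) s"
      proof -
        \<comment> \<open>Twelve commands, the loop test and the increment make 14 steps per
          edge.\<close>
        have "14 * c + 14 \<le> 14 * length es" using c(2) by simp
        moreover have "k \<le> k' + 14 * c + 2" using I by blast
        ultimately have "15 \<le> k'" using k by linarith
        \<comment> \<open>With a numeral split off the budget, the simplifier evaluates the nested
          truncated subtractions. The same device recurs in the later programs.\<close>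
        then obtain r where "k' = 15 + r" using le_Suc_ex by blast
        then show ?thesis using I c ne src adj' dg by simp
      qed
    next
      fix k' s assume "?I (length es) k' s"
      then show "1 \<le> k' \<and> ?P (k' - 1) s" using k
        by (auto simp: adj_ok_def adj_def adjs_def L_def nb_def)
    qed (use k s in \<open>auto simp: input_def L_def adjs_def\<close>)
  qed
  then show ?thesis by (rule wp_frame) (use Q in blast)
qed

definition alive :: "store \<Rightarrow> nat set" where
  "alive s = {v. v < n \<and> arrs s ''x'' v = 0}"

end

section \<open>Deleting a vertex and the queue of leaves\<close>

definition nz :: "(nat \<Rightarrow> nat) \<Rightarrow> nat set" where
  "nz f = {v. f v \<noteq> 0}"

lemma nz_upd [simp]: "nz (f(a := 0)) = nz f - {a}" "nz (f(a := Suc k)) = insert a (nz f)"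
  by (auto simp: nz_def)

text \<open>A vertex is queued at the moment its degree falls to 1; when it falls to 0, the vertex
  has been queued before.\<close>

definition KillB :: "prog \<Rightarrow> prog" where
  "KillB mk = Cond (EqT (Arr ''x'' (Reg ''y'')) (Const 0)) (seqs
     [Assign ''p'' (Reg ''y''), mk, Store ''dg'' (Reg ''y'') (Dec (Arr ''dg'' (Reg ''y''))),
      Cond (EqT (Arr ''dg'' (Reg ''y'')) (Const 1))
        (seqs [Store ''q'' (Reg ''qt'') (Reg ''y''), Assign ''qt'' (Inc (Reg ''qt''))]) Skip]) Skip"

definition Kill :: "string \<Rightarrow> prog \<Rightarrow> prog" where
  "Kill r mk = ForNb ''j'' ''y'' r (KillB mk)"

definition mark :: "bool \<Rightarrow> prog" where
  "mark b = (if b then Store ''w'' (Reg ''y'') (Const 1) else Skip)"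

text \<open>Served entries stay in the array, so injectivity bounds the length of the queue by
  \<open>n\<close>. The degree bound on all entries, served ones included, prevents a vertex from
  entering twice.\<close>

definition qinv :: "nat \<Rightarrow> nat set \<Rightarrow> (nat \<Rightarrow> nat) \<Rightarrow> (nat \<Rightarrow> nat) \<Rightarrow> nat \<Rightarrow> nat \<Rightarrow> bool" where
  "qinv n A dg q qh qt \<longleftrightarrow> inj_on q {..<qt} \<and> (\<forall>i<qt. q i < n \<and> dg (q i) \<le> 1) \<and>
     (\<forall>v\<in>A. dg v \<le> 1 \<longrightarrow> v \<in> q ` {qh..<qt}) \<and> qh \<le> qt"

lemma qinv_le: "qinv n A dg q qh qt \<Longrightarrow> qt \<le> n"
  using card_inj_on_le[of q "{..<qt}" "{..<n}"] by (auto simp: qinv_def)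

lemma qinv_push:
  assumes "qinv n A dg q qh qt" "y < n" "dg y = 2"
  shows "qinv n A (dg(y := 1)) (q(qt := y)) qh (Suc qt)"
  unfolding qinv_def
proof (intro conjI allI ballI impI)
  have y: "y \<notin> q ` {..<qt}" using assms by (force simp: qinv_def)
  then show "inj_on (q(qt := y)) {..<Suc qt}"
    using assms by (auto simp: qinv_def inj_on_def less_Suc_eq)
  fix v assume v: "v \<in> A" "(dg(y := 1)) v \<le> 1"
  show "v \<in> (q(qt := y)) ` {qh..<Suc qt}"
  proof (cases "v = y")
    case True
    then show ?thesis using assms by (auto simp: qinv_def image_iff intro!: bexI[of _ qt])
  next
    case False
    then have "v \<in> q ` {qh..<qt}" using v assms by (auto simp: qinv_def)
    then obtain i where "i \<in> {qh..<qt}" "v = q i" by blast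
    then show ?thesis by (auto simp: image_iff intro!: bexI[of _ i])
  qed
qed (use assms in \<open>auto simp: qinv_def less_Suc_eq\<close>)

lemma qinv_dec:
  assumes "qinv n A dg q qh qt" "dg y \<noteq> 2"
  shows "qinv n A (dg(y := dg y - 1)) q qh qt"
  unfolding qinv_def
proof (intro conjI allI ballI impI)
  fix v assume v: "v \<in> A" "(dg(y := dg y - 1)) v \<le> 1"
  then have "dg v \<le> 1" using assms(2) by (auto split: if_splits)
  then show "v \<in> q ` {qh..<qt}" using v assms by (auto simp: qinv_def)
next
  fix i assume "i < qt"
  then have "dg (q i) \<le> 1" using assms by (auto simp: qinv_def)
  then show "(dg(y := dg y - 1)) (q i) \<le> 1" by auto
qed (use assms in \<open>auto simp: qinv_def\<close>)

context graph_input begin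

text \<open>The vertex \<open>v\<close> is dead already, but the degrees of its neighbours still
  count it; the invariant corrects this by one for the neighbours not yet met. The cost of 10 per
  neighbour is 3 for the round and 7 for the longest branch.\<close>

lemma wp_Kill:
  assumes r: "r \<noteq> ''j''" "regs s r = v" and ok: "adj_ok s" and v: "v \<notin> alive s"
    and dg: "\<forall>y\<in>alive s. arrs s ''dg'' y = card (N y \<inter> alive s) + (if y \<in> N v then 1 else 0)"
    and q: "qinv n (alive s) (arrs s ''dg'') (arrs s ''q'') (regs s ''qh'') (regs s ''qt'')"
    and k: "10 * length (nb v) + 2 \<le> k"
    and Q: "\<And>k' s'. k \<le> k' + (10 * length (nb v) + 2) \<Longrightarrow>
      \<forall>y\<in>alive s. arrs s' ''dg'' y = card (N y \<inter> alive s) \<Longrightarrow>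
      qinv n (alive s) (arrs s' ''dg'') (arrs s' ''q'') (regs s ''qh'') (regs s' ''qt'') \<Longrightarrow>
      (if N v \<inter> alive s = {} then regs s' ''p'' = regs s ''p'' else regs s' ''p'' \<in> N v \<inter> alive s) \<Longrightarrow>
      (\<forall>y. arrs s' ''w'' y = (if b \<and> y \<in> N v \<inter> alive s then 1 else arrs s ''w'' y)) \<Longrightarrow>
      (\<And>x. x \<notin> {''j'', ''y'', ''p'', ''qt''} \<Longrightarrow> regs s' x = regs s x) \<Longrightarrow>
      (\<And>a. a \<notin> {''dg'', ''q'', ''w''} \<Longrightarrow> arrs s' a = arrs s a) \<Longrightarrow> Q k' s'"
  shows "wp (Kill r (mark b)) Q k s"
proof -
  let ?A = "alive s"
  define J where "J zs dg q qt p w \<longleftrightarrow> distinct zs \<and> set zs \<subseteq> N v \<and>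
     (\<forall>y\<in>?A. dg y = card (N y \<inter> ?A) + (if y \<in> set zs then 1 else 0)) \<and>
     qinv n ?A dg q (regs s ''qh'') qt \<and>
     (if (N v - set zs) \<inter> ?A = {} then p = regs s ''p'' else p \<in> (N v - set zs) \<inter> ?A) \<and>
     (\<forall>y. w y = (if b \<and> y \<in> (N v - set zs) \<inter> ?A then 1 else arrs s ''w'' y))"
    for zs dg q qt p w
  let ?I = "\<lambda>zs k' s'. k \<le> k' + 10 * (length (nb v) - length zs) + 1 \<and> length zs \<le> length (nb v) \<and>
     arrs s' ''x'' = arrs s ''x'' \<and>
     J zs (arrs s' ''dg'') (arrs s' ''q'') (regs s' ''qt'') (regs s' ''p'') (arrs s' ''w'')"
  let ?P = "\<lambda>k' s'. k \<le> k' + (10 * length (nb v) + 2) \<and>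
      J [] (arrs s' ''dg'') (arrs s' ''q'') (regs s' ''qt'') (regs s' ''p'') (arrs s' ''w'')"
  have aliveX: "y \<in> ?A \<longleftrightarrow> arrs s ''x'' y = 0" if "y \<in> N v" for y
    using N_lt[OF that] by (simp add: alive_def)
  have Jdead: "J zs dg q qt p w" if J: "J (z # zs) dg q qt p w" and z: "z \<notin> ?A" for z zs dg q qt p w
  proof -
    have S: "(N v - set zs) \<inter> ?A = (N v - set (z # zs)) \<inter> ?A" using z by auto
    have d: "\<forall>y\<in>?A. dg y = card (N y \<inter> ?A) + (if y \<in> set zs then 1 else 0)"
    proof
      fix y assume y: "y \<in> ?A"
      then have "dg y = card (N y \<inter> ?A) + (if y \<in> set (z # zs) then 1 else 0)" using J unfolding J_def by blast
      moreover have "y \<noteq> z" using y z by blast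
      ultimately show "dg y = card (N y \<inter> ?A) + (if y \<in> set zs then 1 else 0)" by simp
    qed
    have "distinct zs" "set zs \<subseteq> N v" using J unfolding J_def by auto
    then show ?thesis using J d unfolding J_def S by blast
  qed
  have Jlive: "1 \<le> dg z" "J zs (dg(z := dg z - 1)) (if dg z = 2 then q(qt := z) else q)
      (if dg z = 2 then Suc qt else qt) z (if b then w(z := 1) else w)"
    if J: "J (z # zs) dg q qt p w" and z: "z \<in> ?A" for z zs dg q qt p w
  proof -
    have J': "z \<in> N v" "z \<notin> set zs" "distinct zs" "set zs \<subseteq> N v" "qinv n ?A dg q (regs s ''qh'') qt"
      and d: "\<forall>y\<in>?A. dg y = card (N y \<inter> ?A) + (if y \<in> set (z # zs) then 1 else 0)"
      and w: "\<forall>y. w y = (if b \<and> y \<in> (N v - set (z # zs)) \<inter> ?A then 1 else arrs s ''w'' y)"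
      using J unfolding J_def by auto
    show "1 \<le> dg z" using d z by auto
    have S: "(N v - set zs) \<inter> ?A = insert z ((N v - set (z # zs)) \<inter> ?A)" using z J' by auto
    have "\<forall>y\<in>?A. (dg(z := dg z - 1)) y = card (N y \<inter> ?A) + (if y \<in> set zs then 1 else 0)"
      using d J' by auto
    moreover have "qinv n ?A (dg(z := dg z - 1)) (if dg z = 2 then q(qt := z) else q) (regs s ''qh'')
      (if dg z = 2 then Suc qt else qt)"
      using qinv_push[OF J'(5) N_lt[OF J'(1)]] qinv_dec[OF J'(5)] by auto
    moreover have "\<forall>y. (if b then w(z := 1) else w) y =
        (if b \<and> y \<in> (N v - set zs) \<inter> ?A then 1 else arrs s ''w'' y)"
      using w unfolding S by auto
    moreover have "if (N v - set zs) \<inter> ?A = {} then z = regs s ''p'' else z \<in> (N v - set zs) \<inter> ?A"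
      unfolding S by simp
    ultimately show "J zs (dg(z := dg z - 1)) (if dg z = 2 then q(qt := z) else q)
      (if dg z = 2 then Suc qt else qt) z (if b then w(z := 1) else w)"
      using J' unfolding J_def by blast
  qed
  have "wp (Kill r (mark b)) ?P k s"
    unfolding Kill_def
  proof (rule wp_ForNb[where I = ?I and ys = "nb v"])
    show "adj s (regs s r) (nb v)" using ok r by (simp add: adj_ok_def)
  next
    have "J (nb v) (arrs s ''dg'') (arrs s ''q'') (regs s ''qt'') (regs s ''p'') (arrs s ''w'')"
      unfolding J_def using dg q distinct_nb by simp
    then show "?I (nb v) (k - 1) s" by simp
  next
    fix k' s' assume "?I [] k' s'"
    then show "1 \<le> k' \<and> ?P (k' - 1) s'" using k by simp
  next
    fix z zs k' s' assume I: "?I (z # zs) k' s'" and z: "regs s' ''y'' = z"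
    have "11 \<le> k'" using I k by auto
    then obtain r where r: "k' = 11 + r" using le_Suc_ex by blast
    have kk: "k \<le> r + 10 * (length (nb v) - length zs) + 2" "length zs \<le> length (nb v)" using I r by auto
    have x: "arrs s' ''x'' = arrs s ''x''" and
      J: "J (z # zs) (arrs s' ''dg'') (arrs s' ''q'') (regs s' ''qt'') (regs s' ''p'') (arrs s' ''w'')"
      using I by blast+
    have zN: "z \<in> N v" using J by (simp add: J_def)
    show "3 \<le> k' \<and> wp (KillB (mark b)) (?I zs) (k' - 3) s'"
    proof (cases "z \<in> ?A")
      case False
      then have "arrs s ''x'' z \<noteq> 0" using aliveX zN by blast
      then show ?thesis using x z r kk Jdead[OF J False] unfolding KillB_def by simp
    next
      case True
      then have "arrs s ''x'' z = 0" using aliveX zN by blast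
      moreover have "arrs s' ''dg'' z - Suc 0 = Suc 0 \<longleftrightarrow> arrs s' ''dg'' z = 2"
        using Jlive(1)[OF J True] by auto
      ultimately show ?thesis using x z r kk Jlive(2)[OF J True] unfolding KillB_def mark_def
        by (cases b; cases "arrs s' ''dg'' z = 2") simp_all
    qed
  qed (use k r in \<open>auto simp: KillB_def mark_def\<close>)
  then show ?thesis
  proof (rule wp_frame, goal_cases)
    case (1 k' s')
    from 1(1) have c: "k \<le> k' + (10 * length (nb v) + 2)" by blast
    from 1(1) have J: "J [] (arrs s' ''dg'') (arrs s' ''q'') (regs s' ''qt'') (regs s' ''p'') (arrs s' ''w'')"
      by blast
    have P1: "\<forall>y\<in>alive s. arrs s' ''dg'' y = card (N y \<inter> alive s)" using J unfolding J_def by simp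
    have P2: "qinv n (alive s) (arrs s' ''dg'') (arrs s' ''q'') (regs s ''qh'') (regs s' ''qt'')"
      using J unfolding J_def by blast
    have P3: "if N v \<inter> alive s = {} then regs s' ''p'' = regs s ''p'' else regs s' ''p'' \<in> N v \<inter> alive s"
      using J unfolding J_def list.set Diff_empty by blast
    have P4: "\<forall>y. arrs s' ''w'' y = (if b \<and> y \<in> N v \<inter> alive s then 1 else arrs s ''w'' y)"
      using J unfolding J_def list.set Diff_empty by blast
    show ?case
    proof (rule Q)
      fix x :: string assume "x \<notin> {''j'', ''y'', ''p'', ''qt''}"
      then show "regs s' x = regs s x" using 1(2)[of x] by (auto simp: Kill_def KillB_def ForNb_def mark_def)
    next
      fix x :: string assume "x \<notin> {''dg'', ''q'', ''w''}"
      then show "arrs s' x = arrs s x" using 1(3)[of x] by (auto simp: Kill_def KillB_def ForNb_def mark_def)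
    qed (use c in simp, rule P1, rule P2, rule P3, rule P4)
  qed
qed

end

section \<open>Stripping leaves\<close>

lemma adj_setr [simp]: "adj (setr r x s) v ys \<longleftrightarrow> adj s v ys"
  by (simp add: adj_def)

text \<open>\<open>Kill\<close> marks living neighbours only, so array \<open>w\<close> represents
  the new exempt set just on the remaining vertices.\<close>

lemma reduction_cong_free:
  assumes "reduction V E W V' E' W' L" "W' \<inter> V' = W'' \<inter> V'"
  shows "reduction V E W V' E' W'' L"
proof -
  have "dominating V' E' W' = dominating V' E' W''"
    using dominating_Int[of V' E' W'] dominating_Int[of V' E' W''] assms(2) by (auto simp: fun_eq_iff)
  then show ?thesis using assms(1) unfolding reduction_def by simp
qed

text \<open>The value \<open>n\<close> in \<open>p\<close> stands for the absence of a living
  neighbour. Queue entries may have died in the meantime as neighbours of other leaves; the outer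
  test skips them.\<close>

definition StripB :: prog where
  "StripB = seqs
    [Assign ''v'' (Arr ''q'' (Reg ''qh'')), Assign ''qh'' (Inc (Reg ''qh'')),
     Cond (EqT (Arr ''x'' (Reg ''v'')) (Const 0)) (seqs
       [Store ''x'' (Reg ''v'') (Const 1), Assign ''p'' (Reg ''n''), Kill ''v'' (mark False),
        Cond (EqT (Arr ''w'' (Reg ''v'')) (Const 0))
          (Cond (Less (Reg ''p'') (Reg ''n''))
            (seqs [Assign ''r'' (Reg ''p''), Store ''s'' (Reg ''r'') (Const 1),
               Store ''x'' (Reg ''r'') (Const 1), Kill ''r'' (mark True)])
            (Store ''s'' (Reg ''v'') (Const 1))) Skip]) Skip]"

definition Strip :: prog where
  "Strip = seqs
    [Assign ''qt'' (Const 0),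
     Loop ''i'' ''n'' (Cond (Less (Arr ''dg'' (Reg ''i'')) (Const 2))
        (seqs [Store ''q'' (Reg ''qt'') (Reg ''i''), Assign ''qt'' (Inc (Reg ''qt''))]) Skip),
     Assign ''qh'' (Const 0), While (Less (Reg ''qh'') (Reg ''qt'')) StripB]"

context graph_input begin

definition sinv :: "store \<Rightarrow> bool" where
  "sinv s \<longleftrightarrow> adj_ok s \<and> (\<forall>v. arrs s ''w'' v \<le> 1) \<and>
     (\<forall>y\<in>alive s. arrs s ''dg'' y = card (N y \<inter> alive s)) \<and>
     qinv n (alive s) (arrs s ''dg'') (arrs s ''q'') (regs s ''qh'') (regs s ''qt'') \<and>
     reduction {0..<n} E {} (alive s) (ind E (alive s)) (nz (arrs s ''w'')) (\<lambda>D. D \<union> nz (arrs s ''s'')) \<and>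
     nz (arrs s ''s'') \<subseteq> {0..<n}"

text \<open>A vertex dies once, and \<open>Kill\<close> then takes 10 steps per neighbour in the
  input graph.\<close>

definition pot :: "nat set \<Rightarrow> nat" where
  "pot A = (\<Sum>v\<in>A. 10 * length (nb v))"

lemma finite_alive [simp]: "finite (alive s)"
  by (simp add: alive_def)

lemma pot_remove: "finite A \<Longrightarrow> v \<in> A \<Longrightarrow> pot A = 10 * length (nb v) + pot (A - {v})"
  by (simp add: pot_def sum.remove)

lemma alive_upd: "arrs s' ''x'' = (arrs s ''x'')(v := Suc 0) \<Longrightarrow> alive s' = alive s - {v}"
  by (auto simp: alive_def)

lemma adj_ok_cong:
  assumes "adj_ok s" "\<And>a. a \<in> {''to'', ''nx'', ''hd'', ''src'', ''dst''} \<Longrightarrow> arrs s' a = arrs s a"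
    "\<And>x. x \<in> {''n'', ''m''} \<Longrightarrow> regs s' x = regs s x"
  shows "adj_ok s'"
  using assms unfolding adj_ok_def adj_def by simp

lemma alive_cong: "arrs s' ''x'' = arrs s ''x'' \<Longrightarrow> alive s' = alive s"
  by (simp add: alive_def)

lemma qinv_mono: "qinv n A dg q qh qt \<Longrightarrow> B \<subseteq> A \<Longrightarrow> qinv n B dg q qh qt"
  unfolding qinv_def by blast

text \<open>The first call of \<open>Kill\<close> leaves in \<open>p\<close> the neighbour of the vertex \<open>v\<close>, if there is one.\<close>

lemma wp_StripB:
  assumes inv: "sinv s" and q: "regs s ''qh'' < regs s ''qt''"
    and k: "15 * (n - regs s ''qh'') + pot (alive s) + 1 \<le> k"
  shows "wp StripB (\<lambda>k' s'. sinv s' \<and> 15 * (n - regs s' ''qh'') + pot (alive s') + 1 \<le> k') (k - 1) s"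
proof -
  let ?Q = "\<lambda>k' s'. sinv s' \<and> 15 * (n - regs s' ''qh'') + pot (alive s') + 1 \<le> k'"
  let ?A = "alive s"
  define v where "v = arrs s ''q'' (regs s ''qh'')"
  define h where "h = Suc (regs s ''qh'')"
  have adj: "adj_ok s" and w1: "\<forall>v. arrs s ''w'' v \<le> 1"
    and dg: "\<forall>y\<in>?A. arrs s ''dg'' y = card (N y \<inter> ?A)"
    and qi: "qinv n ?A (arrs s ''dg'') (arrs s ''q'') (regs s ''qh'') (regs s ''qt'')"
    and red: "reduction {0..<n} E {} ?A (ind E ?A) (nz (arrs s ''w'')) (\<lambda>D. D \<union> nz (arrs s ''s''))"
    and sV: "nz (arrs s ''s'') \<subseteq> {0..<n}"
    using inv by (auto simp: sinv_def)
  have vn: "v < n" "arrs s ''dg'' v \<le> 1" using qi q by (auto simp: qinv_def v_def)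
  have hn: "regs s ''qh'' < n" using q qinv_le[OF qi] by simp
  have qi': "qinv n (?A - {v}) (arrs s ''dg'') (arrs s ''q'') h (regs s ''qt'')"
    unfolding qinv_def
  proof (intro conjI ballI impI)
    fix y assume "y \<in> ?A - {v}" "arrs s ''dg'' y \<le> 1"
    then have "y \<in> arrs s ''q'' ` {regs s ''qh''..<regs s ''qt''}" "y \<noteq> v" using qi by (auto simp: qinv_def)
    then obtain i where i: "i \<in> {regs s ''qh''..<regs s ''qt''}" "y = arrs s ''q'' i" "y \<noteq> v" by blast
    then have "i \<noteq> regs s ''qh''" by (auto simp: v_def)
    then show "y \<in> arrs s ''q'' ` {h..<regs s ''qt''}" using i by (auto simp: h_def)
  qed (use qi q in \<open>auto simp: qinv_def h_def\<close>)
  have AV: "?A \<subseteq> {0..<n}" by (auto simp: alive_def)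
  obtain c where c: "k = 15 + 15 * (n - h) + pot ?A + 1 + c"
    using k hn le_Suc_ex unfolding h_def
    by (metis (no_types, lifting) Suc_diff_Suc mult_Suc_right)
  show ?thesis
  proof (cases "v \<in> ?A")
    case False
    then have x: "arrs s ''x'' v \<noteq> 0" using vn by (auto simp: alive_def)
    have al: "alive (setr ''qh'' h (setr ''v'' v s)) = ?A" by (rule alive_cong) simp
    have "adj_ok (setr ''qh'' h (setr ''v'' v s))" by (rule adj_ok_cong[OF adj]) auto
    then have "sinv (setr ''qh'' h (setr ''v'' v s))"
      unfolding sinv_def al using w1 dg qi' False red sV by simp
    then show ?thesis unfolding StripB_def using x c al
      by (simp add: v_def[symmetric] h_def[symmetric])
  next
    case True
    let ?B = "?A - {v}"
    have x: "arrs s ''x'' v = 0" using True by (auto simp: alive_def)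
    have Av: "?A = insert v ?B" using True by auto
    have vN: "v \<notin> N v" using nbh_subset[OF sg] by blast
    have leaf: "card (N v \<inter> ?A) \<le> 1" using dg True vn by auto
    have pA: "pot ?A = 10 * length (nb v) + pot ?B" using pot_remove[OF _ True] by simp
    define s1 where "s1 = setr ''p'' n (seta ''x'' v 1 (setr ''qh'' h (setr ''v'' v s)))"
    have al1: "alive s1 = ?B" by (rule alive_upd) (simp add: s1_def)
    let ?R = "\<lambda>k' s'. 15 * (n - h) + pot ?B + 8 \<le> k' \<and>
      (\<forall>y\<in>?B. arrs s' ''dg'' y = card (N y \<inter> ?B)) \<and>
      qinv n ?B (arrs s' ''dg'') (arrs s' ''q'') h (regs s' ''qt'') \<and>
      (if N v \<inter> ?B = {} then regs s' ''p'' = n else regs s' ''p'' \<in> N v \<inter> ?B) \<and>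
      arrs s' ''w'' = arrs s ''w'' \<and> arrs s' ''x'' = arrs s1 ''x'' \<and> arrs s' ''s'' = arrs s ''s'' \<and>
      regs s' ''v'' = v \<and> regs s' ''qh'' = h \<and> regs s' ''n'' = n \<and> adj_ok s'"
    have kill1: "wp (Kill ''v'' (mark False)) ?R (k - 6) s1"
    proof (rule wp_Kill[where v = v])
      show "adj_ok s1" by (rule adj_ok_cong[OF adj]) (auto simp: s1_def)
      show "v \<notin> alive s1" using al1 by simp
      show "\<forall>y\<in>alive s1. arrs s1 ''dg'' y = card (N y \<inter> alive s1) + (if y \<in> N v then 1 else 0)"
      proof
        fix y assume y: "y \<in> alive s1"
        have "card (N y \<inter> ?A) = card (N y \<inter> ?B) + (if y \<in> N v then 1 else 0)"
        proof (cases "y \<in> N v")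
          case t: True
          then have "N y \<inter> ?A = insert v (N y \<inter> ?B)" using Av nbh_sym[of y E v] True by auto
          then show ?thesis using t by simp
        next
          case False
          then have "N y \<inter> ?A = N y \<inter> ?B" using nbh_sym[of y E v] by auto
          then show ?thesis using False by simp
        qed
        then show "arrs s1 ''dg'' y = card (N y \<inter> alive s1) + (if y \<in> N v then 1 else 0)"
          using y dg unfolding al1 by (simp add: s1_def)
      qed
      show "qinv n (alive s1) (arrs s1 ''dg'') (arrs s1 ''q'') (regs s1 ''qh'') (regs s1 ''qt'')"
        unfolding al1 using qi' by (simp add: s1_def)
    next
      fix k' s' assume a: "k - 6 \<le> k' + (10 * length (nb v) + 2)"
        "\<forall>y\<in>alive s1. arrs s' ''dg'' y = card (N y \<inter> alive s1)"
        "qinv n (alive s1) (arrs s' ''dg'') (arrs s' ''q'') (regs s1 ''qh'') (regs s' ''qt'')"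
        "if N v \<inter> alive s1 = {} then regs s' ''p'' = regs s1 ''p'' else regs s' ''p'' \<in> N v \<inter> alive s1"
        "\<forall>y. arrs s' ''w'' y = (if False \<and> y \<in> N v \<inter> alive s1 then 1 else arrs s1 ''w'' y)"
        and f: "\<And>x. x \<notin> {''j'', ''y'', ''p'', ''qt''} \<Longrightarrow> regs s' x = regs s1 x"
        "\<And>a. a \<notin> {''dg'', ''q'', ''w''} \<Longrightarrow> arrs s' a = arrs s1 a"
      have "arrs s' ''w'' = arrs s ''w''" using a(5) by (auto simp: s1_def)
      moreover have "adj_ok s'" by (rule adj_ok_cong[OF adj]) (auto simp: s1_def f)
      moreover have "15 * (n - h) + pot ?B + 8 \<le> k'" using a(1) c pA by simp
      moreover have p1: "regs s1 ''p'' = n" "regs s1 ''qh'' = h" by (simp_all add: s1_def)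
      moreover have "arrs s' ''x'' = arrs s1 ''x''" "arrs s' ''s'' = arrs s ''s''" "regs s' ''v'' = v"
        "regs s' ''qh'' = h" "regs s' ''n'' = n"
        using f adj by (simp_all add: s1_def adj_ok_def)
      ultimately show "?R k' s'" using a(2-4) unfolding al1 p1 by blast
    qed (use c pA in \<open>auto simp: s1_def\<close>)
    have rest: "wp (Cond (EqT (Arr ''w'' (Reg ''v'')) (Const 0))
          (Cond (Less (Reg ''p'') (Reg ''n''))
            (seqs [Assign ''r'' (Reg ''p''), Store ''s'' (Reg ''r'') (Const 1),
               Store ''x'' (Reg ''r'') (Const 1), Kill ''r'' (mark True)])
            (Store ''s'' (Reg ''v'') (Const 1))) Skip) ?Q k2 s2" if R: "?R k2 s2" for k2 s2
    proof -
      have al2: "alive s2 = ?B" using R al1 by (simp add: alive_def)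
      have ad2: "adj_ok s2" using R by blast
      obtain d where d: "k2 = 15 * (n - h) + pot ?B + 8 + d" using R le_Suc_ex by blast
      have x2: "arrs s2 ''x'' = (arrs s ''x'')(v := Suc 0)" using R by (simp add: s1_def)
      have NAB: "N v \<inter> ?A = N v \<inter> ?B" using vN by auto
      \<comment> \<open>The three leaf rules, told apart by the program through \<open>w\<close> and
        \<open>p\<close>.\<close>
      consider (free) "arrs s ''w'' v \<noteq> 0" | (iso) "arrs s ''w'' v = 0" "N v \<inter> ?B = {}"
        | (leaf) "arrs s ''w'' v = 0" "N v \<inter> ?B \<noteq> {}" by blast
      then show ?thesis
      proof cases
        case free
        have "reduction {0..<n} E {} ?B (ind E ?B) (nz (arrs s ''w'')) (\<lambda>D. D \<union> nz (arrs s ''s''))"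
          using reduction_trans[OF red reduction_free_leaf[OF sg AV True _ leaf, of "nz (arrs s ''w'')"]] free
          by (simp add: nz_def)
        then have "sinv s2" unfolding sinv_def al2 using R w1 sV by simp
        then show ?thesis using R free d al2 by simp
      next
        case iso
        have "reduction {0..<n} E {} ?B (ind E ?B) (nz (arrs s ''w'')) (\<lambda>D. insert v D \<union> nz (arrs s ''s''))"
          using reduction_trans[OF red reduction_isolated[OF sg AV True, of "nz (arrs s ''w'')"]] iso NAB
          by (simp add: nz_def)
        moreover have "(\<lambda>D. insert v D \<union> nz (arrs s ''s'')) = (\<lambda>D. D \<union> insert v (nz (arrs s ''s'')))" by auto
        moreover have "alive (seta ''s'' v (Suc 0) s2) = ?B" using al2 by (simp add: alive_def)
        moreover have "adj_ok (seta ''s'' v (Suc 0) s2)" by (rule adj_ok_cong[OF ad2]) auto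
        ultimately have "sinv (seta ''s'' v (Suc 0) s2)" unfolding sinv_def using R w1 sV vn by simp
        then show ?thesis using R iso d \<open>alive (seta ''s'' v (Suc 0) s2) = ?B\<close> by simp
      next
        case leaf2: leaf
        define p where "p = regs s2 ''p''"
        have p: "p \<in> N v \<inter> ?B" using R leaf2 by (simp add: p_def)
        then have pn: "p < n" "p \<in> ?B" using N_lt by auto
        have Np: "N v \<inter> ?A = {p}"
        proof -
          have "{p} \<subseteq> N v \<inter> ?A" using p by auto
          moreover have "finite (N v \<inter> ?A)" by simp
          ultimately show ?thesis using leaf by (metis card.empty card_insert_disjoint card_seteq empty_iff finite.emptyI One_nat_def)
        qed
        let ?C = "?B - {p}"
        define s3 where "s3 = seta ''x'' p 1 (seta ''s'' p 1 (setr ''r'' p s2))"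
        have al3: "alive s3 = ?C" unfolding al2[symmetric] by (rule alive_upd) (simp add: s3_def)
        have pB: "pot ?B = 10 * length (nb p) + pot ?C" using pot_remove[OF _ pn(2)] by simp
        have red3: "reduction {0..<n} E {} ?C (ind E ?C) (nz (arrs s ''w'') \<union> N p) (\<lambda>D. D \<union> insert p (nz (arrs s ''s'')))"
        proof -
          have "reduction {0..<n} E {} ?C (ind E ?C) (nz (arrs s ''w'') \<union> N p) (\<lambda>D. insert p D \<union> nz (arrs s ''s''))"
            using reduction_trans[OF red reduction_leaf[OF sg AV True, of "nz (arrs s ''w'')" p]] leaf2 Np
            by (simp add: nz_def)
          moreover have "(\<lambda>D. insert p D \<union> nz (arrs s ''s'')) = (\<lambda>D. D \<union> insert p (nz (arrs s ''s'')))" by auto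
          ultimately show ?thesis by simp
        qed
        have "wp (Kill ''r'' (mark True)) ?Q (k2 - 5) s3"
        proof (rule wp_Kill[where v = p])
          show "adj_ok s3" by (rule adj_ok_cong[OF ad2]) (auto simp: s3_def)
          show "p \<notin> alive s3" using al3 by simp
          show "\<forall>y\<in>alive s3. arrs s3 ''dg'' y = card (N y \<inter> alive s3) + (if y \<in> N p then 1 else 0)"
          proof
            fix y assume y: "y \<in> alive s3"
            have "card (N y \<inter> ?B) = card (N y \<inter> ?C) + (if y \<in> N p then 1 else 0)"
            proof (cases "y \<in> N p")
              case t: True
              then have "N y \<inter> ?B = insert p (N y \<inter> ?C)" using pn nbh_sym[of y E p] by auto
              then show ?thesis using t by simp
            next
              case False
              then have "N y \<inter> ?B = N y \<inter> ?C" using nbh_sym[of y E p] by auto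
              then show ?thesis using False by simp
            qed
            then show "arrs s3 ''dg'' y = card (N y \<inter> alive s3) + (if y \<in> N p then 1 else 0)"
              using y R unfolding al3 by (simp add: s3_def)
          qed
          show "qinv n (alive s3) (arrs s3 ''dg'') (arrs s3 ''q'') (regs s3 ''qh'') (regs s3 ''qt'')"
            unfolding al3 using R qinv_mono[of ?B _ _ _ _ ?C] by (simp add: s3_def)
        next
          fix k' s' assume a: "k2 - 5 \<le> k' + (10 * length (nb p) + 2)"
            "\<forall>y\<in>alive s3. arrs s' ''dg'' y = card (N y \<inter> alive s3)"
            "qinv n (alive s3) (arrs s' ''dg'') (arrs s' ''q'') (regs s3 ''qh'') (regs s' ''qt'')"
            "if N p \<inter> alive s3 = {} then regs s' ''p'' = regs s3 ''p'' else regs s' ''p'' \<in> N p \<inter> alive s3"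
            "\<forall>y. arrs s' ''w'' y = (if True \<and> y \<in> N p \<inter> alive s3 then 1 else arrs s3 ''w'' y)"
            and f: "\<And>x. x \<notin> {''j'', ''y'', ''p'', ''qt''} \<Longrightarrow> regs s' x = regs s3 x"
            "\<And>a. a \<notin> {''dg'', ''q'', ''w''} \<Longrightarrow> arrs s' a = arrs s3 a"
          have ad: "adj_ok s'" by (rule adj_ok_cong[OF ad2]) (auto simp: s3_def f)
          have al: "alive s' = ?C" using al3 f by (simp add: alive_def)
          have w: "arrs s' ''w'' y = (if y \<in> N p \<inter> ?C then 1 else arrs s ''w'' y)" for y
            using a(5) R al3 by (simp add: s3_def)
          then have "nz (arrs s' ''w'') \<inter> ?C = (nz (arrs s ''w'') \<union> N p) \<inter> ?C" by (auto simp: nz_def)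
          then have "reduction {0..<n} E {} ?C (ind E ?C) (nz (arrs s' ''w'')) (\<lambda>D. D \<union> insert p (nz (arrs s ''s'')))"
            using reduction_cong_free[OF red3] by simp
          moreover have "nz (arrs s' ''s'') = insert p (nz (arrs s ''s''))" using f R by (simp add: s3_def)
          moreover have "regs s' ''qh'' = h" using f R by (simp add: s3_def)
          moreover have "\<forall>v. arrs s' ''w'' v \<le> 1" using w w1 by simp
          ultimately have "sinv s'" unfolding sinv_def al using ad a(2,3) al3 sV pn R by (simp add: s3_def)
          then show "?Q k' s'" using a(1) d pB al \<open>regs s' ''qh'' = h\<close> by simp
        qed (use d pB in \<open>auto simp: s3_def\<close>)
        then show ?thesis using R leaf2 d pn unfolding s3_def p_def by simp
      qed
    qed
    have "wp (Seq (Kill ''v'' (mark False)) (Cond (EqT (Arr ''w'' (Reg ''v'')) (Const 0))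
          (Cond (Less (Reg ''p'') (Reg ''n''))
            (seqs [Assign ''r'' (Reg ''p''), Store ''s'' (Reg ''r'') (Const 1),
               Store ''x'' (Reg ''r'') (Const 1), Kill ''r'' (mark True)])
            (Store ''s'' (Reg ''v'') (Const 1))) Skip)) ?Q (k - 6) s1"
      unfolding wp_Seq using wp_mono[OF kill1 rest] .
    then show ?thesis unfolding StripB_def s1_def using x c adj
      by (simp add: v_def[symmetric] h_def[symmetric] adj_ok_def)
  qed
qed


lemma sum_pot: "pot {0..<n} \<le> 20 * length es"
  using sum_nb unfolding pot_def sum_distrib_left[symmetric] by linarith

text \<open>Per vertex, 5 steps fill the queue and 15 serve an entry; per edge, the potential holds
  10 steps for each end point. An empty queue leaves no living vertex of degree at most one.\<close>

lemma wp_Strip: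
  assumes adj: "adj_ok s" and dg: "\<forall>v. arrs s ''dg'' v = length (nb v)"
    and z: "arrs s ''x'' = (\<lambda>_. 0)" "arrs s ''w'' = (\<lambda>_. 0)" "arrs s ''s'' = (\<lambda>_. 0)"
    and k: "20 * n + 20 * length es + 6 \<le> k"
    and Q: "\<And>k' s'. k \<le> k' + (20 * n + 20 * length es + 6) \<Longrightarrow> sinv s' \<Longrightarrow>
      \<forall>v\<in>alive s'. 2 \<le> card (N v \<inter> alive s') \<Longrightarrow>
      (\<And>x. x \<notin> wregs Strip \<Longrightarrow> regs s' x = regs s x) \<Longrightarrow>
      (\<And>a. a \<notin> warrs Strip \<Longrightarrow> arrs s' a = arrs s a) \<Longrightarrow> Q k' s'"
  shows "wp Strip Q k s"
proof -
  obtain c where c: "k = 20 * n + 20 * length es + 6 + c" using k le_Suc_ex by blast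
  let ?V = "{0..<n}"
  let ?J = "\<lambda>k' s. sinv s \<and> 15 * (n - regs s ''qh'') + pot (alive s) + 1 + c \<le> k'"
  let ?P = "\<lambda>k' s'. k \<le> k' + (20 * n + 20 * length es + 6) \<and> sinv s' \<and>
     (\<forall>v\<in>alive s'. 2 \<le> card (N v \<inter> alive s'))"
  let ?I = "\<lambda>i k' s. 5 * (n - i) + 15 * n + 20 * length es + 3 + c \<le> k' \<and> adj_ok s \<and>
    (\<forall>v. arrs s ''dg'' v = length (nb v)) \<and>
    arrs s ''x'' = (\<lambda>_. 0) \<and> arrs s ''w'' = (\<lambda>_. 0) \<and> arrs s ''s'' = (\<lambda>_. 0) \<and>
    inj_on (arrs s ''q'') {..<regs s ''qt''} \<and>
    arrs s ''q'' ` {..<regs s ''qt''} = {v. v < i \<and> length (nb v) < 2}"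
  have while: "wp (While (Less (Reg ''qh'') (Reg ''qt'')) StripB) ?P k1 s1"
    if "?J k1 s1" for k1 s1
  proof (rule wp_While[where I = ?J, OF that])
    fix k s assume J: "?J k s" and b: "eval_test (Less (Reg ''qh'') (Reg ''qt'')) s"
    then have "wp StripB (\<lambda>k' s'. sinv s' \<and> 15 * (n - regs s' ''qh'') + pot (alive s') + 1 \<le> k') (k - c - 1) s"
      by (intro wp_StripB) auto
    moreover have "k - c - 1 = k - 1 - c" "c \<le> k - 1" using J by auto
    ultimately have "wp StripB (\<lambda>k' s'. c \<le> k' \<and> (sinv s' \<and> 15 * (n - regs s' ''qh'') + pot (alive s') + 1 \<le> k' - c)) (k - 1) s"
      using wp_pay[of StripB _ "k - 1" c s] by simp
    then show "wp StripB ?J (k - 1) s" by (rule wp_mono) auto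
  next
    fix k' s assume J: "?J k' s" and b: "\<not> eval_test (Less (Reg ''qh'') (Reg ''qt'')) s"
    have "\<forall>v\<in>alive s. \<not> arrs s ''dg'' v \<le> 1" using J b by (auto simp: sinv_def qinv_def)
    then have "\<forall>v\<in>alive s. 2 \<le> card (N v \<inter> alive s)" using J by (auto simp: sinv_def)
    then show "?P (k' - 1) s" using J c by auto
  qed auto
  have "wp Strip ?P k s"
    unfolding Strip_def seqs.simps wp_Seq wp_Assign
  proof (intro conjI, goal_cases)
    case 1
    then show ?case using c by simp
  next
    case 2
    show ?case
    proof (rule wp_Loop[where I = ?I and N = n])
      fix i k' s assume I: "?I i k' s" and i: "regs s ''i'' = i" "i < n" "regs s ''n'' = n"
      obtain e where e: "k' = 5 + 5 * (n - Suc i) + 15 * n + 20 * length es + 3 + c + e"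
      proof -
        have "5 * (n - i) = 5 + 5 * (n - Suc i)" using i by simp
        then have "5 + 5 * (n - Suc i) + 15 * n + 20 * length es + 3 + c \<le> k'" using I by linarith
        then show ?thesis using that le_Suc_ex by blast
      qed
      let ?s = "setr ''qt'' (Suc (regs s ''qt'')) (seta ''q'' (regs s ''qt'') i s)"
      have ad: "adj_ok ?s" by (rule adj_ok_cong[of s]) (use I in auto)
      have new: "i \<notin> arrs s ''q'' ` {..<regs s ''qt''}" using I by auto
      have low: "{v. v < Suc i \<and> length (nb v) < 2} =
          (if length (nb i) < 2 then insert i {v. v < i \<and> length (nb v) < 2} else {v. v < i \<and> length (nb v) < 2})"
        by (auto simp: less_Suc_eq)
      have im: "((arrs s ''q'')(regs s ''qt'' := i)) ` {..<regs s ''qt''} = arrs s ''q'' ` {..<regs s ''qt''}"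
        by (intro image_cong) auto
      have "inj_on ((arrs s ''q'')(regs s ''qt'' := i)) {..<Suc (regs s ''qt'')}"
        unfolding lessThan_Suc inj_on_insert using I im new by (auto simp: inj_on_def)
      moreover have "((arrs s ''q'')(regs s ''qt'' := i)) ` {..<Suc (regs s ''qt'')} =
          insert i (arrs s ''q'' ` {..<regs s ''qt''})"
        unfolding lessThan_Suc image_insert im by simp
      ultimately show "2 \<le> k' \<and> wp (Cond (Less (Arr ''dg'' (Reg ''i'')) (Const 2))
        (Seq (Store ''q'' (Reg ''qt'') (Reg ''i'')) (Assign ''qt'' (Inc (Reg ''qt'')))) Skip) (?I (Suc i)) (k' - 2) s"
        using I i e ad low by simp
    next
      fix k' s assume I: "?I n k' s"
      let ?s = "setr ''qh'' 0 s"
      have al: "alive ?s = ?V" using I by (auto simp: alive_def)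
      have "adj_ok ?s" by (rule adj_ok_cong[of s]) (use I in auto)
      moreover have "\<forall>y\<in>?V. length (nb y) = card (N y \<inter> ?V)"
      proof
        fix y have "N y \<inter> ?V = N y" using N_lt by auto
        then show "length (nb y) = card (N y \<inter> ?V)" by (simp add: length_nb)
      qed
      moreover have "qinv n ?V (arrs s ''dg'') (arrs s ''q'') 0 (regs s ''qt'')"
        unfolding qinv_def
      proof (intro conjI allI ballI impI)
        fix i assume "i < regs s ''qt''"
        then have "arrs s ''q'' i \<in> {v. v < n \<and> length (nb v) < 2}" using I by blast
        then show "arrs s ''q'' i < n" "arrs s ''dg'' (arrs s ''q'' i) \<le> 1" using I by auto
      next
        fix v assume "v \<in> ?V" "arrs s ''dg'' v \<le> 1"
        then have "v \<in> {v. v < n \<and> length (nb v) < 2}" using I by auto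
        then show "v \<in> arrs s ''q'' ` {0..<regs s ''qt''}" using I by (simp add: atLeast0LessThan)
      qed (use I in auto)
      moreover have "ind E ?V = E" using sg by (auto simp: ind_def simple_graph_def)
      moreover have "nz (\<lambda>_. 0) = {}" by (simp add: nz_def)
      ultimately have "sinv ?s" unfolding sinv_def al using I reduction_refl[of ?V E "{}"] by simp
      moreover have "15 * n + pot ?V + 1 + c + 2 \<le> k'" using I sum_pot by auto
      ultimately have J: "?J (k' - 2) ?s" unfolding al by simp
      show "1 \<le> k' \<and> 1 \<le> k' - 1 \<and>
        wp (While (Less (Reg ''qh'') (Reg ''qt'')) StripB) ?P (k' - 1 - 1) (setr ''qh'' (eval_exp (Const 0) s) s)"
      proof -
        have "3 \<le> k'" using I by auto
        then obtain r where "k' = 3 + r" using le_Suc_ex by blast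
        then show ?thesis using while[OF J] by simp
      qed
    next
      show "?I 0 (k - 1 - 1) (setr ''qt'' (eval_exp (Const 0) s) s)"
        using c dg z by (auto intro!: adj_ok_cong[OF adj])
    qed (use c adj in \<open>auto simp: adj_ok_def\<close>)
  qed
  then show ?thesis by (rule wp_frame) (use Q in blast)
qed

end

section \<open>The log, and the stack as the program sees it\<close>

definition lg :: "(nat \<Rightarrow> 'a) \<Rightarrow> (nat \<Rightarrow> 'a) \<Rightarrow> (nat \<Rightarrow> 'a) \<Rightarrow> (nat \<Rightarrow> 'a) \<Rightarrow> (nat \<Rightarrow> 'a) \<Rightarrow> nat \<Rightarrow>
    ('a \<times> 'a \<times> 'a \<times> 'a \<times> 'a) list" where
  "lg p z a b c m = map (\<lambda>i. (p i, z i, a i, b i, c i)) [0..<m]"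

lemma lg_snoc [simp]:
  "lg (p(m := p')) (z(m := z')) (a(m := a')) (b(m := b')) (c(m := c')) (Suc m) =
     lg p z a b c m @ [(p', z', a', b', c')]"
  by (simp add: lg_def)

definition lgs :: "store \<Rightarrow> (nat \<times> nat \<times> nat \<times> nat \<times> nat) list" where
  "lgs s = lg (arrs s ''lp'') (arrs s ''lz'') (arrs s ''la'') (arrs s ''lB'') (arrs s ''lc'') (regs s ''ln'')"

text \<open>The patterns whose first letter survives the rule. They are tested with
  \<open>cu\<close> in front of the stack while \<open>cu\<close> is not yet on it, since the rule
  deletes vertices below \<open>cu\<close> and needs \<open>cu\<close> to be exempt.\<close>

fun bad45 :: "bool list \<Rightarrow> bool" where
  "bad45 (True # True # True # _) = True"
| "bad45 (True # True # False # True # True # _) = True"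
| "bad45 _ = False"

lemma bad45_bad: "bad45 xs \<Longrightarrow> bad xs"
  by (induction xs rule: bad45.induct) auto

text \<open>The program stores only the top \<open>tp\<close>; array \<open>lf\<close> leads to the
  rest. The number \<open>g\<close> accounts for the vertices kept on earlier paths.\<close>

definition stk where
  "stk E A W H Vis lf Em u pr cu g K log tp ss \<longleftrightarrow> winv E A W H Vis K lf Em log u ss pr cu \<and>
     tp = peek ss u \<and> irr (map (\<lambda>v. v \<in> W) ss) \<and> card K \<le> g + length ss"

text \<open>A hub has label 2 whether or not it lies in \<open>W\<close>, so that the program never
  deletes a hub and never relies on a hub being exempt.\<close>

definition labels :: "'a set \<Rightarrow> 'a set \<Rightarrow> 'a set \<Rightarrow> ('a \<Rightarrow> nat) \<Rightarrow> bool" where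
  "labels A H W L \<longleftrightarrow> (\<forall>v\<in>A. L v = (if v \<in> H then 2 else if v \<in> W then 1 else 0))"

lemma peel:
  assumes "chained lf ss u" "a = peek ss u" "L a \<noteq> 2" "L u = (2::nat)"
  obtains ss' where "ss = a # ss'" "lf a = peek ss' u" "chained lf ss' u"
  using assms by (cases ss) auto

lemma stk_facts:
  assumes "stk E A W H Vis lf Em u pr cu g K log tp ss" "labels A H W L" "finite A"
  shows "winv E A W H Vis K lf Em log u ss pr cu" "tp = peek ss u" "irr (map (\<lambda>v. v \<in> W) ss)"
    "card K \<le> g + length ss" "chained lf ss u" "L u = 2" "finite K" "distinct ss" "set ss \<subseteq> K"
    "\<And>x. x \<in> set ss \<Longrightarrow> L x = (if x \<in> W then 1 else 0)" "u \<in> H" "cu \<in> A"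
    "\<And>x. x \<in> A \<Longrightarrow> L x = 1 \<Longrightarrow> x \<in> W" "\<And>x. x \<in> A \<Longrightarrow> L x = 0 \<Longrightarrow> x \<notin> W"
    "\<And>x. x \<in> set ss \<Longrightarrow> L x = 1 \<Longrightarrow> x \<in> W" "\<And>x. x \<in> set ss \<Longrightarrow> L x = 0 \<Longrightarrow> x \<notin> W"
proof -
  show w: "winv E A W H Vis K lf Em log u ss pr cu" and "tp = peek ss u" "irr (map (\<lambda>v. v \<in> W) ss)"
    "card K \<le> g + length ss" using assms(1) by (auto simp: stk_def)
  note b = kbaseD(1-3)[OF winvD(1)[OF w]]
  show "chained lf ss u" "distinct ss" and u: "u \<in> H" and ss: "set ss \<subseteq> K" and "cu \<in> A" using winvD[OF w] by blast+
  show "finite K" using b assms(3) by (meson Diff_subset finite_subset)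
  show "L u = 2" using assms(2) b u by (auto simp: labels_def)
  show Ls: "L x = (if x \<in> W then 1 else 0)" if "x \<in> set ss" for x
  proof -
    have "x \<in> A - H" using that ss b by blast
    then show ?thesis using assms(2) by (auto simp: labels_def)
  qed
  show "x \<in> W" if "x \<in> set ss" "L x = 1" for x
    using Ls[OF that(1)] that(2) by (cases "x \<in> W") simp_all
  show "x \<notin> W" if "x \<in> set ss" "L x = 0" for x
    using Ls[OF that(1)] that(2) by (cases "x \<in> W") simp_all
  have "L x = (if x \<in> H then 2 else if x \<in> W then 1 else 0)" if "x \<in> A" for x
    using assms(2) that unfolding labels_def by blast
  note L = this
  show "x \<in> W" if "x \<in> A" "L x = 1" for x
    using L[OF that(1)] that(2) by (cases "x \<in> H"; cases "x \<in> W") simp_all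
  show "x \<notin> W" if "x \<in> A" "L x = 0" for x
    using L[OF that(1)] that(2) by (cases "x \<in> H"; cases "x \<in> W") simp_all
qed

lemma card_rem: "finite K \<Longrightarrow> distinct xs \<Longrightarrow> set xs \<subseteq> K \<Longrightarrow> card (K - set xs) = card K - length xs"
  by (simp add: card_Diff_subset distinct_card)

text \<open>The vertices \<open>tp\<close>, \<open>lf tp\<close>, ... read by the program are the entries of the stack as long as the
  tests succeed, because the label \<open>2\<close> of the hub makes them fail at the bottom.\<close>

lemma stk_prepop1:
  assumes s: "stk E A W H Vis lf Em u pr cu g K log a0 ss" and l: "labels A H W L" and fin: "finite A"
    and a: "a1 = lf a0" and L: "L cu = 1" "L a0 = 1" "L a1 = 1"
  shows "\<exists>ss'. stk E A W H Vis lf Em u pr cu g (K - {a0}) log a1 ss' \<and> \<not> bad45 (map (\<lambda>v. v \<in> W) (cu # ss'))"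
proof -
  note f = stk_facts[OF s l fin]
  obtain s1 where s1: "ss = a0 # s1" "lf a0 = peek s1 u" "chained lf s1 u" using peel[OF f(5,2), of L] L f(6) by auto
  obtain s2 where s2: "s1 = a1 # s2" using peel[OF s1(3), of a1 L] s1 L f(6) a by auto
  have W: "a0 \<in> W" "a1 \<in> W" "cu \<in> W"
    using f(15)[of a0] f(15)[of a1] f(13)[OF f(12)] s1(1) s2(1) L by simp_all
  have "winv E A W H Vis (K - {a0}) lf Em log u s1 pr cu"
    by (rule winv_pop1_free[OF f(1)[unfolded s1] fin]) (use W s2 in auto)
  moreover have "card (K - set [a0]) = card K - length [a0]"
    using f(7-9) s1(1) by (intro card_rem) auto
  moreover have "irr (map (\<lambda>v. v \<in> W) s1)" using f(3) s1 by simp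
  \<comment> \<open>\<open>cu\<close> replaces the deleted \<open>a0\<close>, and both are in
    \<open>W\<close>; the word is the old irreducible one.\<close>
  moreover have "\<not> bad45 (map (\<lambda>v. v \<in> W) (cu # s1))"
  proof -
    have "map (\<lambda>v. v \<in> W) (cu # s1) = map (\<lambda>v. v \<in> W) ss" using s1 s2 W by simp
    then show ?thesis using f(3) s1 bad45_bad[of "map (\<lambda>v. v \<in> W) ss"] by auto
  qed
  ultimately show ?thesis using f(4) s1 s2 by (intro exI[of _ s1]) (auto simp: stk_def)
qed

lemma stk_prepop2:
  assumes s: "stk E A W H Vis lf Em u pr cu g K log a0 ss" and l: "labels A H W L" and fin: "finite A"
    and a: "a1 = lf a0" "a2 = lf a1" "a3 = lf a2" and L: "L cu = 1" "L a0 = 1" "L a1 = 0" "L a2 = 1" "L a3 = 1"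
  shows "\<exists>ss'. stk E A W H Vis lf Em u pr cu g (K - {a0} - {a1} - {a2}) (log @ [(a3, cu, a1, a1, a1)]) a3 ss' \<and>
    \<not> bad45 (map (\<lambda>v. v \<in> W) (cu # ss'))"
proof -
  note f = stk_facts[OF s l fin]
  obtain s1 where s1: "ss = a0 # s1" "lf a0 = peek s1 u" "chained lf s1 u" using peel[OF f(5,2), of L] L f(6) by auto
  obtain s2 where s2: "s1 = a1 # s2" "lf a1 = peek s2 u" "chained lf s2 u" using peel[OF s1(3), of a1 L] s1 L f(6) a by auto
  obtain s3 where s3: "s2 = a2 # s3" "lf a2 = peek s3 u" "chained lf s3 u" using peel[OF s2(3), of a2 L] s2 L f(6) a by auto
  obtain s4 where s4: "s3 = a3 # s4" using peel[OF s3(3), of a3 L] s3 L f(6) a by auto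
  have ss: "ss = a0 # a1 # a2 # a3 # s4" using s1 s2 s3 s4 by simp
  have W: "a0 \<in> W" "a1 \<notin> W" "a2 \<in> W" "a3 \<in> W" "cu \<in> W"
    using f(15)[of a0] f(16)[of a1] f(15)[of a2] f(15)[of a3] f(13)[OF f(12)] ss L by simp_all
  have K: "K - {a0} - {a1} - {a2} = K - {a0, a1, a2}" by auto
  have "winv E A W H Vis (K - {a0, a1, a2}) lf Em (log @ [(peek (a3 # s4) u, cu, a1, a1, a1)]) u (a3 # s4) pr cu"
    by (rule winv_pop3_free[OF f(1)[unfolded ss] fin]) (use W in auto)
  moreover have "card (K - set [a0, a1, a2]) = card K - length [a0, a1, a2]"
    using f(7-9) ss by (intro card_rem) auto
  moreover have i: "irr (map (\<lambda>v. v \<in> W) (a2 # a3 # s4))" using f(3) ss by simp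
  \<comment> \<open>\<open>cu\<close> now stands on \<open>a3\<close> as \<open>a2\<close> did
    before, with the same label, so the word is a suffix of the old one.\<close>
  moreover have "\<not> bad45 (map (\<lambda>v. v \<in> W) (cu # a3 # s4))"
  proof -
    have "map (\<lambda>v. v \<in> W) (cu # a3 # s4) = map (\<lambda>v. v \<in> W) (a2 # a3 # s4)" using W by simp
    then show ?thesis using i bad45_bad[of "map (\<lambda>v. v \<in> W) (a2 # a3 # s4)"] by auto
  qed
  ultimately show ?thesis unfolding K using f(4) ss by (intro exI[of _ "a3 # s4"]) (auto simp: stk_def)
qed

text \<open>Values read beyond the bottom of the stack are arbitrary, but this direction is safe: on
  an actual stack with a bad word all letters are read correctly, and a test would have
  succeeded.\<close>

lemma stk_prepop_none:
  assumes s: "stk E A W H Vis lf Em u pr cu g K log a0 ss" and l: "labels A H W L" and fin: "finite A"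
    and a: "a1 = lf a0" "a2 = lf a1" "a3 = lf a2" and cu: "cu \<notin> H"
    and L: "\<not> (L cu = 1 \<and> L a0 = 1 \<and> L a1 = 1)"
      "\<not> (L cu = 1 \<and> L a0 = 1 \<and> L a1 = 0 \<and> L a2 = 1 \<and> L a3 = 1)"
  shows "\<not> bad45 (map (\<lambda>v. v \<in> W) (cu # ss))"
proof
  assume b: "bad45 (map (\<lambda>v. v \<in> W) (cu # ss))"
  note f = stk_facts[OF s l fin]
  have c: "L cu = (if cu \<in> W then 1 else 0)" using l f(12) cu by (auto simp: labels_def)
  from b consider x y t where "ss = x # y # t" "cu \<in> W" "x \<in> W" "y \<in> W"
    | x y z w t where "ss = x # y # z # w # t" "cu \<in> W" "x \<in> W" "y \<notin> W" "z \<in> W" "w \<in> W"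
    by (induction "map (\<lambda>v. v \<in> W) (cu # ss)" rule: bad45.induct) (auto simp: Cons_eq_map_conv)
  then show False
  proof cases
    case 1
    then show False using L(1) f(2,5,10) a c by auto
  next
    case 2
    then show False using L(2) f(2,5,10) a c by auto
  qed
qed

text \<open>After a push only the tail is known to be irreducible. That is enough, because the rule
  deletes the top and leaves a suffix of the tail.\<close>

lemma stk_postpop3:
  assumes s: "winv E A W H Vis K lf Em log u ss pr cu" and l: "labels A H W L" and fin: "finite A"
    and ir: "irr (map (\<lambda>v. v \<in> W) (tl ss))" and c: "card K \<le> g + length ss"
    and a: "a0 = peek ss u" "a1 = lf a0" "a2 = lf a1" "a3 = lf a2"
    and L: "L a1 = 0" "L a2 = 0" "L a0 = 0 \<or> L a0 = 1 \<and> L a3 = 1"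
  shows "\<exists>ss'. stk E A W H Vis lf Em u pr cu g (K - {a0} - {a1} - {a2}) (log @ [(a3, cu, a0, a2, a1)]) a3 ss'"
proof -
  note w = winvD[OF s]
  note b = kbaseD(1-3)[OF w(1)]
  have Lu: "L u = 2" using l b w by (auto simp: labels_def)
  have Ls: "L x = (if x \<in> W then 1 else 0)" if "x \<in> set ss" for x
  proof -
    have "x \<in> A - H" using that w(3) b by blast
    then show ?thesis using l by (auto simp: labels_def)
  qed
  have fK: "finite K" using b fin by (meson Diff_subset finite_subset)
  have n: "L a0 \<noteq> 2" "L a1 \<noteq> 2" "L a2 \<noteq> 2" using L by auto
  obtain s1 where s1: "ss = a0 # s1" "lf a0 = peek s1 u" "chained lf s1 u" using peel[OF w(5) a(1) n(1) Lu] by blast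
  obtain s2 where s2: "s1 = a1 # s2" "lf a1 = peek s2 u" "chained lf s2 u" using peel[OF s1(3) trans[OF a(2) s1(2)] n(2) Lu] by blast
  obtain s3 where s3: "s2 = a2 # s3" "lf a2 = peek s3 u" "chained lf s3 u" using peel[OF s2(3) trans[OF a(3) s2(2)] n(3) Lu] by blast
  have ss: "ss = a0 # a1 # a2 # s3" using s1 s2 s3 by simp
  have W: "a1 \<notin> W" "a2 \<notin> W" "a0 \<in> W \<Longrightarrow> a3 \<in> W"
  proof -
    show "a1 \<notin> W" "a2 \<notin> W"
      using Ls[of a1] Ls[of a2] ss L by (cases "a1 \<in> W"; cases "a2 \<in> W"; simp)+
    assume "a0 \<in> W"
    then have "L a3 = 1" using Ls[of a0] ss L by simp
    moreover have "a3 \<in> insert u (set ss)" using a s3 ss peek_in[of s3 u] by auto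
    ultimately show "a3 \<in> W" using Ls[of a3] Lu by (cases "a3 = u"; cases "a3 \<in> W") simp_all
  qed
  have K: "K - {a0} - {a1} - {a2} = K - {a0, a1, a2}" by auto
  have p: "peek s3 u = a3" using s3 a by simp
  have "winv E A W H Vis (K - {a0, a1, a2}) lf Em (log @ [(peek s3 u, cu, a0, a2, a1)]) u s3 pr cu"
    by (rule winv_pop3[OF s[unfolded ss] fin]) (use W p in auto)
  moreover have "card (K - set [a0, a1, a2]) = card K - length [a0, a1, a2]"
    using w(3,4) fK ss by (intro card_rem) auto
  moreover have "irr (map (\<lambda>v. v \<in> W) s3)" using ir ss by simp
  ultimately show ?thesis unfolding K using c ss p by (intro exI[of _ s3]) (auto simp: stk_def)
qed

lemma stk_postpop4:
  assumes s: "winv E A W H Vis K lf Em log u ss pr cu" and l: "labels A H W L" and fin: "finite A"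
    and ir: "irr (map (\<lambda>v. v \<in> W) (tl ss))" and c: "card K \<le> g + length ss"
    and a: "a0 = peek ss u" "a1 = lf a0" "a2 = lf a1" "a3 = lf a2" "a4 = lf a3"
    and L: "L a0 = 1" "L a1 = 0" "L a2 = 1" "L a3 = 0" "L a4 = 1"
  shows "\<exists>ss'. stk E A W H Vis lf Em u pr cu g (K - {a0} - {a1} - {a2} - {a3}) (log @ [(a4, cu, a0, a2, a2)]) a4 ss'"
proof -
  note w = winvD[OF s]
  note b = kbaseD(1-3)[OF w(1)]
  have Lu: "L u = 2" using l b w by (auto simp: labels_def)
  have Ls: "L x = (if x \<in> W then 1 else 0)" if "x \<in> set ss" for x
  proof -
    have "x \<in> A - H" using that w(3) b by blast
    then show ?thesis using l by (auto simp: labels_def)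
  qed
  have fK: "finite K" using b fin by (meson Diff_subset finite_subset)
  have n: "L a0 \<noteq> 2" "L a1 \<noteq> 2" "L a2 \<noteq> 2" "L a3 \<noteq> 2" "L a4 \<noteq> 2" using L by auto
  obtain s1 where s1: "ss = a0 # s1" "lf a0 = peek s1 u" "chained lf s1 u" using peel[OF w(5) a(1) n(1) Lu] by blast
  obtain s2 where s2: "s1 = a1 # s2" "lf a1 = peek s2 u" "chained lf s2 u" using peel[OF s1(3) trans[OF a(2) s1(2)] n(2) Lu] by blast
  obtain s3 where s3: "s2 = a2 # s3" "lf a2 = peek s3 u" "chained lf s3 u" using peel[OF s2(3) trans[OF a(3) s2(2)] n(3) Lu] by blast
  obtain s4 where s4: "s3 = a3 # s4" "lf a3 = peek s4 u" "chained lf s4 u" using peel[OF s3(3) trans[OF a(4) s3(2)] n(4) Lu] by blast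
  obtain s5 where s5: "s4 = a4 # s5" using peel[OF s4(3) trans[OF a(5) s4(2)] n(5) Lu] by blast
  have ss: "ss = a0 # a1 # a2 # a3 # s4" using s1 s2 s3 s4 by simp
  have W: "a0 \<in> W" "a1 \<notin> W" "a2 \<in> W" "a3 \<notin> W" "a4 \<in> W"
  proof -
    have *: "x \<in> W \<longleftrightarrow> L x = 1" if "x \<in> set ss" for x
      using Ls[OF that] by (cases "x \<in> W") simp_all
    show "a0 \<in> W" "a1 \<notin> W" "a2 \<in> W" "a3 \<notin> W" "a4 \<in> W"
      using *[of a0] *[of a1] *[of a2] *[of a3] *[of a4] ss s5 L by simp_all
  qed
  have K: "K - {a0} - {a1} - {a2} - {a3} = K - {a0, a1, a2, a3}" by auto
  have p: "peek s4 u = a4" using s4 a by simp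
  have "winv E A W H Vis (K - {a0, a1, a2, a3}) lf Em (log @ [(peek s4 u, cu, a0, a2, a2)]) u s4 pr cu"
    by (rule winv_pop4[OF s[unfolded ss] fin]) (use W p in auto)
  moreover have "card (K - set [a0, a1, a2, a3]) = card K - length [a0, a1, a2, a3]"
    using w(3,4) fK ss by (intro card_rem) auto
  moreover have "irr (map (\<lambda>v. v \<in> W) s4)" using ir ss by simp
  ultimately show ?thesis unfolding K using c ss p by (intro exI[of _ s4]) (auto simp: stk_def)
qed

lemma stk_postpop_none:
  assumes s: "winv E A W H Vis K lf Em log u ss pr cu" and l: "labels A H W L"
    and b45: "\<not> bad45 (map (\<lambda>v. v \<in> W) ss)"
    and a: "a0 = peek ss u" "a1 = lf a0" "a2 = lf a1" "a3 = lf a2" "a4 = lf a3"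
    and L: "\<not> (L a1 = 0 \<and> L a2 = 0 \<and> (L a0 = 0 \<or> L a0 = 1 \<and> L a3 = 1))"
      "\<not> (L a0 = 1 \<and> L a1 = 0 \<and> L a2 = 1 \<and> L a3 = 0 \<and> L a4 = 1)"
  shows "\<not> bad (map (\<lambda>v. v \<in> W) ss)"
proof
  assume bd: "bad (map (\<lambda>v. v \<in> W) ss)"
  note w = winvD[OF s]
  note b = kbaseD(1-3)[OF w(1)]
  have Ls: "L x = (if x \<in> W then 1 else 0)" if "x \<in> set ss" for x
  proof -
    have "x \<in> A - H" using that w(3) b by blast
    then show ?thesis using l by (auto simp: labels_def)
  qed
  from bd b45 consider x y z t where "ss = x # y # z # t" "x \<notin> W" "y \<notin> W" "z \<notin> W"
    | x y z v t where "ss = x # y # z # v # t" "x \<in> W" "y \<notin> W" "z \<notin> W" "v \<in> W"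
    | x y z v r t where "ss = x # y # z # v # r # t" "x \<in> W" "y \<notin> W" "z \<in> W" "v \<notin> W" "r \<in> W"
    by (induction "map (\<lambda>v. v \<in> W) ss" rule: bad.induct) (auto simp: Cons_eq_map_conv map_eq_Cons_conv)
  then show False
    by cases (use L w(5) Ls a in auto)
qed

section \<open>Walking along paths\<close>

definition Log :: "string \<Rightarrow> string \<Rightarrow> string \<Rightarrow> string \<Rightarrow> prog" where
  "Log p a b c = seqs
    [Store ''lp'' (Reg ''ln'') (Reg p), Store ''lz'' (Reg ''ln'') (Reg ''cu''),
     Store ''la'' (Reg ''ln'') (Reg a), Store ''lB'' (Reg ''ln'') (Reg b),
     Store ''lc'' (Reg ''ln'') (Reg c), Assign ''ln'' (Inc (Reg ''ln''))]"

definition Lab :: "string \<Rightarrow> nat \<Rightarrow> test" where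
  "Lab r l = EqT (Arr ''lb'' (Reg r)) (Const l)"

lemma eval_Lab [simp]: "eval_test (Lab r l) s \<longleftrightarrow> arrs s ''lb'' (regs s r) = l"
  by (simp add: Lab_def)

definition Del :: "string \<Rightarrow> prog" where
  "Del r = Store ''kf'' (Reg r) (Const 0)"

text \<open>The scan covers the neighbours in the input graph, dead ones included; in the core,
  \<open>cu\<close> has exactly one neighbour besides \<open>pr\<close>.\<close>

definition FindNext :: prog where
  "FindNext = ForNb ''jj'' ''z'' ''cu'' (Cond (Conj (EqT (Arr ''x'' (Reg ''z'')) (Const 0))
     (Neg (EqT (Reg ''z'') (Reg ''pr'')))) (Assign ''nz'' (Reg ''z'')) Skip)"

definition PrePop :: prog where
  "PrePop = seqs
    [Assign ''a0'' (Reg ''tp''), Assign ''a1'' (Arr ''lf'' (Reg ''a0'')),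
     Assign ''a2'' (Arr ''lf'' (Reg ''a1'')), Assign ''a3'' (Arr ''lf'' (Reg ''a2'')),
     Cond (Conj (Lab ''cu'' 1) (Conj (Lab ''a0'' 1) (Lab ''a1'' 1)))
       (seqs [Del ''a0'', Assign ''tp'' (Reg ''a1'')])
       (Cond (Conj (Lab ''cu'' 1) (Conj (Lab ''a0'' 1) (Conj (Lab ''a1'' 0) (Conj (Lab ''a2'' 1) (Lab ''a3'' 1)))))
         (seqs [Del ''a0'', Del ''a1'', Del ''a2'', Log ''a3'' ''a1'' ''a1'' ''a1'', Assign ''tp'' (Reg ''a3'')])
         Skip)]"

definition Push :: prog where
  "Push = seqs
    [Store ''vis'' (Reg ''cu'') (Const 1), Store ''lf'' (Reg ''cu'') (Reg ''tp''),
     Store ''kf'' (Reg ''cu'') (Const 1), Assign ''tp'' (Reg ''cu''), Assign ''pr'' (Reg ''cu''),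
     Assign ''cu'' (Reg ''nz'')]"

definition PostPop :: prog where
  "PostPop = seqs
    [Assign ''a0'' (Reg ''tp''), Assign ''a1'' (Arr ''lf'' (Reg ''a0'')),
     Assign ''a2'' (Arr ''lf'' (Reg ''a1'')), Assign ''a3'' (Arr ''lf'' (Reg ''a2'')),
     Assign ''a4'' (Arr ''lf'' (Reg ''a3'')),
     Cond (Conj (Lab ''a1'' 0) (Conj (Lab ''a2'' 0)
         (Neg (Conj (Neg (Lab ''a0'' 0)) (Neg (Conj (Lab ''a0'' 1) (Lab ''a3'' 1)))))))
       (seqs [Del ''a0'', Del ''a1'', Del ''a2'', Log ''a3'' ''a0'' ''a2'' ''a1'', Assign ''tp'' (Reg ''a3'')])
       (Cond (Conj (Lab ''a0'' 1) (Conj (Lab ''a1'' 0) (Conj (Lab ''a2'' 1) (Conj (Lab ''a3'' 0) (Lab ''a4'' 1)))))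
         (seqs [Del ''a0'', Del ''a1'', Del ''a2'', Del ''a3'', Log ''a4'' ''a0'' ''a2'' ''a2'',
                Assign ''tp'' (Reg ''a4'')])
         Skip)]"

definition WalkB :: prog where
  "WalkB = seqs [FindNext, PrePop, Push, PostPop]"

text \<open>At the end \<open>tp = cu\<close> means that the path has returned to its own hub and
  nothing of it is kept; an edge would be a loop and is suppressed.\<close>

definition Walk :: prog where
  "Walk = seqs
    [Assign ''pr'' (Reg ''u''), Assign ''cu'' (Reg ''y''), Assign ''tp'' (Reg ''u''),
     While (Less (Arr ''lb'' (Reg ''cu'')) (Const 2)) WalkB,
     Cond (EqT (Reg ''tp'') (Reg ''cu'')) Skip (seqs
       [Store ''E1'' (Reg ''E'') (Reg ''tp''), Store ''E2'' (Reg ''E'') (Reg ''cu''),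
        Assign ''E'' (Inc (Reg ''E''))])]"

lemma lgs_cong:
  assumes "\<And>a. a \<in> {''lp'', ''lz'', ''la'', ''lB'', ''lc''} \<Longrightarrow> arrs s' a = arrs s a" "regs s' ''ln'' = regs s ''ln''"
  shows "lgs s' = lgs s"
  using assms by (simp add: lgs_def)

section \<open>Reading one path\<close>

text \<open>The core with the hubs of one stage. The hub set grows during the second pass, where the
  locale is interpreted anew for each hub set.\<close>

locale core = graph_input +
  fixes A W H :: "nat set" and L :: "nat \<Rightarrow> nat"
  assumes AV: "A \<subseteq> {0..<n}" and HA: "H \<subseteq> A" and lab: "labels A H W L"
    and deg2: "\<And>v. v \<in> A \<Longrightarrow> v \<notin> H \<Longrightarrow> card (N v \<inter> A) = 2"
begin

lemma finA: "finite A"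
  using AV finite_subset by blast

lemma L2: "v \<in> A \<Longrightarrow> L v < 2 \<longleftrightarrow> v \<notin> H"
  using lab by (auto simp: labels_def)

definition wok :: "store \<Rightarrow> bool" where
  "wok s \<longleftrightarrow> adj_ok s \<and> alive s = A \<and> arrs s ''lb'' = L"

definition sstk :: "nat set set \<Rightarrow> nat \<Rightarrow> nat \<Rightarrow> store \<Rightarrow> nat list \<Rightarrow> bool" where
  "sstk Em u g s ss \<longleftrightarrow> stk E A W H (nz (arrs s ''vis'')) (arrs s ''lf'') Em u (regs s ''pr'') (regs s ''cu'') g
     (nz (arrs s ''kf'')) (lgs s) (regs s ''tp'') ss"

lemma wok_cong:
  assumes "wok s" "\<And>a. a \<in> {''to'', ''nx'', ''hd'', ''src'', ''dst'', ''x'', ''lb''} \<Longrightarrow> arrs s' a = arrs s a"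
    "\<And>x. x \<in> {''n'', ''m''} \<Longrightarrow> regs s' x = regs s x"
  shows "wok s'"
proof -
  have "adj_ok s'" by (rule adj_ok_cong[of s]) (use assms in \<open>auto simp: wok_def\<close>)
  moreover have "alive s' = alive s" by (rule alive_cong) (use assms in auto)
  ultimately show ?thesis using assms by (simp add: wok_def)
qed

lemma next_nb:
  assumes "winv E A W H Vis K lf Em log u ss pr cu" "cu \<notin> H"
  obtains t where "N cu \<inter> A = {pr, t}" "t \<noteq> pr"
proof -
  note w = winvD[OF assms(1)] and b = kbaseD(1-3)[OF winvD(1)[OF assms(1)]]
  have cu: "cu \<in> A" using w by blast
  have "pr \<in> A" using w(10,2) b by blast
  then have pr: "pr \<in> N cu \<inter> A" using w(9) nbh_sym by fastforce
  obtain a c where ac: "N cu \<inter> A = {a, c}" "a \<noteq> c" using deg2[OF cu assms(2)] by (metis card_2_iff)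
  with pr have "pr = a \<or> pr = c" by auto
  with ac show ?thesis using that[of a] that[of c] by auto
qed

lemma wp_FindNext:
  assumes ok: "wok s" and st: "sstk Em u g s ss" and cu: "regs s ''cu'' \<notin> H"
    and k: "5 * length (nb (regs s ''cu'')) + 2 \<le> k"
    and Q: "\<And>k' s'. k \<le> k' + (5 * length (nb (regs s ''cu'')) + 2) \<Longrightarrow> wok s' \<Longrightarrow> sstk Em u g s' ss \<Longrightarrow>
      regs s' ''cu'' = regs s ''cu'' \<Longrightarrow> arrs s' ''vis'' = arrs s ''vis'' \<Longrightarrow>
      N (regs s' ''cu'') \<inter> A = {regs s' ''pr'', regs s' ''nz''} \<Longrightarrow> regs s' ''nz'' \<noteq> regs s' ''pr'' \<Longrightarrow> Q k' s'"
  shows "wp FindNext Q k s"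
proof -
  define cu' pr x where "cu' = regs s ''cu''" and "pr = regs s ''pr''" and "x = arrs s ''x''"
  have w: "winv E A W H (nz (arrs s ''vis'')) (nz (arrs s ''kf'')) (arrs s ''lf'') Em (lgs s) u ss pr cu'"
    using st by (simp add: sstk_def stk_def cu'_def pr_def)
  obtain t where t: "N cu' \<inter> A = {pr, t}" "t \<noteq> pr" using next_nb[OF w] cu cu'_def by blast
  let ?I = "\<lambda>zs k' s'. k \<le> k' + 5 * (length (nb cu') - length zs) + 1 \<and> length zs \<le> length (nb cu') \<and> set zs \<subseteq> N cu' \<and>
    arrs s' ''x'' = x \<and> regs s' ''pr'' = pr \<and> (t \<notin> set zs \<longrightarrow> regs s' ''nz'' = t)"
  have al: "z \<in> A \<longleftrightarrow> x z = 0" if "z \<in> N cu'" for z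
  proof -
    have "A = alive s" using ok by (simp add: wok_def)
    then show ?thesis using N_lt[OF that] by (simp add: alive_def x_def)
  qed
  have "wp FindNext (\<lambda>k' s'. k \<le> k' + (5 * length (nb cu') + 2) \<and> regs s' ''nz'' = t) k s"
    unfolding FindNext_def
  proof (rule wp_ForNb[where I = ?I and ys = "nb cu'"])
    show "adj s (regs s ''cu'') (nb cu')" using ok by (simp add: wok_def adj_ok_def cu'_def)
    have "t \<in> N cu'" using t by blast
    then show "?I (nb cu') (k - 1) s" by (simp add: pr_def x_def)
  next
    fix k' s' assume "?I [] k' s'"
    then show "1 \<le> k' \<and> k \<le> k' - 1 + (5 * length (nb cu') + 2) \<and> regs s' ''nz'' = t" using k cu'_def by auto
  next
    fix z zs k' s' assume I: "?I (z # zs) k' s'" and z: "regs s' ''z'' = z"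
    have "6 \<le> k'" using I k cu'_def by auto
    then obtain r where r: "k' = 6 + r" using le_Suc_ex by blast
    have kk: "k \<le> r + 5 * (length (nb cu') - length zs) + 2" "length zs \<le> length (nb cu')" using I r by auto
    have zN: "z \<in> N cu'" using I by simp
    have "z \<in> N cu' \<inter> A \<and> z \<noteq> pr \<longleftrightarrow> z = t" unfolding t(1) using t(2) by blast
    then have zt: "(x z = 0 \<and> z \<noteq> pr) = (z = t)" unfolding Int_iff al[OF zN] using zN by simp
    show "3 \<le> k' \<and> wp (Cond (Conj (EqT (Arr ''x'' (Reg ''z'')) (Const 0))
     (Neg (EqT (Reg ''z'') (Reg ''pr'')))) (Assign ''nz'' (Reg ''z'')) Skip) (?I zs) (k' - 3) s'"
    proof (cases "z = t")
      case True
      then show ?thesis using I z zt r kk by simp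
    next
      case False
      then consider "x z \<noteq> 0" | "z = pr" using zt by (cases "z = pr") simp_all
      then show ?thesis by cases (use I z r kk False in simp_all)
    qed
  qed (use k in auto)
  then show ?thesis
  proof (rule wp_frame, goal_cases)
    case (1 k' s')
    have f: "regs s' v = regs s v" if "v \<notin> {''jj'', ''z'', ''nz''}" for v
      using 1(2)[of v] that by (auto simp: FindNext_def ForNb_def)
    have g: "arrs s' a = arrs s a" for a using 1(3)[of a] by (auto simp: FindNext_def ForNb_def)
    have v: "regs s' ''cu'' = cu'" "regs s' ''pr'' = pr" "regs s' ''nz'' = t" "arrs s' ''vis'' = arrs s ''vis''"
      using 1(1) f g by (simp_all add: cu'_def pr_def)
    show ?case
    proof (rule Q)
      show "k \<le> k' + (5 * length (nb (regs s ''cu'')) + 2)" using 1(1) by (simp add: cu'_def)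
      show "N (regs s' ''cu'') \<inter> A = {regs s' ''pr'', regs s' ''nz''}" unfolding v by (rule t(1))
      show "regs s' ''nz'' \<noteq> regs s' ''pr''" unfolding v by (rule t(2))
      show "regs s' ''cu'' = regs s ''cu''" using v(1) by (simp add: cu'_def)
      show "arrs s' ''vis'' = arrs s ''vis''" by (rule v(4))
      show "wok s'" by (rule wok_cong[OF ok]) (auto simp: f g)
      have "lgs s' = lgs s" by (rule lgs_cong) (simp_all add: f g)
      then show "sstk Em u g s' ss" using st by (simp add: sstk_def f g)
    qed
  qed
qed

lemma wp_PrePop:
  assumes ok: "wok s" and st: "sstk Em u g s ss" and cu: "regs s ''cu'' \<notin> H" and k: "17 \<le> k"
    and Q: "\<And>k' s' ss'. k \<le> k' + 17 \<Longrightarrow> wok s' \<Longrightarrow> sstk Em u g s' ss' \<Longrightarrow>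
      \<not> bad45 (map (\<lambda>v. v \<in> W) (regs s' ''cu'' # ss')) \<Longrightarrow> regs s' ''cu'' = regs s ''cu'' \<Longrightarrow>
      regs s' ''pr'' = regs s ''pr'' \<Longrightarrow> regs s' ''nz'' = regs s ''nz'' \<Longrightarrow>
      arrs s' ''vis'' = arrs s ''vis'' \<Longrightarrow> Q k' s'"
  shows "wp PrePop Q k s"
proof -
  obtain r where r: "k = 17 + r" using k le_Suc_ex by blast
  define a0 where "a0 = regs s ''tp''"
  define a1 where "a1 = arrs s ''lf'' a0"
  define a2 where "a2 = arrs s ''lf'' a1"
  define a3 where "a3 = arrs s ''lf'' a2"
  define c where "c = regs s ''cu''"
  have Ls: "arrs s ''lb'' = L" using ok by (simp add: wok_def)
  note st' = st[unfolded sstk_def, folded a0_def c_def]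
  let ?s = "setr ''a3'' a3 (setr ''a2'' a2 (setr ''a1'' a1 (setr ''a0'' a0 s)))"
  show ?thesis
  proof (cases "L c = 1 \<and> L a0 = 1 \<and> L a1 = 1")
    case True
    then have T: "L c = 1" "L a0 = 1" "L a1 = 1" by simp_all
    let ?t = "setr ''tp'' a1 (seta ''kf'' a0 0 ?s)"
    obtain ss' where ss': "stk E A W H (nz (arrs s ''vis'')) (arrs s ''lf'') Em u (regs s ''pr'') c g
       (nz (arrs s ''kf'') - {a0}) (lgs s) a1 ss'" "\<not> bad45 (map (\<lambda>v. v \<in> W) (c # ss'))"
      using stk_prepop1[OF st' lab finA a1_def T] by blast
    have "Q (10 + r) ?t"
    proof (rule Q)
      have "lgs ?t = lgs s" by (rule lgs_cong) auto
      then show "sstk Em u g ?t ss'" using ss' by (simp add: sstk_def c_def)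
    qed (use ss' r in \<open>auto simp: c_def intro!: wok_cong[OF ok]\<close>)
    then show ?thesis using True r Ls unfolding PrePop_def Del_def
      by (simp add: a0_def[symmetric] a1_def[symmetric] a2_def[symmetric] a3_def[symmetric] c_def[symmetric])
  next
    case F1: False
    show ?thesis
    proof (cases "L c = 1 \<and> L a0 = 1 \<and> L a1 = 0 \<and> L a2 = 1 \<and> L a3 = 1")
      case True
      then have T: "L c = 1" "L a0 = 1" "L a1 = 0" "L a2 = 1" "L a3 = 1" by simp_all
      obtain ss' where ss': "stk E A W H (nz (arrs s ''vis'')) (arrs s ''lf'') Em u (regs s ''pr'') c g
         (nz (arrs s ''kf'') - {a0} - {a1} - {a2}) (lgs s @ [(a3, c, a1, a1, a1)]) a3 ss'"
         "\<not> bad45 (map (\<lambda>v. v \<in> W) (c # ss'))"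
        using stk_prepop2[OF st' lab finA a1_def a2_def a3_def T] by blast
      show ?thesis unfolding PrePop_def Del_def Log_def
        apply (simp add: a0_def[symmetric] a1_def[symmetric] a2_def[symmetric] a3_def[symmetric] c_def[symmetric] r Ls True)
        apply (rule Q[of _ _ ss'])
        using ss' r by (auto simp: sstk_def lgs_def c_def intro!: wok_cong[OF ok])
    next
      case F2: False
      have nb: "\<not> bad45 (map (\<lambda>v. v \<in> W) (c # ss))"
        by (rule stk_prepop_none[OF st' lab finA a1_def a2_def a3_def _ F1 F2]) (use cu in \<open>simp add: c_def\<close>)
      have "Q (10 + r) ?s"
      proof (rule Q)
        have "lgs ?s = lgs s" by (rule lgs_cong) auto
        then show "sstk Em u g ?s ss" using st by (simp add: sstk_def c_def)
      qed (use nb r in \<open>auto simp: c_def intro!: wok_cong[OF ok]\<close>)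
      then show ?thesis using F1 F2 r Ls unfolding PrePop_def
        by (auto simp: a0_def[symmetric] a1_def[symmetric] a2_def[symmetric] a3_def[symmetric] c_def[symmetric])
    qed
  qed
qed


lemma wp_Push:
  assumes ok: "wok s" and st: "sstk Em u g s ss" and b45: "\<not> bad45 (map (\<lambda>v. v \<in> W) (regs s ''cu'' # ss))"
    and cu: "regs s ''cu'' \<notin> H" and nx: "N (regs s ''cu'') \<inter> A = {regs s ''pr'', regs s ''nz''}" "regs s ''nz'' \<noteq> regs s ''pr''"
    and k: "6 \<le> k"
    and Q: "\<And>s'. wok s' \<Longrightarrow> regs s' ''tp'' = regs s ''cu'' \<Longrightarrow>
      nz (arrs s' ''vis'') = insert (regs s ''cu'') (nz (arrs s ''vis'')) \<Longrightarrow>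
      winv E A W H (nz (arrs s' ''vis'')) (nz (arrs s' ''kf'')) (arrs s' ''lf'') Em (lgs s') u
        (regs s ''cu'' # ss) (regs s' ''pr'') (regs s' ''cu'') \<Longrightarrow>
      card (nz (arrs s' ''kf'')) \<le> g + length (regs s ''cu'' # ss) \<Longrightarrow>
      irr (map (\<lambda>v. v \<in> W) ss) \<Longrightarrow> Q (k - 6) s'"
  shows "wp Push Q k s"
proof -
  obtain r where r: "k = 6 + r" using k le_Suc_ex by blast
  define c where "c = regs s ''cu''"
  note st' = st[unfolded sstk_def]
  note f = stk_facts[OF st' lab finA]
  let ?s = "setr ''cu'' (regs s ''nz'') (setr ''pr'' c (setr ''tp'' c (seta ''kf'' c 1
    (seta ''lf'' c (regs s ''tp'') (seta ''vis'' c 1 s)))))"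
  have w: "winv E A W H (insert c (nz (arrs s ''vis''))) (insert c (nz (arrs s ''kf'')))
      ((arrs s ''lf'')(c := regs s ''tp'')) Em (lgs s) u (c # ss) c (regs s ''nz'')"
    using winv_push[OF sg f(1) cu nx] f(2) by (simp add: c_def)
  have "card (insert c (nz (arrs s ''kf''))) \<le> g + length (c # ss)"
    using f(4) card_insert_le_m1 f(7) by (simp add: card_insert_if)
  moreover have "lgs ?s = lgs s" by (rule lgs_cong) auto
  moreover have "wok ?s" by (rule wok_cong[OF ok]) auto
  ultimately have "Q (k - 6) ?s" using w f(3) by (intro Q) (auto simp: c_def[symmetric])
  then show ?thesis using r by (simp add: Push_def c_def)
qed

lemma wp_PostPop:
  assumes ok: "wok s" and w: "winv E A W H (nz (arrs s ''vis'')) (nz (arrs s ''kf'')) (arrs s ''lf'') Em (lgs s) u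
        ss (regs s ''pr'') (regs s ''cu'')"
    and tp: "regs s ''tp'' = peek ss u" and cd: "card (nz (arrs s ''kf'')) \<le> g + length ss"
    and ir: "irr (map (\<lambda>v. v \<in> W) (tl ss))" "ss \<noteq> []" and b45: "\<not> bad45 (map (\<lambda>v. v \<in> W) ss)"
    and k: "18 \<le> k"
    and Q: "\<And>k' s' ss'. k \<le> k' + 18 \<Longrightarrow> wok s' \<Longrightarrow> sstk Em u g s' ss' \<Longrightarrow>
      arrs s' ''vis'' = arrs s ''vis'' \<Longrightarrow> Q k' s'"
  shows "wp PostPop Q k s"
proof -
  obtain r where r: "k = 18 + r" using k le_Suc_ex by blast
  define a0 where "a0 = regs s ''tp''"
  define a1 where "a1 = arrs s ''lf'' a0"
  define a2 where "a2 = arrs s ''lf'' a1"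
  define a3 where "a3 = arrs s ''lf'' a2"
  define a4 where "a4 = arrs s ''lf'' a3"
  have Ls: "arrs s ''lb'' = L" using ok by (simp add: wok_def)
  note t = tp[folded a0_def]
  note defs = a0_def[symmetric] a1_def[symmetric] a2_def[symmetric] a3_def[symmetric] a4_def[symmetric]
  show ?thesis
  proof (cases "L a1 = 0 \<and> L a2 = 0 \<and> (L a0 = 0 \<or> L a0 = 1 \<and> L a3 = 1)")
    case True
    then have T: "L a1 = 0" "L a2 = 0" "L a0 = 0 \<or> L a0 = 1 \<and> L a3 = 1" by simp_all
    obtain ss' where ss': "stk E A W H (nz (arrs s ''vis'')) (arrs s ''lf'') Em u (regs s ''pr'') (regs s ''cu'') g
       (nz (arrs s ''kf'') - {a0} - {a1} - {a2}) (lgs s @ [(a3, regs s ''cu'', a0, a2, a1)]) a3 ss'"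
      using stk_postpop3[OF w lab finA ir(1) cd t a1_def a2_def a3_def T] by blast
    from T(3) show ?thesis
    proof
      assume "L a0 = 0"
      then show ?thesis unfolding PostPop_def Del_def Log_def
        apply (simp add: defs r Ls T(1,2))
        apply (rule Q[of _ _ ss'])
        using ss' r by (auto simp: sstk_def lgs_def intro!: wok_cong[OF ok])
    next
      assume "L a0 = 1 \<and> L a3 = 1"
      then show ?thesis unfolding PostPop_def Del_def Log_def
        apply (simp add: defs r Ls T(1,2))
        apply (rule Q[of _ _ ss'])
        using ss' r by (auto simp: sstk_def lgs_def intro!: wok_cong[OF ok])
    qed
  next
    case F1: False
    show ?thesis
    proof (cases "L a0 = 1 \<and> L a1 = 0 \<and> L a2 = 1 \<and> L a3 = 0 \<and> L a4 = 1")
      case True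
      then have T: "L a0 = 1" "L a1 = 0" "L a2 = 1" "L a3 = 0" "L a4 = 1" by simp_all
      obtain ss' where ss': "stk E A W H (nz (arrs s ''vis'')) (arrs s ''lf'') Em u (regs s ''pr'') (regs s ''cu'') g
         (nz (arrs s ''kf'') - {a0} - {a1} - {a2} - {a3}) (lgs s @ [(a4, regs s ''cu'', a0, a2, a2)]) a4 ss'"
        using stk_postpop4[OF w lab finA ir(1) cd t a1_def a2_def a3_def a4_def T] by blast
      show ?thesis unfolding PostPop_def Del_def Log_def
        apply (simp add: defs r Ls T)
        apply (rule Q[of _ _ ss'])
        using ss' r by (auto simp: sstk_def lgs_def intro!: wok_cong[OF ok])
    next
      case F2: False
      have nb: "\<not> bad (map (\<lambda>v. v \<in> W) ss)"
        by (rule stk_postpop_none[OF w lab b45 t a1_def a2_def a3_def a4_def F1 F2])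
      let ?s = "setr ''a4'' a4 (setr ''a3'' a3 (setr ''a2'' a2 (setr ''a1'' a1 (setr ''a0'' a0 s))))"
      have "irr (map (\<lambda>v. v \<in> W) ss)" using nb ir by (cases ss) auto
      moreover have "lgs ?s = lgs s" by (rule lgs_cong) auto
      ultimately have "sstk Em u g ?s ss" using w tp cd by (simp add: sstk_def stk_def)
      moreover have "wok ?s" by (rule wok_cong[OF ok]) auto
      ultimately have "Q (10 + r) ?s" using r by (intro Q) auto
      then show ?thesis using F1 F2 r Ls unfolding PostPop_def by (auto simp: defs)
    qed
  qed
qed

end

section \<open>All paths that leave a hub\<close>

lemma wp_Seq_fun: "wp (Seq p q) Q = wp p (wp q Q)"
  by (intro ext) simp

definition ProcHub :: prog where
  "ProcHub = ForNb ''j'' ''y'' ''u'' (Cond (Conj (EqT (Arr ''x'' (Reg ''y'')) (Const 0))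
     (Conj (Less (Arr ''lb'' (Reg ''y'')) (Const 2)) (EqT (Arr ''vis'' (Reg ''y'')) (Const 0)))) Walk Skip)"

lemma out_edges_snoc:
  assumes "arrs s' ''E1'' = (arrs s ''E1'')(regs s ''E'' := a)" "arrs s' ''E2'' = (arrs s ''E2'')(regs s ''E'' := b)"
    "regs s' ''E'' = Suc (regs s ''E'')"
  shows "out_edges s' = insert {a, b} (out_edges s)"
  using assms by (auto simp: out_edges_def lessThan_Suc)

lemma out_edges_cong:
  assumes "arrs s' ''E1'' = arrs s ''E1''" "arrs s' ''E2'' = arrs s ''E2''" "regs s' ''E'' = regs s ''E''"
  shows "out_edges s' = out_edges s"
  using assms by (simp add: out_edges_def)

context core begin

text \<open>Credit of the unvisited vertices: 50 steps for the stack operations and 10 per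
  neighbour, more than the 5 that \<open>FindNext\<close> takes for each.\<close>

definition pw :: "nat set \<Rightarrow> nat" where
  "pw Vis = (\<Sum>v\<in>A - Vis. 50 + 10 * length (nb v))"

lemma pw_insert: "v \<in> A - Vis \<Longrightarrow> pw Vis = 50 + 10 * length (nb v) + pw (insert v Vis)"
proof -
  assume v: "v \<in> A - Vis"
  have "A - Vis - {v} = A - insert v Vis" by auto
  then show ?thesis unfolding pw_def using sum.remove[OF _ v] finA by simp
qed

definition kst :: "store \<Rightarrow> bool" where
  "kst s \<longleftrightarrow> kinv E A W H (nz (arrs s ''vis'')) (nz (arrs s ''kf'')) (arrs s ''lf'') (out_edges s) (lgs s)"

text \<open>\<open>w\<close> counts walks: each leaves at most 10 kept vertices, by
  \<open>irr_length\<close>, and at most one closing edge.\<close>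

definition kcnt :: "store \<Rightarrow> nat \<Rightarrow> bool" where
  "kcnt s w \<longleftrightarrow> card (nz (arrs s ''kf'')) \<le> 10 * w \<and> regs s ''E'' \<le> w"

lemma wp_WalkB:
  assumes ok: "wok s" and st: "sstk Em u g s ss" and cu: "regs s ''cu'' \<notin> H"
    and k: "pw (nz (arrs s ''vis'')) + c \<le> k"
  shows "wp WalkB (\<lambda>k' s'. wok s' \<and> (\<exists>ss'. sstk Em u g s' ss') \<and>
     nz (arrs s' ''vis'') = insert (regs s ''cu'') (nz (arrs s ''vis'')) \<and> pw (nz (arrs s' ''vis'')) + c \<le> k') (k - 1) s"
proof -
  define c0 where "c0 = regs s ''cu''"
  let ?Vis = "nz (arrs s ''vis'')"
  note f = stk_facts[OF st[unfolded sstk_def] lab finA]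
  have "c0 \<in> A - ?Vis" using winvD(8)[OF f(1)] by (simp add: c0_def)
  then have p: "pw ?Vis = 50 + 10 * length (nb c0) + pw (insert c0 ?Vis)" by (rule pw_insert)
  let ?P = "\<lambda>k' s'. wok s' \<and> (\<exists>ss'. sstk Em u g s' ss') \<and>
     nz (arrs s' ''vis'') = insert c0 ?Vis \<and> pw (nz (arrs s' ''vis'')) + c \<le> k'"
  have "wp FindNext (wp PrePop (wp Push (wp PostPop ?P))) (k - 1) s"
  proof (rule wp_FindNext[OF ok st cu])
    show "5 * length (nb (regs s ''cu'')) + 2 \<le> k - 1" using k p by (simp add: c0_def)
    fix k1 s1
    assume k1: "k - 1 \<le> k1 + (5 * length (nb (regs s ''cu'')) + 2)" and 1: "wok s1" "sstk Em u g s1 ss"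
      and c1: "regs s1 ''cu'' = regs s ''cu''" and v1: "arrs s1 ''vis'' = arrs s ''vis''"
      and n1: "N (regs s1 ''cu'') \<inter> A = {regs s1 ''pr'', regs s1 ''nz''}" "regs s1 ''nz'' \<noteq> regs s1 ''pr''"
    \<comment> \<open>The loop test and the overhead of \<open>FindNext\<close> have used 3 of the
      50 steps. The other three programs need 17 + 6 + 18 = 41.\<close>
    have k1': "pw (insert c0 ?Vis) + c + 47 \<le> k1" using k1 k p by (simp add: c0_def)
    have cu1: "regs s1 ''cu'' \<notin> H" using c1 cu by simp
    show "wp PrePop (wp Push (wp PostPop ?P)) k1 s1"
    proof (rule wp_PrePop[OF 1 cu1])
      show "17 \<le> k1" using k1' by simp
      fix k2 s2 ss2
      assume k2: "k1 \<le> k2 + 17" and 2: "wok s2" "sstk Em u g s2 ss2" "\<not> bad45 (map (\<lambda>v. v \<in> W) (regs s2 ''cu'' # ss2))"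
        and c2: "regs s2 ''cu'' = regs s1 ''cu''" "regs s2 ''pr'' = regs s1 ''pr''" "regs s2 ''nz'' = regs s1 ''nz''"
        and v2: "arrs s2 ''vis'' = arrs s1 ''vis''"
      have cu2: "regs s2 ''cu'' \<notin> H" using c2 cu1 by simp
      have n2: "N (regs s2 ''cu'') \<inter> A = {regs s2 ''pr'', regs s2 ''nz''}" "regs s2 ''nz'' \<noteq> regs s2 ''pr''"
        using n1 c2 by simp_all
      show "wp Push (wp PostPop ?P) k2 s2"
      proof (rule wp_Push[OF 2 cu2 n2])
        show "6 \<le> k2" using k1' k2 by simp
        fix s3
        assume 3: "wok s3" "regs s3 ''tp'' = regs s2 ''cu''"
          "nz (arrs s3 ''vis'') = insert (regs s2 ''cu'') (nz (arrs s2 ''vis''))"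
          "winv E A W H (nz (arrs s3 ''vis'')) (nz (arrs s3 ''kf'')) (arrs s3 ''lf'') Em (lgs s3) u
            (regs s2 ''cu'' # ss2) (regs s3 ''pr'') (regs s3 ''cu'')"
          "card (nz (arrs s3 ''kf'')) \<le> g + length (regs s2 ''cu'' # ss2)" "irr (map (\<lambda>v. v \<in> W) ss2)"
        have v3: "nz (arrs s3 ''vis'') = insert c0 ?Vis" using 3(3) c2 c1 v1 v2 by (simp add: c0_def)
        show "wp PostPop ?P (k2 - 6) s3"
        proof (rule wp_PostPop[OF 3(1,4) _ 3(5) _ _ 2(3)])
          fix k4 s4 ss4 assume 4: "k2 - 6 \<le> k4 + 18" "wok s4" "sstk Em u g s4 ss4" "arrs s4 ''vis'' = arrs s3 ''vis''"
          have "pw (insert c0 ?Vis) + c \<le> k4" using 4(1) k1' k2 by simp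
          then show "?P k4 s4" using 4(2-4) v3 by auto
        qed (use 3 k1' k2 in auto)
      qed
    qed
  qed
  then show ?thesis unfolding WalkB_def seqs.simps wp_Seq_fun c0_def .
qed

lemma wp_Walk:
  assumes ok: "wok s" and st: "kst s" and cnt: "kcnt s w"
    and u: "regs s ''u'' \<in> H" and y: "regs s ''y'' \<in> N (regs s ''u'') \<inter> A" "regs s ''y'' \<notin> H" "regs s ''y'' \<notin> nz (arrs s ''vis'')"
    and k: "pw (nz (arrs s ''vis'')) + c + 10 \<le> k"
    and Q: "\<And>k' s'. wok s' \<Longrightarrow> kst s' \<Longrightarrow> kcnt s' (Suc w) \<Longrightarrow>
      insert (regs s ''y'') (nz (arrs s ''vis'')) \<subseteq> nz (arrs s' ''vis'') \<Longrightarrow> pw (nz (arrs s' ''vis'')) + c \<le> k' \<Longrightarrow> Q k' s'"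
  shows "wp Walk Q k s"
proof -
  define u' y' where "u' = regs s ''u''" and "y' = regs s ''y''"
  let ?Em = "out_edges s"
  define s1 where "s1 = setr ''tp'' u' (setr ''cu'' y' (setr ''pr'' u' s))"
  let ?g = "10 * w"
  \<comment> \<open>The disjunction records that the walk visits its first vertex \<open>y'\<close>:
    since \<open>y'\<close> is not a hub, the loop cannot stop while \<open>cu\<close> is still
    \<open>y'\<close>.\<close>
  let ?J = "\<lambda>k' s'. wok s' \<and> (\<exists>ss. sstk ?Em u' ?g s' ss) \<and> nz (arrs s ''vis'') \<subseteq> nz (arrs s' ''vis'') \<and>
     (regs s' ''cu'' = y' \<or> y' \<in> nz (arrs s' ''vis'')) \<and> pw (nz (arrs s' ''vis'')) + (c + 7) \<le> k'"
  have lt: "arrs s' ''lb'' (regs s' ''cu'') < 2 \<longleftrightarrow> regs s' ''cu'' \<notin> H" if "wok s'" "sstk ?Em u' ?g s' ss" for s' ss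
  proof -
    have "regs s' ''cu'' \<in> A" using stk_facts(12)[OF that(2)[unfolded sstk_def] lab finA] .
    then show ?thesis using L2 that(1) by (simp add: wok_def)
  qed
  let ?fin = "Cond (EqT (Reg ''tp'') (Reg ''cu'')) Skip (seqs
       [Store ''E1'' (Reg ''E'') (Reg ''tp''), Store ''E2'' (Reg ''E'') (Reg ''cu''),
        Assign ''E'' (Inc (Reg ''E''))])"
  let ?J' = "\<lambda>k' s'. ?J (k' + 1) s' \<and> regs s' ''cu'' \<in> H"
  have "wp (While (Less (Arr ''lb'' (Reg ''cu'')) (Const 2)) WalkB) ?J' (k - 3) s1"
  proof (rule wp_While[where I = ?J])
    have "wok s1" by (rule wok_cong[OF ok]) (auto simp: s1_def)
    moreover have "winv E A W H (nz (arrs s ''vis'')) (nz (arrs s ''kf'')) (arrs s ''lf'') ?Em (lgs s) u' [] u' y'"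
      using winv_start[OF st[unfolded kst_def] u] y unfolding u'_def y'_def by blast
    moreover have "lgs s1 = lgs s" by (rule lgs_cong) (auto simp: s1_def)
    ultimately have "wok s1" "sstk ?Em u' ?g s1 []" using cnt by (simp_all add: sstk_def stk_def s1_def kcnt_def)
    then show "?J (k - 3) s1" using k by (auto simp: s1_def)
  next
    fix k' s' assume J: "?J k' s'" and b: "eval_test (Less (Arr ''lb'' (Reg ''cu'')) (Const 2)) s'"
    then obtain ss where ss: "wok s'" "sstk ?Em u' ?g s' ss" by blast
    have "wp WalkB (\<lambda>k'' s''. wok s'' \<and> (\<exists>ss'. sstk ?Em u' ?g s'' ss') \<and>
       nz (arrs s'' ''vis'') = insert (regs s' ''cu'') (nz (arrs s' ''vis'')) \<and>
       pw (nz (arrs s'' ''vis'')) + (c + 7) \<le> k'') (k' - 1) s'"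
      by (rule wp_WalkB[OF ss]) (use lt[OF ss] b J in auto)
    then show "wp WalkB ?J (k' - 1) s'" by (rule wp_mono) (use J in auto)
  next
    fix k' s' assume J: "?J k' s'" and b: "\<not> eval_test (Less (Arr ''lb'' (Reg ''cu'')) (Const 2)) s'"
    then obtain ss where ss: "wok s'" "sstk ?Em u' ?g s' ss" by blast
    have "1 \<le> k'" using J by linarith
    then show "?J' (k' - 1) s'" using J lt[OF ss] b by simp
  qed linarith
  then have "wp (While (Less (Arr ''lb'' (Reg ''cu'')) (Const 2)) WalkB) (wp ?fin Q) (k - 3) s1"
  proof (rule wp_frame, goal_cases)
    case (1 k' s')
    then obtain ss where ss: "wok s'" "sstk ?Em u' ?g s' ss" by blast
    have E: "arrs s' ''E1'' = arrs s ''E1''" "arrs s' ''E2'' = arrs s ''E2''" "regs s' ''E'' = regs s ''E''"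
      using 1(2)[of "''E''"] 1(3)[of "''E1''"] 1(3)[of "''E2''"]
      by (auto simp: s1_def WalkB_def FindNext_def PrePop_def Push_def PostPop_def Del_def Log_def ForNb_def)
    note f = stk_facts[OF ss(2)[unfolded sstk_def] lab finA]
    have cu: "regs s' ''cu'' \<in> H" using 1(1) by blast
    have "length ss \<le> 10" using irr_length[OF f(3)] by simp
    then have cd: "card (nz (arrs s' ''kf'')) \<le> 10 * Suc w" using f(4) by simp
    note K = winv_finish[OF f(1) cu, folded f(2)]
    have yv: "insert y' (nz (arrs s ''vis'')) \<subseteq> nz (arrs s' ''vis'')" using 1(1) cu y by (auto simp: y'_def)
    have kk: "pw (nz (arrs s' ''vis'')) + c + 6 \<le> k'" using 1(1) by simp
    then obtain r where r: "k' = pw (nz (arrs s' ''vis'')) + c + 6 + r" using le_Suc_ex by blast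
    show ?case
    proof (cases "regs s' ''tp'' = regs s' ''cu''")
      case True
      then have "{{regs s' ''tp'', regs s' ''cu''}} - {{regs s' ''tp''}} = {}" by simp
      then have "kst s'" using K out_edges_cong[OF E] by (simp add: kst_def)
      then have "Q (k' - 2) s'"
        by (intro Q ss) (use cd E cnt yv r in \<open>simp_all add: kcnt_def y'_def\<close>)
      then show ?thesis using True r by (simp add: numeral_2_eq_2)
    next
      case False
      define s2 where "s2 = setr ''E'' (Suc (regs s' ''E'')) (seta ''E2'' (regs s' ''E'') (regs s' ''cu'')
        (seta ''E1'' (regs s' ''E'') (regs s' ''tp'') s'))"
      have "{{regs s' ''tp'', regs s' ''cu''}} - {{regs s' ''tp''}} = {{regs s' ''tp'', regs s' ''cu''}}" using False by auto
      moreover have "out_edges s2 = insert {regs s' ''tp'', regs s' ''cu''} (out_edges s')"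
        by (rule out_edges_snoc) (auto simp: s2_def)
      moreover have "lgs s2 = lgs s'" by (rule lgs_cong) (auto simp: s2_def)
      ultimately have "kst s2" using K out_edges_cong[OF E] by (simp add: kst_def s2_def)
      moreover have "wok s2" by (rule wok_cong[OF ss(1)]) (auto simp: s2_def)
      ultimately have "Q (k' - 4) s2"
        by (intro Q) (use cd E cnt yv r in \<open>simp_all add: kcnt_def y'_def s2_def\<close>)
      then show ?thesis using False r by (simp add: s2_def)
    qed
  qed
  moreover obtain r where "k = 3 + r" using k le_Suc_ex[of 3 k] by auto
  ultimately show ?thesis unfolding Walk_def s1_def u'_def y'_def by simp
qed

text \<open>Each neighbour of \<open>u\<close> in the core starts at most one walk; a path met again
  from its other end is visited already. The 20 steps per neighbour cover the tests and the overhead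
  of \<open>Walk\<close>, whose rounds are paid by \<open>pw\<close>.\<close>

lemma wp_ProcHub:
  assumes ok: "wok s" and st: "kst s" and cnt: "kcnt s w" and u: "regs s ''u'' = u" "u \<in> H"
    and k: "pw (nz (arrs s ''vis'')) + 20 * length (nb u) + 2 + c \<le> k"
    and Q: "\<And>k' s' w'. wok s' \<Longrightarrow> kst s' \<Longrightarrow> kcnt s' w' \<Longrightarrow> w' \<le> w + card (N u \<inter> A) \<Longrightarrow>
      nz (arrs s ''vis'') \<subseteq> nz (arrs s' ''vis'') \<Longrightarrow> N u \<inter> A \<subseteq> nz (arrs s' ''vis'') \<union> H \<Longrightarrow>
      pw (nz (arrs s' ''vis'')) + c \<le> k' \<Longrightarrow> Q k' s'"
  shows "wp ProcHub Q k s"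
proof -
  define J where "J zs s' \<longleftrightarrow> wok s' \<and> kst s' \<and> regs s' ''u'' = u \<and> distinct zs \<and> set zs \<subseteq> N u \<and>
    nz (arrs s ''vis'') \<subseteq> nz (arrs s' ''vis'') \<and> (N u - set zs) \<inter> A \<subseteq> nz (arrs s' ''vis'') \<union> H \<and>
    (\<exists>w'. kcnt s' w' \<and> w' \<le> w + card ((N u - set zs) \<inter> A))" for zs s'
  let ?I = "\<lambda>zs k' s'. J zs s' \<and> pw (nz (arrs s' ''vis'')) + 20 * length zs + 1 + c \<le> k'"
  have Jcong: "J zs (setr r x s')" if "J zs s'" "r \<in> {''j'', ''y''}" for zs r x s'
  proof -
    have "wok (setr r x s')" by (rule wok_cong[of s']) (use that in \<open>auto simp: J_def\<close>)
    moreover have "lgs (setr r x s') = lgs s'" by (rule lgs_cong) (use that in auto)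
    moreover have "out_edges (setr r x s') = out_edges s'" by (rule out_edges_cong) (use that in auto)
    ultimately show ?thesis using that by (auto simp: J_def kst_def kcnt_def)
  qed
  have fr: "''j'' \<notin> wregs Walk" "''y'' \<notin> wregs Walk" "''u'' \<notin> wregs Walk" "''nx'' \<notin> warrs Walk" "''to'' \<notin> warrs Walk"
    by (auto simp: Walk_def WalkB_def FindNext_def PrePop_def Push_def PostPop_def Del_def Log_def ForNb_def)
  show ?thesis unfolding ProcHub_def
  proof (rule wp_ForNb[where I = ?I and ys = "nb u"])
    show "adj s (regs s ''u'') (nb u)" using ok u by (simp add: wok_def adj_ok_def)
    have "\<exists>w'. kcnt s w' \<and> w' \<le> w + card ((N u - set (nb u)) \<inter> A)" using cnt by auto
    then have "J (nb u) s" unfolding J_def using ok st u distinct_nb[of u] by simp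
    then show "?I (nb u) (k - 1) s" using k by auto
  next
    fix k' s' assume I: "?I [] k' s'"
    then have J: "J [] s'" and kk: "pw (nz (arrs s' ''vis'')) + 1 + c \<le> k'" by auto
    from J obtain w' where "kcnt s' w'" "w' \<le> w + card (N u \<inter> A)" unfolding J_def by auto
    then have "Q (k' - 1) s'" using J kk by (intro Q[of s' w']) (auto simp: J_def)
    then show "1 \<le> k' \<and> Q (k' - 1) s'" using kk by simp
  next
    fix z zs k' s' assume I: "?I (z # zs) k' s'" and z: "regs s' ''y'' = z"
    then have J: "J (z # zs) s'" by blast
    obtain r where r: "k' = pw (nz (arrs s' ''vis'')) + 20 * length zs + 21 + c + r"
    proof -
      have "pw (nz (arrs s' ''vis'')) + 20 * length zs + 21 + c \<le> k'" using I by simp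
      then show ?thesis using that le_Suc_ex by blast
    qed
    obtain w' where w': "kcnt s' w'" "w' \<le> w + card ((N u - set (z # zs)) \<inter> A)" using J unfolding J_def by auto
    have ok': "wok s'" "kst s'" "regs s' ''u'' = u" "z \<in> N u" "z \<notin> set zs" using J by (auto simp: J_def)
    have al: "arrs s' ''x'' z = 0 \<longleftrightarrow> z \<in> A"
      using ok' N_lt[OF ok'(4)] by (auto simp: wok_def alive_def)
    have lb: "z \<in> A \<Longrightarrow> arrs s' ''lb'' z < 2 \<longleftrightarrow> z \<notin> H" using ok' L2 by (simp add: wok_def)
    have vz: "arrs s' ''vis'' z = 0 \<longleftrightarrow> z \<notin> nz (arrs s' ''vis'')" by (simp add: nz_def)
    have fi: "finite ((N u - set zs) \<inter> A)" using finA by simp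
    show "3 \<le> k' \<and> wp (Cond (Conj (EqT (Arr ''x'' (Reg ''y'')) (Const 0))
     (Conj (Less (Arr ''lb'' (Reg ''y'')) (Const 2)) (EqT (Arr ''vis'' (Reg ''y'')) (Const 0)))) Walk Skip) (?I zs) (k' - 3) s'"
    proof (cases "z \<in> A \<and> z \<notin> H \<and> z \<notin> nz (arrs s' ''vis'')")
      case True
      have S: "(N u - set zs) \<inter> A = insert z ((N u - set (z # zs)) \<inter> A)" using True ok' by auto
      have cS: "card ((N u - set zs) \<inter> A) = Suc (card ((N u - set (z # zs)) \<inter> A))"
        unfolding S using finA by simp
      have "wp Walk (\<lambda>k'' s''. wok s'' \<and> kst s'' \<and> kcnt s'' (Suc w') \<and>
        insert z (nz (arrs s' ''vis'')) \<subseteq> nz (arrs s'' ''vis'') \<and> pw (nz (arrs s'' ''vis'')) + (20 * length zs + 1 + c) \<le> k'') (k' - 4) s'"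
        by (rule wp_Walk[OF ok'(1,2) w'(1), where c = "20 * length zs + 1 + c"])
          (use True ok' u z r in auto)
      then have "wp Walk (?I zs) (k' - 4) s'"
      proof (rule wp_frame, goal_cases)
        case (1 k'' s'')
        have "regs s'' ''u'' = u" using 1(2)[OF fr(3)] ok' by simp
        moreover have "(N u - set zs) \<inter> A \<subseteq> nz (arrs s'' ''vis'') \<union> H"
          unfolding S using 1(1) J unfolding J_def by blast
        moreover have "\<exists>w''. kcnt s'' w'' \<and> w'' \<le> w + card ((N u - set zs) \<inter> A)"
          using 1(1) w'(2) cS by (intro exI[of _ "Suc w'"]) simp
        moreover have "nz (arrs s ''vis'') \<subseteq> nz (arrs s'' ''vis'')" using 1(1) J unfolding J_def by blast
        ultimately have "J zs s''" using 1(1) J unfolding J_def by simp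
        then show ?case using 1(1) by simp
      qed
      then show ?thesis using True al lb vz z r by simp
    next
      case False
      have c1: "(N u - set zs) \<inter> A \<subseteq> nz (arrs s' ''vis'') \<union> H"
        using J False unfolding J_def by auto
      have "card ((N u - set (z # zs)) \<inter> A) \<le> card ((N u - set zs) \<inter> A)"
        by (rule card_mono[OF fi]) auto
      then have "J zs s'" using J c1 w' unfolding J_def by (auto intro!: exI[of _ w'])
      then have "?I zs (k' - 5) s'" using r by simp
      moreover have "\<not> (arrs s' ''x'' z = 0 \<and> arrs s' ''lb'' z < 2 \<and> arrs s' ''vis'' z = 0)"
        using False al lb vz by blast
      ultimately show ?thesis using z r by auto
    qed
  qed (use fr k Jcong in auto)
qed

end

section \<open>Hubs\<close>

definition Label :: prog where
  "Label = Loop ''i'' ''n'' (Cond (EqT (Arr ''x'' (Reg ''i'')) (Const 0))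
     (Cond (Less (Const 2) (Arr ''dg'' (Reg ''i''))) (Store ''lb'' (Reg ''i'') (Const 2))
       (Store ''lb'' (Reg ''i'') (Arr ''w'' (Reg ''i'')))) Skip)"

definition PassA :: prog where
  "PassA = Loop ''i'' ''n'' (Cond (Conj (EqT (Arr ''x'' (Reg ''i'')) (Const 0)) (Lab ''i'' 2))
     (Seq (Assign ''u'' (Reg ''i'')) ProcHub) Skip)"

text \<open>Unvisited vertices without label 2 lie on components that are cycles. A new hub turns
  such a cycle into a path from the hub to itself.\<close>

definition PassB :: prog where
  "PassB = Loop ''i'' ''n'' (Cond (Conj (EqT (Arr ''x'' (Reg ''i'')) (Const 0))
       (Conj (Less (Arr ''lb'' (Reg ''i'')) (Const 2)) (EqT (Arr ''vis'' (Reg ''i'')) (Const 0))))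
     (Seq (Store ''lb'' (Reg ''i'') (Const 2)) (Seq (Assign ''u'' (Reg ''i'')) ProcHub)) Skip)"

text \<open>An unvisited vertex is still present, and declaring it a hub changes neither the current
  graph nor the log.\<close>

lemma kinv_new_hub:
  assumes "kinv E A W H Vis K lf Em log" "v \<in> A" "v \<notin> Vis"
  shows "kinv E A W (insert v H) Vis K lf Em log"
proof -
  have b: "kbase A H Vis K lf Em" and c: "\<forall>x\<in>Vis. nbh E x \<inter> A \<subseteq> Vis \<union> H"
    and r: "reduction A (ind E A) W (curV A Vis K) (curE E A Vis K lf Em) W (foldr lstep log)"
    using assms(1) by (auto simp: kinv_def)
  note b' = kbaseD[OF b]
  have "\<forall>x\<in>K. lf x \<in> K \<union> insert v H \<and> lf x \<noteq> x" using b'(4) by blast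
  moreover have "\<forall>e\<in>Em. e \<subseteq> K \<union> insert v H \<and> card e = 2" using b'(5) by blast
  moreover have "insert v H \<subseteq> A" "Vis \<subseteq> A - insert v H" using b'(1,2) assms(2,3) by auto
  ultimately have "kbase A (insert v H) Vis K lf Em" unfolding kbase_def using b'(3) by blast
  moreover have "\<forall>x\<in>Vis. nbh E x \<inter> A \<subseteq> Vis \<union> insert v H" using c by blast
  ultimately show ?thesis unfolding kinv_def using r by blast
qed

lemma kinv_init: "H \<subseteq> A \<Longrightarrow> kinv E A W H {} {} lf {} []"
proof -
  assume "H \<subseteq> A"
  have "foldr lstep [] = (\<lambda>D. D)" by (rule ext) simp
  moreover have "curE E A {} {} lf {} = ind E A" "curV A {} {} = A" by (auto simp: curE_def curV_def)
  ultimately show ?thesis using \<open>H \<subseteq> A\<close> reduction_refl[of A "ind E A" W] by (simp add: kinv_def kbase_def id_def)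
qed

context graph_input begin

definition hubs3 :: "nat set \<Rightarrow> nat set" where
  "hubs3 A = {v \<in> A. 2 < card (N v \<inter> A)}"

lemma wp_Label:
  assumes inv: "sinv s" and k: "5 * n + 2 + c \<le> k"
    and Q: "\<And>k' s'. c \<le> k' \<Longrightarrow>
      \<forall>v\<in>alive s. arrs s' ''lb'' v = (if v \<in> hubs3 (alive s) then 2 else arrs s ''w'' v) \<Longrightarrow>
      (\<And>x. x \<noteq> ''i'' \<Longrightarrow> regs s' x = regs s x) \<Longrightarrow>
      (\<And>a. a \<noteq> ''lb'' \<Longrightarrow> arrs s' a = arrs s a) \<Longrightarrow> Q k' s'"
  shows "wp Label Q k s"
proof -
  define d x w where "d = arrs s ''dg''" and "x = arrs s ''x''" and "w = arrs s ''w''"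
  let ?I = "\<lambda>i k' s'. 5 * (n - i) + 1 + c \<le> k' \<and> arrs s' ''dg'' = d \<and> arrs s' ''x'' = x \<and> arrs s' ''w'' = w \<and>
     (\<forall>v<i. v \<in> alive s \<longrightarrow> arrs s' ''lb'' v = (if 2 < d v then 2 else w v))"
  have "wp Label (\<lambda>k' s'. c \<le> k' \<and> (\<forall>v<n. v \<in> alive s \<longrightarrow> arrs s' ''lb'' v = (if 2 < d v then 2 else w v))) k s"
    unfolding Label_def
  proof (rule wp_Loop[where I = ?I and N = n])
    show "regs s ''n'' = n" using inv by (simp add: sinv_def adj_ok_def)
  next
    fix i k' s' assume I: "?I i k' s'" and i: "regs s' ''i'' = i" "i < n"
    obtain r where r: "k' = 6 + 5 * (n - Suc i) + c + r"
    proof -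
      have "5 * (n - i) = 5 + 5 * (n - Suc i)" using i by simp
      then have "6 + 5 * (n - Suc i) + c \<le> k'" using I by linarith
      then show ?thesis using that le_Suc_ex by blast
    qed
    have al: "i \<in> alive s \<longleftrightarrow> x i = 0" using i by (simp add: alive_def x_def)
    show "2 \<le> k' \<and> wp (Cond (EqT (Arr ''x'' (Reg ''i'')) (Const 0))
     (Cond (Less (Const 2) (Arr ''dg'' (Reg ''i''))) (Store ''lb'' (Reg ''i'') (Const 2))
       (Store ''lb'' (Reg ''i'') (Arr ''w'' (Reg ''i'')))) Skip) (?I (Suc i)) (k' - 2) s'"
      using I i r al by (cases "x i = 0"; cases "2 < d i") (simp_all add: less_Suc_eq)
  qed (use k in \<open>auto simp: d_def x_def w_def\<close>)
  then show ?thesis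
  proof (rule wp_frame, goal_cases)
    case (1 k' s')
    show ?case
    proof (rule Q)
      show "\<forall>v\<in>alive s. arrs s' ''lb'' v = (if v \<in> hubs3 (alive s) then 2 else arrs s ''w'' v)"
      proof
        fix v assume v: "v \<in> alive s"
        then have "d v = card (N v \<inter> alive s)" "v < n" using inv by (auto simp: sinv_def d_def alive_def)
        then show "arrs s' ''lb'' v = (if v \<in> hubs3 (alive s) then 2 else arrs s ''w'' v)"
          using 1(1) v by (simp add: hubs3_def w_def)
      qed
    qed (use 1 in \<open>auto simp: Label_def Loop_def\<close>)
  qed
qed

text \<open>Prepaid cost of calling \<open>ProcHub\<close> on each of the vertices still to be
  passed, apart from the rounds of its walks.\<close>

definition pot2 :: "nat \<Rightarrow> nat" where
  "pot2 i = (\<Sum>v\<in>{i..<n}. 20 * length (nb v) + 10)"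

lemma pot2_step: "i < n \<Longrightarrow> pot2 i = 20 * length (nb i) + 10 + pot2 (Suc i)"
  by (simp add: pot2_def sum.atLeast_Suc_lessThan)

lemma pot2_le: "pot2 0 \<le> 40 * length es + 10 * n"
  using sum_nb unfolding pot2_def sum.distrib sum_distrib_left[symmetric] by simp

lemma ProcHub_frame:
  "''i'' \<notin> wregs ProcHub" "''n'' \<notin> wregs ProcHub" "''u'' \<notin> wregs ProcHub"
  by (auto simp: ProcHub_def Walk_def WalkB_def FindNext_def PrePop_def Push_def PostPop_def Del_def Log_def ForNb_def)

end

context core begin

lemma kst_cong:
  assumes "kst s" "\<And>a. a \<noteq> ''lb'' \<Longrightarrow> arrs s' a = arrs s a" "\<And>x. x \<notin> {''i'', ''u''} \<Longrightarrow> regs s' x = regs s x"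
  shows "kst s'"
proof -
  have "lgs s' = lgs s" by (rule lgs_cong) (auto simp: assms(2,3))
  moreover have "out_edges s' = out_edges s" by (rule out_edges_cong) (simp_all add: assms(2,3))
  ultimately show ?thesis using assms(1) by (simp add: kst_def assms(2))
qed

lemma wp_PassA:
  assumes ok: "wok s" and st: "kst s" and cnt: "kcnt s 0"
    and k: "pw (nz (arrs s ''vis'')) + pot2 0 + 2 + c \<le> k"
    and Q: "\<And>k' s' w. wok s' \<Longrightarrow> kst s' \<Longrightarrow> kcnt s' w \<Longrightarrow> w \<le> (\<Sum>v\<in>H. card (N v \<inter> A)) \<Longrightarrow>
      \<forall>v\<in>H. N v \<inter> A \<subseteq> nz (arrs s' ''vis'') \<union> H \<Longrightarrow> pw (nz (arrs s' ''vis'')) + c \<le> k' \<Longrightarrow> Q k' s'"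
  shows "wp PassA Q k s"
proof -
  have fH: "finite H" using finA HA finite_subset by blast
  define J where "J i s' \<longleftrightarrow> wok s' \<and> kst s' \<and> (\<forall>v\<in>H. v < i \<longrightarrow> N v \<inter> A \<subseteq> nz (arrs s' ''vis'') \<union> H) \<and>
     (\<exists>w. kcnt s' w \<and> w \<le> (\<Sum>v\<in>{v \<in> H. v < i}. card (N v \<inter> A)))" for i s'
  let ?I = "\<lambda>i k' s'. J i s' \<and> pw (nz (arrs s' ''vis'')) + pot2 i + 1 + c \<le> k'"
  have Jcong: "J i (setr ''i'' x s')" if "J i s'" for i x s'
  proof -
    have "wok (setr ''i'' x s')" by (rule wok_cong[of s']) (use that in \<open>auto simp: J_def\<close>)
    moreover have "kst (setr ''i'' x s')" by (rule kst_cong[of s']) (use that in \<open>auto simp: J_def\<close>)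
    ultimately show ?thesis using that by (auto simp: J_def kcnt_def)
  qed
  show ?thesis unfolding PassA_def
  proof (rule wp_Loop[where I = ?I and N = n])
    show "regs s ''n'' = n" using ok by (simp add: wok_def adj_ok_def)
    have "J 0 s" using ok st cnt by (auto simp: J_def)
    then show "?I 0 (k - 1) s" using k by auto
  next
    fix k' s' assume I: "?I n k' s'"
    have "{v \<in> H. v < n} = H" using HA AV by auto
    then obtain w where "kcnt s' w" "w \<le> (\<Sum>v\<in>H. card (N v \<inter> A))" using I by (auto simp: J_def)
    moreover have "\<forall>v\<in>H. N v \<inter> A \<subseteq> nz (arrs s' ''vis'') \<union> H"
    proof
      fix v assume v: "v \<in> H"
      then have "v < n" using HA AV by auto
      then show "N v \<inter> A \<subseteq> nz (arrs s' ''vis'') \<union> H" using I v unfolding J_def by blast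
    qed
    ultimately have "Q (k' - 1) s'" using I by (intro Q[of s' w]) (auto simp: J_def)
    then show "1 \<le> k' \<and> Q (k' - 1) s'" using I by auto
  next
    fix i k' s' assume I: "?I i k' s'" and i: "regs s' ''i'' = i" "i < n"
    obtain r where r: "k' = pw (nz (arrs s' ''vis'')) + (20 * length (nb i) + 10) + pot2 (Suc i) + 1 + c + r"
    proof -
      have "pw (nz (arrs s' ''vis'')) + (20 * length (nb i) + 10) + pot2 (Suc i) + 1 + c \<le> k'"
        using I pot2_step[OF i(2)] by simp
      then show ?thesis using that le_Suc_ex by blast
    qed
    have J: "J i s'" using I by blast
    then obtain w where w: "kcnt s' w" "w \<le> (\<Sum>v\<in>{v \<in> H. v < i}. card (N v \<inter> A))" by (auto simp: J_def)
    have o: "wok s'" "kst s'" using J by (auto simp: J_def)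
    have al: "arrs s' ''x'' i = 0 \<longleftrightarrow> i \<in> A" using o i by (auto simp: wok_def alive_def)
    have lb: "i \<in> A \<Longrightarrow> arrs s' ''lb'' i = 2 \<longleftrightarrow> i \<in> H" using o lab by (auto simp: wok_def labels_def)
    show "2 \<le> k' \<and> wp (Cond (Conj (EqT (Arr ''x'' (Reg ''i'')) (Const 0)) (Lab ''i'' 2))
     (Seq (Assign ''u'' (Reg ''i'')) ProcHub) Skip) (?I (Suc i)) (k' - 2) s'"
    proof (cases "i \<in> H")
      case True
      let ?s = "setr ''u'' i s'"
      have S: "{v \<in> H. v < Suc i} = insert i {v \<in> H. v < i}" using True by auto
      have sm: "(\<Sum>v\<in>{v \<in> H. v < Suc i}. card (N v \<inter> A)) = card (N i \<inter> A) + (\<Sum>v\<in>{v \<in> H. v < i}. card (N v \<inter> A))"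
        unfolding S using fH by simp
      have "wp ProcHub (?I (Suc i)) (k' - 4) ?s"
      proof (rule wp_ProcHub[where c = "pot2 (Suc i) + 1 + c" and u = i])
        show "wok ?s" by (rule wok_cong[OF o(1)]) auto
        show "kst ?s" by (rule kst_cong[OF o(2)]) auto
        show "kcnt ?s w" using w by (simp add: kcnt_def)
        fix k2 s2 w2 assume a: "wok s2" "kst s2" "kcnt s2 w2" "w2 \<le> w + card (N i \<inter> A)"
          "nz (arrs ?s ''vis'') \<subseteq> nz (arrs s2 ''vis'')" "N i \<inter> A \<subseteq> nz (arrs s2 ''vis'') \<union> H"
          "pw (nz (arrs s2 ''vis'')) + (pot2 (Suc i) + 1 + c) \<le> k2"
        have "N v \<inter> A \<subseteq> nz (arrs s2 ''vis'') \<union> H" if "v \<in> H" "v < Suc i" for v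
        proof (cases "v = i")
          case False
          then have "N v \<inter> A \<subseteq> nz (arrs s' ''vis'') \<union> H" using J that by (auto simp: J_def)
          then show ?thesis using a(5) by auto
        qed (use a(6) in simp)
        moreover have "w2 \<le> (\<Sum>v\<in>{v \<in> H. v < Suc i}. card (N v \<inter> A))" using a(4) w(2) sm by simp
        ultimately have "J (Suc i) s2" using a(1-3) by (auto simp: J_def)
        then show "?I (Suc i) k2 s2" using a(7) by simp
      qed (use True r in auto)
      then show ?thesis using True HA al lb i r by auto
    next
      case False
      have "{v \<in> H. v < Suc i} = {v \<in> H. v < i}" using False less_Suc_eq by auto
      then have "J (Suc i) s'" using J False by (auto simp: J_def less_Suc_eq)
      moreover have "\<not> (arrs s' ''x'' i = 0 \<and> arrs s' ''lb'' i = 2)" using False al lb by blast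
      ultimately show ?thesis using i r by auto
    qed
  qed (use ProcHub_frame k Jcong in auto)
qed

end

section \<open>Components that are cycles, and the size of the core\<close>

context graph_input begin

text \<open>All degrees within \<open>C\<close> are 2, so \<open>C\<close> induces as many edges as
  it has vertices. That is too many for a forest, hence some edge of \<open>F\<close> lies
  inside.\<close>

lemma closed_feedback:
  assumes F: "feedback_edge_set E F" and C: "C \<subseteq> A" "C \<noteq> {}" and A: "A \<subseteq> {0..<n}"
    and cl: "\<And>x. x \<in> C \<Longrightarrow> N x \<inter> A \<subseteq> C" and d: "\<And>x. x \<in> C \<Longrightarrow> card (N x \<inter> A) = 2"
  shows "\<exists>f\<in>F. f \<subseteq> C"
proof (rule ccontr)
  assume no: "\<not> ?thesis"
  have g: "simple_graph C (ind E C)" using simple_graph_ind[OF sg] C A by blast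
  have "forest (E - F)" using F by (simp add: feedback_edge_set_def)
  then have "forest (ind E C)" by (rule forest_mono) (use no in \<open>auto simp: ind_def\<close>)
  then have lt: "card (ind E C) < card C" using forest_card[OF g] C by blast
  have "card (nbh (ind E C) x) = 2" if "x \<in> C" for x
  proof -
    have "N x \<inter> C = N x \<inter> A" using cl[OF that] C by blast
    then show ?thesis using d[OF that] nbh_ind[OF that, of E] by simp
  qed
  then have "(\<Sum>x\<in>C. card (nbh (ind E C) x)) = 2 * card C" by simp
  then show False using handshake[OF g] lt by simp
qed

text \<open>The last conjunct charges every hub added in the second pass to its own edge of
  \<open>F\<close>, found in the part of the core finished so far.\<close>

definition binv :: "nat set \<Rightarrow> nat set \<Rightarrow> nat set set \<Rightarrow> nat set \<Rightarrow> store \<Rightarrow> bool" where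
  "binv A W F H s \<longleftrightarrow> hubs3 A \<subseteq> H \<and> core n es A W H (arrs s ''lb'') \<and> adj_ok s \<and> alive s = A \<and>
     kinv E A W H (nz (arrs s ''vis'')) (nz (arrs s ''kf'')) (arrs s ''lf'') (out_edges s) (lgs s) \<and>
     (\<exists>w. card (nz (arrs s ''kf'')) \<le> 10 * w \<and> regs s ''E'' \<le> w \<and> w \<le> (\<Sum>v\<in>H. card (N v \<inter> A))) \<and>
     (\<forall>v\<in>H. N v \<inter> A \<subseteq> nz (arrs s ''vis'') \<union> H) \<and>
     card (H - hubs3 A) \<le> card {f \<in> F. f \<subseteq> nz (arrs s ''vis'') \<union> H}"

definition pwA :: "nat set \<Rightarrow> nat set \<Rightarrow> nat" where
  "pwA A Vis = (\<Sum>v\<in>A - Vis. 50 + 10 * length (nb v))"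

lemma binv_cong:
  assumes "binv A W F H s" "\<And>a. arrs s' a = arrs s a" "\<And>x. x \<notin> {''i'', ''u''} \<Longrightarrow> regs s' x = regs s x"
  shows "binv A W F H s'"
proof -
  have "lgs s' = lgs s" by (rule lgs_cong) (auto simp: assms(2,3))
  moreover have "out_edges s' = out_edges s" by (rule out_edges_cong) (simp_all add: assms(2,3))
  moreover have "alive s' = alive s" by (rule alive_cong) (simp add: assms(2))
  moreover have "adj_ok s' \<longleftrightarrow> adj_ok s" by (simp add: adj_ok_def adj_def assms(2,3))
  ultimately show ?thesis using assms(1) by (simp add: binv_def assms(2,3))
qed

text \<open>The part of the core finished by the new hub is disjoint from and not adjacent to
  everything finished before. \<open>closed_feedback\<close> therefore yields an edge of
  \<open>F\<close> that has not been charged yet.\<close>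

lemma wp_new_hub:
  assumes b: "binv A W F H s" and F: "feedback_edge_set E F"
    and v: "v \<in> A" "v \<notin> H" "v \<notin> nz (arrs s ''vis'')"
    and s1: "s1 = setr ''u'' v (seta ''lb'' v 2 s)"
    and k: "pwA A (nz (arrs s ''vis'')) + 20 * length (nb v) + 2 + c \<le> k"
    and Q: "\<And>k' s'. binv A W F (insert v H) s' \<Longrightarrow> nz (arrs s ''vis'') \<subseteq> nz (arrs s' ''vis'') \<Longrightarrow>
       pwA A (nz (arrs s' ''vis'')) + c \<le> k' \<Longrightarrow> Q k' s'"
  shows "wp ProcHub Q k s1"
proof -
  let ?H = "insert v H" and ?L = "(arrs s ''lb'')(v := 2)" and ?Vis = "nz (arrs s ''vis'')"
  interpret c0: core n es A W H "arrs s ''lb''" using b by (simp add: binv_def)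
  have b1: "hubs3 A \<subseteq> H" "adj_ok s" "alive s = A"
    and kv: "kinv E A W H ?Vis (nz (arrs s ''kf'')) (arrs s ''lf'') (out_edges s) (lgs s)"
    and cl: "\<forall>v\<in>H. N v \<inter> A \<subseteq> ?Vis \<union> H"
    and cF: "card (H - hubs3 A) \<le> card {f \<in> F. f \<subseteq> ?Vis \<union> H}"
    using b by (auto simp: binv_def)
  obtain w where w: "card (nz (arrs s ''kf'')) \<le> 10 * w" "regs s ''E'' \<le> w" "w \<le> (\<Sum>v\<in>H. card (N v \<inter> A))"
    using b by (auto simp: binv_def)
  have fH: "finite H" using c0.finA c0.HA finite_subset by blast
  interpret c1: core n es A W ?H ?L
    by unfold_locales (use c0.AV c0.HA c0.lab c0.deg2 v in \<open>auto simp: labels_def\<close>)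
  have clV: "\<forall>x\<in>?Vis. N x \<inter> A \<subseteq> ?Vis \<union> H" using kv by (simp add: kinv_def)
  have VA: "?Vis \<subseteq> A - H" using kbaseD(2)[of A H ?Vis] kv unfolding kinv_def by blast
  have ok1: "c1.wok s1"
  proof -
    have "adj_ok s1" by (rule adj_ok_cong[OF b1(2)]) (auto simp: s1)
    moreover have "alive s1 = A" using alive_cong[of s1 s] b1(3) by (simp add: s1)
    ultimately show ?thesis by (simp add: c1.wok_def s1)
  qed
  have st1: "c1.kst s1"
  proof -
    have "lgs s1 = lgs s" by (rule lgs_cong) (auto simp: s1)
    moreover have "out_edges s1 = out_edges s" by (rule out_edges_cong) (simp_all add: s1)
    ultimately show ?thesis using kinv_new_hub[OF kv v(1,3)] by (simp add: c1.kst_def s1)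
  qed
  have pw: "c1.pw = pwA A" by (simp add: fun_eq_iff c1.pw_def pwA_def)
  show ?thesis
  proof (rule c1.wp_ProcHub[OF ok1 st1, where w = w and u = v and c = c])
    show "c1.kcnt s1 w" using w by (simp add: c1.kcnt_def s1)
    fix k2 s2 w2 assume a: "c1.wok s2" "c1.kst s2" "c1.kcnt s2 w2" "w2 \<le> w + card (N v \<inter> A)"
      "nz (arrs s1 ''vis'') \<subseteq> nz (arrs s2 ''vis'')" "N v \<inter> A \<subseteq> nz (arrs s2 ''vis'') \<union> ?H"
      "c1.pw (nz (arrs s2 ''vis'')) + c \<le> k2"
    let ?Vis2 = "nz (arrs s2 ''vis'')"
    have sub: "?Vis \<subseteq> ?Vis2" using a(5) by (simp add: s1)
    have lb2: "arrs s2 ''lb'' = ?L" using a(1) by (simp add: c1.wok_def)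
    have kv2: "kinv E A W ?H ?Vis2 (nz (arrs s2 ''kf'')) (arrs s2 ''lf'') (out_edges s2) (lgs s2)"
      using a(2) by (simp add: c1.kst_def)
    have clV2: "\<forall>x\<in>?Vis2. N x \<inter> A \<subseteq> ?Vis2 \<union> ?H" using kv2 by (simp add: kinv_def)
    have VA2: "?Vis2 \<subseteq> A - ?H" using kbaseD(2)[of A ?H ?Vis2] kv2 unfolding kinv_def by blast
    have clH2: "\<forall>x\<in>?H. N x \<inter> A \<subseteq> ?Vis2 \<union> ?H" using cl a(6) sub by blast
    have "w2 \<le> (\<Sum>v\<in>?H. card (N v \<inter> A))" using a(4) w(3) v(2) fH by simp
    then have cnt: "\<exists>w. card (nz (arrs s2 ''kf'')) \<le> 10 * w \<and> regs s2 ''E'' \<le> w \<and> w \<le> (\<Sum>v\<in>?H. card (N v \<inter> A))"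
      using a(3) by (auto simp: c1.kcnt_def)
    let ?Z = "?Vis \<union> H" and ?Z2 = "?Vis2 \<union> ?H"
    have Z: "?Z \<subseteq> ?Z2" using sub by blast
    have zcl: "N x \<inter> A \<subseteq> ?Z" if "x \<in> ?Z" for x using that clV cl by blast
    have zcl2: "N x \<inter> A \<subseteq> ?Z2" if "x \<in> ?Z2" for x using that clV2 clH2 by blast
    \<comment> \<open>Old and new finished parts are both closed under neighbours in the core; by
      symmetry of adjacency so is their difference, and it contains no old hub, so all its degrees
      are 2.\<close>
    have "\<exists>f\<in>F. f \<subseteq> ?Z2 - ?Z"
    proof (rule closed_feedback[OF F _ _ c0.AV])
      show "?Z2 - ?Z \<subseteq> A" using VA2 c1.HA by blast
      show "?Z2 - ?Z \<noteq> {}" using v by blast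
      fix x assume x: "x \<in> ?Z2 - ?Z"
      then have xA: "x \<in> A" using VA2 c1.HA by blast
      show "N x \<inter> A \<subseteq> ?Z2 - ?Z"
      proof
        fix y assume y: "y \<in> N x \<inter> A"
        then have "y \<in> ?Z2" using zcl2[of x] x by blast
        moreover have "y \<notin> ?Z"
        proof
          assume "y \<in> ?Z"
          moreover have "x \<in> N y \<inter> A" using y xA nbh_sym[of x E y] by blast
          ultimately show False using zcl[of y] x by blast
        qed
        ultimately show "y \<in> ?Z2 - ?Z" by blast
      qed
      show "card (N x \<inter> A) = 2" using c0.deg2[OF xA] x by blast
    qed
    then obtain f where f: "f \<in> F" "f \<subseteq> ?Z2 - ?Z" by blast
    have FE: "F \<subseteq> E" using F by (simp add: feedback_edge_set_def)
    then have fF: "finite F" using simple_graph_finite[OF sg] finite_subset by blast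
    have "card f = 2" using f(1) FE sg unfolding simple_graph_def by blast
    then have "f \<noteq> {}" by auto
    \<comment> \<open>An edge is not empty, so one inside the difference was not counted
      before.\<close>
    then have "\<not> f \<subseteq> ?Z" using f(2) by blast
    then have "card (insert f {f \<in> F. f \<subseteq> ?Z}) = Suc (card {f \<in> F. f \<subseteq> ?Z})" using fF by simp
    moreover have "card (insert f {f \<in> F. f \<subseteq> ?Z}) \<le> card {f \<in> F. f \<subseteq> ?Z2}"
      by (rule card_mono) (use fF f Z in auto)
    moreover have "card (?H - hubs3 A) \<le> Suc (card (H - hubs3 A))"
    proof -
      have "?H - hubs3 A \<subseteq> insert v (H - hubs3 A)" by auto
      then have "card (?H - hubs3 A) \<le> card (insert v (H - hubs3 A))" by (rule card_mono[rotated]) (use fH in auto)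
      then show ?thesis using card_insert_le_m1[of "Suc (card (H - hubs3 A))" "H - hubs3 A" v] by simp
    qed
    ultimately have cF2: "card (?H - hubs3 A) \<le> card {f \<in> F. f \<subseteq> ?Z2}" using cF by linarith
    have "binv A W F ?H s2" unfolding binv_def lb2
      using b1(1) c1.core_axioms a(1) kv2 cnt clH2 cF2 by (auto simp: c1.wok_def)
    then show "Q k2 s2" using Q[of s2 k2] sub a(7) pw by simp
  qed (use k in \<open>auto simp: s1 pw\<close>)
qed

lemma wp_PassB:
  assumes b: "binv A W F H0 s" and F: "feedback_edge_set E F"
    and k: "pwA A (nz (arrs s ''vis'')) + pot2 0 + 2 + c \<le> k"
    and Q: "\<And>k' s' H. binv A W F H s' \<Longrightarrow> A - nz (arrs s' ''vis'') = H \<Longrightarrow> c \<le> k' \<Longrightarrow> Q k' s'"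
  shows "wp PassB Q k s"
proof -
  define J where "J i s' \<longleftrightarrow> (\<exists>H. binv A W F H s' \<and> (\<forall>v\<in>A. v < i \<longrightarrow> v \<in> nz (arrs s' ''vis'') \<union> H))" for i s'
  let ?I = "\<lambda>i k' s'. J i s' \<and> pwA A (nz (arrs s' ''vis'')) + pot2 i + 1 + c \<le> k'"
  have Jcong: "J i (setr ''i'' x s')" if "J i s'" for i x s'
    using that binv_cong[of A W F _ s' "setr ''i'' x s'"] by (auto simp: J_def)
  show ?thesis unfolding PassB_def
  proof (rule wp_Loop[where I = ?I and N = n])
    show "regs s ''n'' = n" using b by (simp add: binv_def adj_ok_def)
    have "J 0 s" using b by (auto simp: J_def)
    then show "?I 0 (k - 1) s" using k by auto
  next
    fix k' s' assume I: "?I n k' s'"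
    then obtain H where H: "binv A W F H s'" "\<forall>v\<in>A. v < n \<longrightarrow> v \<in> nz (arrs s' ''vis'') \<union> H" by (auto simp: J_def)
    interpret c0: core n es A W H "arrs s' ''lb''" using H by (simp add: binv_def)
    have "kbase A H (nz (arrs s' ''vis'')) (nz (arrs s' ''kf'')) (arrs s' ''lf'') (out_edges s')"
      using H(1) unfolding binv_def kinv_def by blast
    note kb = kbaseD(2)[OF this]
    have "A - nz (arrs s' ''vis'') = H"
    proof
      show "A - nz (arrs s' ''vis'') \<subseteq> H"
      proof
        fix v assume v: "v \<in> A - nz (arrs s' ''vis'')"
        then have "v < n" using c0.AV by auto
        then show "v \<in> H" using H(2) v by blast
      qed
      show "H \<subseteq> A - nz (arrs s' ''vis'')" using kb c0.HA by blast
    qed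
    then have "Q (k' - 1) s'" using I by (intro Q[OF H(1)]) auto
    then show "1 \<le> k' \<and> Q (k' - 1) s'" using I by auto
  next
    fix i k' s' assume I: "?I i k' s'" and i: "regs s' ''i'' = i" "i < n"
    obtain r where r: "k' = pwA A (nz (arrs s' ''vis'')) + (20 * length (nb i) + 10) + pot2 (Suc i) + 1 + c + r"
    proof -
      have "pwA A (nz (arrs s' ''vis'')) + (20 * length (nb i) + 10) + pot2 (Suc i) + 1 + c \<le> k'"
        using I pot2_step[OF i(2)] by simp
      then show ?thesis using that le_Suc_ex by blast
    qed
    obtain H where H: "binv A W F H s'" "\<forall>v\<in>A. v < i \<longrightarrow> v \<in> nz (arrs s' ''vis'') \<union> H" using I by (auto simp: J_def)
    interpret c0: core n es A W H "arrs s' ''lb''" using H by (simp add: binv_def)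
    have al: "arrs s' ''x'' i = 0 \<longleftrightarrow> i \<in> A" using H(1) i by (auto simp: binv_def alive_def)
    have lb: "i \<in> A \<Longrightarrow> arrs s' ''lb'' i < 2 \<longleftrightarrow> i \<notin> H" using c0.L2 by simp
    have vz: "arrs s' ''vis'' i = 0 \<longleftrightarrow> i \<notin> nz (arrs s' ''vis'')" by (simp add: nz_def)
    show "2 \<le> k' \<and> wp (Cond (Conj (EqT (Arr ''x'' (Reg ''i'')) (Const 0))
       (Conj (Less (Arr ''lb'' (Reg ''i'')) (Const 2)) (EqT (Arr ''vis'' (Reg ''i'')) (Const 0))))
     (Seq (Store ''lb'' (Reg ''i'') (Const 2)) (Seq (Assign ''u'' (Reg ''i'')) ProcHub)) Skip) (?I (Suc i)) (k' - 2) s'"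
    proof (cases "i \<in> A \<and> i \<notin> H \<and> i \<notin> nz (arrs s' ''vis'')")
      case True
      have "wp ProcHub (?I (Suc i)) (k' - 5) (setr ''u'' i (seta ''lb'' i 2 s'))"
      proof (rule wp_new_hub[OF H(1) F _ _ _ refl, where c = "pot2 (Suc i) + 1 + c"])
        fix k2 s2 assume a: "binv A W F (insert i H) s2" "nz (arrs s' ''vis'') \<subseteq> nz (arrs s2 ''vis'')"
          "pwA A (nz (arrs s2 ''vis'')) + (pot2 (Suc i) + 1 + c) \<le> k2"
        have "\<forall>v\<in>A. v < Suc i \<longrightarrow> v \<in> nz (arrs s2 ''vis'') \<union> insert i H"
          using H(2) a(2) by (auto simp: less_Suc_eq)
        then have "J (Suc i) s2" using a(1) unfolding J_def by blast
        then show "?I (Suc i) k2 s2" using a(3) by simp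
      qed (use True r in auto)
      then show ?thesis using True al lb vz i r by simp
    next
      case False
      then have "\<forall>v\<in>A. v < Suc i \<longrightarrow> v \<in> nz (arrs s' ''vis'') \<union> H" using H(2) by (auto simp: less_Suc_eq)
      then have "J (Suc i) s'" using H(1) unfolding J_def by blast
      moreover have "\<not> (arrs s' ''x'' i = 0 \<and> arrs s' ''lb'' i < 2 \<and> arrs s' ''vis'' i = 0)"
        using False al lb vz by blast
      ultimately show ?thesis using i r by auto
    qed
  qed (use ProcHub_frame k Jcong in auto)
qed

text \<open>Write \<open>f\<close> for \<open>card F\<close>. The handshake lemma bounds the degree
  sum by \<open>2 |A| + 2 f\<close>, and all degrees are at least 2, so the excess over 2 is at most
  \<open>2 f\<close>. This bounds the number of vertices in \<open>hubs3\<close> by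
  \<open>2 f\<close> and their degree sum by \<open>6 f\<close>; the remaining hubs are at most
  \<open>f\<close> in number, of degree 2.\<close>

lemma size_core:
  assumes F: "feedback_edge_set E F" and A: "A \<subseteq> {0..<n}" and d: "\<And>v. v \<in> A \<Longrightarrow> 2 \<le> card (N v \<inter> A)"
    and H: "hubs3 A \<subseteq> H" "H \<subseteq> A" "card (H - hubs3 A) \<le> card F"
  shows "card H \<le> 3 * card F" "(\<Sum>v\<in>H. card (N v \<inter> A)) \<le> 8 * card F"
proof -
  have fA: "finite A" using A finite_subset by blast
  then have fH: "finite H" "finite (hubs3 A)" using H finite_subset by (auto simp: hubs3_def)
  have g: "simple_graph A (ind E A)" using simple_graph_ind[OF sg A] .
  have fF: "finite F" using F simple_graph_finite[OF sg] finite_subset by (auto simp: feedback_edge_set_def)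
  let ?d = "\<lambda>v. card (N v \<inter> A)"
  have "(\<Sum>v\<in>A. card (nbh (ind E A) v)) = (\<Sum>v\<in>A. ?d v)"
    by (rule sum.cong) (auto simp: nbh_ind)
  then have hs: "(\<Sum>v\<in>A. ?d v) = 2 * card (ind E A)" using handshake[OF g] by simp
  have "card (ind E A - F) \<le> card A"
  proof (cases "A = {}")
    case True
    then have "ind E A = {}" using g by (metis all_not_in_conv empty_iff simple_graph_edge)
    then show ?thesis by simp
  next
    case False
    have "simple_graph A (ind E A - F)" using g by (auto simp: simple_graph_def)
    moreover have "forest (E - F)" using F by (simp add: feedback_edge_set_def)
    then have "forest (ind E A - F)" by (rule forest_mono) (auto simp: ind_def)
    ultimately show ?thesis using forest_card[OF _ _ False] by fastforce
  qed
  moreover have "card (ind E A) \<le> card (ind E A - F) + card F"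
    using fF by (metis card_Diff_subset_Int card_mono diff_le_self le_add_diff_inverse2 Int_lower2 add_le_mono order_refl finite_Int
        diff_card_le_card_Diff le_diff_conv)
  ultimately have e: "(\<Sum>v\<in>A. ?d v) \<le> 2 * card A + 2 * card F" using hs by linarith
  have sp: "(\<Sum>v\<in>A. ?d v) = (\<Sum>v\<in>A - hubs3 A. ?d v) + (\<Sum>v\<in>hubs3 A. ?d v)"
    by (rule sum.subset_diff) (use fA in \<open>auto simp: hubs3_def\<close>)
  have "(\<Sum>v\<in>A - hubs3 A. 2) \<le> (\<Sum>v\<in>A - hubs3 A. ?d v)" by (rule sum_mono) (use d in auto)
  then have lo: "2 * card (A - hubs3 A) \<le> (\<Sum>v\<in>A - hubs3 A. ?d v)" by simp
  have cA: "card A = card (A - hubs3 A) + card (hubs3 A)"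
    using fA fH card_Diff_subset[of "hubs3 A" A] card_mono[of A "hubs3 A"] by (auto simp: hubs3_def)
  have s3: "(\<Sum>v\<in>hubs3 A. ?d v) \<le> 2 * card (hubs3 A) + 2 * card F" using e sp lo cA by linarith
  have "(\<Sum>v\<in>hubs3 A. 3) \<le> (\<Sum>v\<in>hubs3 A. ?d v)" by (rule sum_mono) (auto simp: hubs3_def)
  then have "3 * card (hubs3 A) \<le> (\<Sum>v\<in>hubs3 A. ?d v)" by simp
  then have h3: "card (hubs3 A) \<le> 2 * card F" using s3 by linarith
  have cH: "card H = card (H - hubs3 A) + card (hubs3 A)"
    using fH H card_Diff_subset[of "hubs3 A" H] card_mono[of H "hubs3 A"] by auto
  show "card H \<le> 3 * card F" using cH h3 H(3) by linarith
  have "(\<Sum>v\<in>H. ?d v) = (\<Sum>v\<in>H - hubs3 A. ?d v) + (\<Sum>v\<in>hubs3 A. ?d v)"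
    by (rule sum.subset_diff) (use fH H in auto)
  moreover have "(\<Sum>v\<in>H - hubs3 A. ?d v) \<le> (\<Sum>v\<in>H - hubs3 A. 2)"
    by (rule sum_mono) (use H in \<open>auto simp: hubs3_def\<close>)
  moreover have "(\<Sum>v\<in>H - hubs3 A. 2) = 2 * card (H - hubs3 A)" by simp
  ultimately show "(\<Sum>v\<in>H. ?d v) \<le> 8 * card F" using s3 h3 H(3) by linarith
qed

end

section \<open>Output and lifting\<close>

fun only_inc :: "string \<Rightarrow> prog \<Rightarrow> bool" where
  "only_inc r (Assign x e) \<longleftrightarrow> x \<noteq> r \<or> e = Inc (Reg r)"
| "only_inc r (Seq p q) \<longleftrightarrow> only_inc r p \<and> only_inc r q"
| "only_inc r (Cond b p q) \<longleftrightarrow> only_inc r p \<and> only_inc r q"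
| "only_inc r (While b p) \<longleftrightarrow> only_inc r p"
| "only_inc r _ \<longleftrightarrow> True"

text \<open>Bounds the length of the log by the running time, which keeps that length out of all
  invariants.\<close>

lemma exec_only_inc: "exec p s t s' \<Longrightarrow> only_inc r p \<Longrightarrow> regs s' r \<le> regs s r + t"
  by (induction rule: exec.induct) auto

definition Emit :: "exp \<Rightarrow> exp \<Rightarrow> prog" where
  "Emit e f = seqs [Store ''E1'' (Reg ''E'') e, Store ''E2'' (Reg ''E'') f, Assign ''E'' (Inc (Reg ''E''))]"

definition Append :: "string \<Rightarrow> prog" where
  "Append r = Seq (Store r (Reg r) (Reg ''i'')) (Assign r (Inc (Reg r)))"

text \<open>An edge between two hubs belongs to no walk, so these edges are taken from the input
  list.\<close>

definition HubEdges :: prog where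
  "HubEdges = Loop ''i'' ''m'' (seqs
    [Assign ''u'' (Arr ''src'' (Reg ''i'')), Assign ''v'' (Arr ''dst'' (Reg ''i'')),
     Cond (Conj (Conj (EqT (Arr ''x'' (Reg ''u'')) (Const 0)) (Lab ''u'' 2))
        (Conj (EqT (Arr ''x'' (Reg ''v'')) (Const 0)) (Lab ''v'' 2))) (Emit (Reg ''u'') (Reg ''v'')) Skip])"

text \<open>Hubs enter \<open>kf\<close> too, so that \<open>kf\<close> finally marks the whole
  vertex set of the kernel. The label still separates them from the kept vertices, which alone have
  a predecessor edge.\<close>

definition OutV :: prog where
  "OutV = Loop ''i'' ''n'' (Seq
     (Cond (Conj (EqT (Arr ''x'' (Reg ''i'')) (Const 0)) (Lab ''i'' 2)) (Store ''kf'' (Reg ''i'') (Const 1)) Skip)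
     (Cond (Less (Const 0) (Arr ''kf'' (Reg ''i'')))
       (seqs [Append ''V'',
         Cond (Less (Const 0) (Arr ''w'' (Reg ''i''))) (Append ''W'') Skip,
         Cond (Less (Arr ''lb'' (Reg ''i'')) (Const 2)) (Emit (Reg ''i'') (Arr ''lf'' (Reg ''i''))) Skip]) Skip))"

definition Kernelize :: prog where
  "Kernelize = seqs [Build, Strip, Label, PassA, PassB, HubEdges, OutV]"

definition MarkD :: prog where
  "MarkD = Loop ''i'' ''d'' (Store ''t'' (Arr ''D'' (Reg ''i'')) (Const 1))"

definition Undo :: prog where
  "Undo = While (Less (Const 0) (Reg ''ln'')) (Seq (Assign ''ln'' (Dec (Reg ''ln'')))
     (Cond (Less (Const 0) (Arr ''t'' (Arr ''lp'' (Reg ''ln'')))) (Store ''t'' (Arr ''la'' (Reg ''ln'')) (Const 1))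
       (Cond (Less (Const 0) (Arr ''t'' (Arr ''lz'' (Reg ''ln'')))) (Store ''t'' (Arr ''lB'' (Reg ''ln'')) (Const 1))
         (Store ''t'' (Arr ''lc'' (Reg ''ln'')) (Const 1)))))"

definition OutS :: prog where
  "OutS = Loop ''i'' ''n'' (Cond (Conj (EqT (Arr ''kf'' (Reg ''i'')) (Const 0))
     (Neg (Conj (EqT (Arr ''s'' (Reg ''i'')) (Const 0)) (EqT (Arr ''t'' (Reg ''i'')) (Const 0)))))
     (Append ''S'') Skip)"

text \<open>It starts from the graph and the list \<open>D\<close> alone, so the log has to be
  computed again.\<close>

definition Complete :: prog where
  "Complete = seqs [Kernelize, MarkD, Undo, OutS]"

lemma out_set_snoc:
  assumes "arrs s' x = (arrs s x)(regs s x := a)" "regs s' x = Suc (regs s x)"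
  shows "out_set x s' = insert a (out_set x s)"
  using assms by (auto simp: out_set_def lessThan_Suc)

lemma out_set_cong: "arrs s' x = arrs s x \<Longrightarrow> regs s' x = regs s x \<Longrightarrow> out_set x s' = out_set x s"
  by (simp add: out_set_def)

context graph_input begin

definition hubset :: "store \<Rightarrow> nat set" where
  "hubset s = {v \<in> alive s. arrs s ''lb'' v = 2}"

lemma wp_HubEdges:
  assumes ok: "adj_ok s" and k: "8 * length es + 2 + c \<le> k"
    and Q: "\<And>k' s'. c \<le> k' \<Longrightarrow> out_edges s' = out_edges s \<union> {e \<in> E. e \<subseteq> hubset s} \<Longrightarrow>
      (\<And>x. x \<notin> {''i'', ''u'', ''v'', ''E''} \<Longrightarrow> regs s' x = regs s x) \<Longrightarrow>
      (\<And>a. a \<notin> {''E1'', ''E2''} \<Longrightarrow> arrs s' a = arrs s a) \<Longrightarrow> Q k' s'"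
  shows "wp HubEdges Q k s"
proof -
  define H where "H = hubset s"
  define ed where "ed i = (\<lambda>(a, b). {a, b}) ` {p \<in> set (take i es). fst p \<in> H \<and> snd p \<in> H}" for i
  define x lb where "x = arrs s ''x''" and "lb = arrs s ''lb''"
  let ?I = "\<lambda>i k' s'. 8 * (length es - i) + 1 + c \<le> k' \<and> arrs s' ''x'' = x \<and> arrs s' ''lb'' = lb \<and>
     arrs s' ''src'' = array_of (map fst es) \<and> arrs s' ''dst'' = array_of (map snd es) \<and>
     out_edges s' = out_edges s \<union> ed i"
  have mem: "v \<in> H \<longleftrightarrow> x v = 0 \<and> lb v = 2" if "v < n" for v
    using that by (auto simp: H_def hubset_def alive_def x_def lb_def)
  have ed_all: "ed (length es) = {e \<in> E. e \<subseteq> H}" by (auto simp: ed_def edges_of_def)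
  have "wp HubEdges (\<lambda>k' s'. c \<le> k' \<and> out_edges s' = out_edges s \<union> ed (length es)) k s"
    unfolding HubEdges_def
  proof (rule wp_Loop[where I = ?I and N = "length es"])
    show "regs s ''m'' = length es" using ok by (simp add: adj_ok_def)
    show "?I 0 (k - 1) s" using ok k by (auto simp: adj_ok_def x_def lb_def ed_def)
  next
    fix i k' s' assume I: "?I i k' s'" and i: "regs s' ''i'' = i" "i < length es"
    obtain r where r: "k' = 9 + 8 * (length es - Suc i) + c + r"
    proof -
      have "8 * (length es - i) = 8 + 8 * (length es - Suc i)" using i by simp
      then have "9 + 8 * (length es - Suc i) + c \<le> k'" using I by linarith
      then show ?thesis using that le_Suc_ex by blast
    qed
    obtain a b where ab: "es ! i = (a, b)" by (cases "es ! i")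
    have src: "array_of (map fst es) i = a" "array_of (map snd es) i = b" using i ab by (auto simp: array_of_def)
    have "{a, b} \<in> E" using ab nth_mem[OF i(2)] by (force simp: edges_of_def)
    then have lt: "a < n" "b < n" using simple_graphD[OF sg] by auto
    have tk: "set (take (Suc i) es) = insert (a, b) (set (take i es))"
      using take_Suc_conv_app_nth[OF i(2)] ab by simp
    have ed: "ed (Suc i) = (if a \<in> H \<and> b \<in> H then insert {a, b} (ed i) else ed i)"
      unfolding ed_def tk by auto
    let ?s = "setr ''v'' b (setr ''u'' a s')"
    let ?t = "setr ''E'' (Suc (regs s' ''E'')) (seta ''E2'' (regs s' ''E'') b (seta ''E1'' (regs s' ''E'') a ?s))"
    have "out_edges ?s = out_edges s'" by (rule out_edges_cong) auto
    moreover have "out_edges ?t = insert {a, b} (out_edges s')" by (rule out_edges_snoc) auto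
    ultimately show "2 \<le> k' \<and> wp (seqs [Assign ''u'' (Arr ''src'' (Reg ''i'')), Assign ''v'' (Arr ''dst'' (Reg ''i'')),
       Cond (Conj (Conj (EqT (Arr ''x'' (Reg ''u'')) (Const 0)) (Lab ''u'' 2))
        (Conj (EqT (Arr ''x'' (Reg ''v'')) (Const 0)) (Lab ''v'' 2))) (Emit (Reg ''u'') (Reg ''v'')) Skip]) (?I (Suc i)) (k' - 2) s'"
      using I i r src ed mem[OF lt(1)] mem[OF lt(2)] unfolding Emit_def
      by (cases "a \<in> H \<and> b \<in> H") (auto simp: insert_commute)
  next
    fix i k' s' z assume I: "?I i k' s'"
    have "out_edges (setr ''i'' z s') = out_edges s'" by (rule out_edges_cong) auto
    then show "?I i k' (setr ''i'' z s')" using I by simp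
  qed (use k in \<open>auto simp: Emit_def\<close>)
  then show ?thesis
  proof (rule wp_frame, goal_cases)
    case (1 k' s')
    show ?case
    proof (rule Q)
      show "out_edges s' = out_edges s \<union> {e \<in> E. e \<subseteq> hubset s}" using 1(1) ed_all by (simp add: H_def)
      show "regs s' x = regs s x" if "x \<notin> {''i'', ''u'', ''v'', ''E''}" for x
        using 1(2)[of x] that by (auto simp: HubEdges_def Loop_def Emit_def)
      show "arrs s' x = arrs s x" if "x \<notin> {''E1'', ''E2''}" for x
        using 1(3)[of x] that by (auto simp: HubEdges_def Loop_def Emit_def)
    qed (use 1(1) in blast)
  qed
qed

lemma wp_OutV:
  assumes n: "regs s ''n'' = n" and K: "nz (arrs s ''kf'') \<subseteq> alive s - hubset s"
    and lb: "\<And>v. v \<in> alive s - hubset s \<Longrightarrow> arrs s ''lb'' v < 2"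
    and z: "regs s ''V'' = 0" "regs s ''W'' = 0" and k: "14 * n + 2 + c \<le> k"
    and Q: "\<And>k' s'. c \<le> k' \<Longrightarrow> nz (arrs s' ''kf'') = nz (arrs s ''kf'') \<union> hubset s \<Longrightarrow>
      out_set ''V'' s' = nz (arrs s ''kf'') \<union> hubset s \<Longrightarrow>
      out_set ''W'' s' = (nz (arrs s ''kf'') \<union> hubset s) \<inter> nz (arrs s ''w'') \<Longrightarrow>
      out_edges s' = out_edges s \<union> (\<lambda>x. {x, arrs s ''lf'' x}) ` nz (arrs s ''kf'') \<Longrightarrow>
      (\<And>x. x \<notin> {''i'', ''V'', ''W'', ''E''} \<Longrightarrow> regs s' x = regs s x) \<Longrightarrow>
      (\<And>a. a \<notin> {''kf'', ''V'', ''W'', ''E1'', ''E2''} \<Longrightarrow> arrs s' a = arrs s a) \<Longrightarrow> Q k' s'"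
  shows "wp OutV Q k s"
proof -
  define H K where "H = hubset s" and "K = nz (arrs s ''kf'')"
  define x lb' w lf where "x = arrs s ''x''" and "lb' = arrs s ''lb''" and "w = arrs s ''w''" and "lf = arrs s ''lf''"
  define P where "P i s' \<longleftrightarrow> nz (arrs s' ''kf'') = K \<union> {v \<in> H. v < i} \<and>
      out_set ''V'' s' = {v \<in> K \<union> H. v < i} \<and> out_set ''W'' s' = {v \<in> K \<union> H. v < i} \<inter> nz w \<and>
      out_edges s' = out_edges s \<union> (\<lambda>x. {x, lf x}) ` {v \<in> K. v < i} \<and>
      arrs s' ''x'' = x \<and> arrs s' ''lb'' = lb' \<and> arrs s' ''w'' = w \<and> arrs s' ''lf'' = lf" for i s'
  let ?I = "\<lambda>i k' s'. 14 * (n - i) + 1 + c \<le> k' \<and> P i s'"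
  have KA: "K \<subseteq> alive s - H" and lbK: "\<And>v. v \<in> K \<Longrightarrow> lb' v < 2" using K lb unfolding K_def H_def lb'_def by auto
  have mem: "v \<in> H \<longleftrightarrow> x v = 0 \<and> lb' v = 2" if "v < n" for v
    using that by (auto simp: H_def hubset_def alive_def x_def lb'_def)
  have "wp OutV (\<lambda>k' s'. c \<le> k' \<and> P n s') k s"
    unfolding OutV_def
  proof (rule wp_Loop[where I = ?I and N = n])
    show "?I 0 (k - 1) s" using k z
      by (auto simp: P_def K_def x_def lb'_def w_def lf_def out_set_def)
  next
    fix i k' s' v assume I: "?I i k' s'"
    have "out_edges (setr ''i'' v s') = out_edges s'" by (rule out_edges_cong) auto
    moreover have "out_set ''V'' (setr ''i'' v s') = out_set ''V'' s'" "out_set ''W'' (setr ''i'' v s') = out_set ''W'' s'"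
      by (rule out_set_cong; simp)+
    ultimately show "?I i k' (setr ''i'' v s')" using I by (simp add: P_def)
  next
    fix i k' s' assume I: "?I i k' s'" and i: "regs s' ''i'' = i" "i < n"
    then have P: "P i s'" by blast
    obtain r where r: "k' = 15 + 14 * (n - Suc i) + c + r"
    proof -
      have "14 * (n - i) = 14 + 14 * (n - Suc i)" using i by simp
      then have "15 + 14 * (n - Suc i) + c \<le> k'" using I by linarith
      then show ?thesis using that le_Suc_ex by blast
    qed
    have KS: "{v \<in> K. v < Suc i} = (if i \<in> K then insert i {v \<in> K. v < i} else {v \<in> K. v < i})"
      and HS: "{v \<in> H. v < Suc i} = (if i \<in> H then insert i {v \<in> H. v < i} else {v \<in> H. v < i})"
      and BS: "{v \<in> K \<union> H. v < Suc i} = (if i \<in> K \<union> H then insert i {v \<in> K \<union> H. v < i} else {v \<in> K \<union> H. v < i})"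
      by (auto simp: less_Suc_eq)
    have kfi: "arrs s' ''kf'' i = 0 \<longleftrightarrow> i \<notin> K"
    proof -
      have "i \<in> nz (arrs s' ''kf'') \<longleftrightarrow> i \<in> K" using P by (simp add: P_def)
      then show ?thesis by (auto simp: nz_def)
    qed
    let ?b = "Seq
     (Cond (Conj (EqT (Arr ''x'' (Reg ''i'')) (Const 0)) (Lab ''i'' 2)) (Store ''kf'' (Reg ''i'') (Const 1)) Skip)
     (Cond (Less (Const 0) (Arr ''kf'' (Reg ''i'')))
       (seqs [Append ''V'',
         Cond (Less (Const 0) (Arr ''w'' (Reg ''i''))) (Append ''W'') Skip,
         Cond (Less (Arr ''lb'' (Reg ''i'')) (Const 2)) (Emit (Reg ''i'') (Arr ''lf'' (Reg ''i''))) Skip]) Skip)"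
    have ar: "arrs s' ''x'' = x" "arrs s' ''lb'' = lb'" "arrs s' ''w'' = w" "arrs s' ''lf'' = lf"
      using P by (auto simp: P_def)
    have Wi: "insert i B \<inter> nz w = (if w i = 0 then B \<inter> nz w else insert i (B \<inter> nz w))" for B
      by (auto simp: nz_def)
    consider (hub) "i \<in> H" "i \<notin> K" | (kept) "i \<in> K" "i \<notin> H" | (none) "i \<notin> K" "i \<notin> H" using KA by blast
    then have "wp ?b (?I (Suc i)) (k' - 2) s'"
    proof cases
      case hub
      define s1 where "s1 = seta ''kf'' i 1 s'"
      define s2 where "s2 = setr ''V'' (Suc (regs s1 ''V'')) (seta ''V'' (regs s1 ''V'') i s1)"
      define s3 where "s3 = (if w i = 0 then s2 else setr ''W'' (Suc (regs s2 ''W'')) (seta ''W'' (regs s2 ''W'') i s2))"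
      have "out_set ''V'' s2 = insert i (out_set ''V'' s1)" by (rule out_set_snoc) (auto simp: s2_def)
      moreover have "out_set ''V'' s1 = out_set ''V'' s'" "out_set ''W'' s1 = out_set ''W'' s'"
        by (rule out_set_cong; simp add: s1_def)+
      moreover have "out_set ''V'' s3 = out_set ''V'' s2" by (rule out_set_cong) (auto simp: s3_def)
      moreover have "out_set ''W'' s2 = out_set ''W'' s1" by (rule out_set_cong) (auto simp: s2_def)
      moreover have "out_set ''W'' s3 = (if w i = 0 then out_set ''W'' s2 else insert i (out_set ''W'' s2))"
        by (cases "w i = 0") (auto simp: s3_def intro!: out_set_snoc)
      moreover have "out_edges s3 = out_edges s'" by (rule out_edges_cong) (auto simp: s3_def s2_def s1_def)
      ultimately have o: "out_set ''V'' s3 = insert i (out_set ''V'' s')"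
          "out_set ''W'' s3 = (if w i = 0 then out_set ''W'' s' else insert i (out_set ''W'' s'))"
          "out_edges s3 = out_edges s'" by simp_all
      have a3: "arrs s3 ''x'' = x" "arrs s3 ''lb'' = lb'" "arrs s3 ''w'' = w" "arrs s3 ''lf'' = lf"
          "nz (arrs s3 ''kf'') = insert i (nz (arrs s' ''kf''))"
        by (simp_all add: s3_def s2_def s1_def ar)
      have "P (Suc i) s3"
        unfolding P_def KS HS BS a3 o using P hub unfolding P_def by (simp add: Wi)
      then show ?thesis using hub mem[OF i(2)] i r ar unfolding Append_def Emit_def s3_def s2_def s1_def
        by (cases "w i = 0") simp_all
    next
      case kept
      define s2 where "s2 = setr ''V'' (Suc (regs s' ''V'')) (seta ''V'' (regs s' ''V'') i s')"
      define s3 where "s3 = (if w i = 0 then s2 else setr ''W'' (Suc (regs s2 ''W'')) (seta ''W'' (regs s2 ''W'') i s2))"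
      define s4 where "s4 = setr ''E'' (Suc (regs s3 ''E'')) (seta ''E2'' (regs s3 ''E'') (lf i) (seta ''E1'' (regs s3 ''E'') i s3))"
      have "out_set ''V'' s2 = insert i (out_set ''V'' s')" by (rule out_set_snoc) (auto simp: s2_def)
      moreover have "out_set ''V'' s3 = out_set ''V'' s2" by (rule out_set_cong) (auto simp: s3_def)
      moreover have "out_set ''W'' s2 = out_set ''W'' s'" by (rule out_set_cong) (auto simp: s2_def)
      moreover have "out_set ''W'' s3 = (if w i = 0 then out_set ''W'' s2 else insert i (out_set ''W'' s2))"
        by (cases "w i = 0") (auto simp: s3_def intro!: out_set_snoc)
      moreover have "out_set ''V'' s4 = out_set ''V'' s3" "out_set ''W'' s4 = out_set ''W'' s3"
        by (rule out_set_cong; simp add: s4_def)+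
      moreover have "out_edges s3 = out_edges s'" by (rule out_edges_cong) (auto simp: s3_def s2_def)
      moreover have "out_edges s4 = insert {i, lf i} (out_edges s3)" by (rule out_edges_snoc) (auto simp: s4_def)
      ultimately have o: "out_set ''V'' s4 = insert i (out_set ''V'' s')"
          "out_set ''W'' s4 = (if w i = 0 then out_set ''W'' s' else insert i (out_set ''W'' s'))"
          "out_edges s4 = insert {i, lf i} (out_edges s')" by simp_all
      have a4: "arrs s4 ''x'' = x" "arrs s4 ''lb'' = lb'" "arrs s4 ''w'' = w" "arrs s4 ''lf'' = lf"
          "nz (arrs s4 ''kf'') = nz (arrs s' ''kf'')"
        by (simp_all add: s4_def s3_def s2_def ar)
      have "P (Suc i) s4"
        unfolding P_def KS HS BS a4 o using P kept unfolding P_def by (simp add: Wi)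
      moreover have "\<not> (x i = 0 \<and> lb' i = 2)" "lb' i < 2" "0 < arrs s' ''kf'' i"
        using kept mem[OF i(2)] lbK kfi by auto
      ultimately show ?thesis using i r ar unfolding Append_def Emit_def s4_def s3_def s2_def
        by (cases "w i = 0") simp_all
    next
      case none
      then have "P (Suc i) s'" using P unfolding P_def KS HS BS by simp
      moreover have "\<not> (x i = 0 \<and> lb' i = 2)" "arrs s' ''kf'' i = 0"
        using none mem[OF i(2)] kfi by auto
      ultimately show ?thesis using i r ar by auto
    qed
    then show "2 \<le> k' \<and> wp ?b (?I (Suc i)) (k' - 2) s'" using r by simp
  qed (use n k in \<open>auto simp: Append_def Emit_def\<close>)
  then show ?thesis
  proof (rule wp_frame, goal_cases)
    case (1 k' s')
    have P: "P n s'" using 1 by blast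
    have lt: "K \<subseteq> {..<n}" "H \<subseteq> {..<n}" using KA by (auto simp: H_def hubset_def alive_def)
    have e: "{v \<in> K \<union> H. v < n} = K \<union> H" "{v \<in> H. v < n} = H" "{v \<in> K. v < n} = K" using lt by auto
    show ?case
    proof (rule Q)
      show "c \<le> k'" using 1 by blast
      show "regs s' x = regs s x" if "x \<notin> {''i'', ''V'', ''W'', ''E''}" for x
        using 1(2)[of x] that by (auto simp: OutV_def Loop_def Emit_def Append_def)
      show "arrs s' x = arrs s x" if "x \<notin> {''kf'', ''V'', ''W'', ''E1'', ''E2''}" for x
        using 1(3)[of x] that by (auto simp: OutV_def Loop_def Emit_def Append_def)
    qed (use P[unfolded P_def e] in \<open>simp_all add: K_def H_def w_def lf_def\<close>)
  qed
qed

end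

section \<open>The kernel and its size\<close>

context graph_input begin

lemma card_hub_edges:
  assumes A: "A \<subseteq> {0..<n}" and H: "H \<subseteq> A"
  shows "card {e \<in> E. e \<subseteq> H} \<le> (\<Sum>v\<in>H. card (N v \<inter> A))"
proof -
  have fA: "finite A" "finite H" using finite_subset[OF A] finite_subset[OF H] by auto
  have "{e \<in> E. e \<subseteq> H} \<subseteq> (\<Union>v\<in>H. (\<lambda>y. {v, y}) ` (N v \<inter> A))"
  proof
    fix e assume e: "e \<in> {e \<in> E. e \<subseteq> H}"
    then obtain a b where "e = {a, b}" using simple_graph_edge[OF sg] by blast
    then show "e \<in> (\<Union>v\<in>H. (\<lambda>y. {v, y}) ` (N v \<inter> A))" using e H by (auto simp: nbh_def)
  qed
  then have "card {e \<in> E. e \<subseteq> H} \<le> card (\<Union>v\<in>H. (\<lambda>y. {v, y}) ` (N v \<inter> A))"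
    by (rule card_mono[rotated]) (use fA in auto)
  also have "\<dots> \<le> (\<Sum>v\<in>H. card ((\<lambda>y. {v, y}) ` (N v \<inter> A)))" using card_UN_le[OF fA(2)] .
  also have "\<dots> \<le> (\<Sum>v\<in>H. card (N v \<inter> A))" by (rule sum_mono) (use fA in \<open>auto intro: card_image_le\<close>)
  finally show ?thesis .
qed

text \<open>What a finished run of \<open>Kernelize\<close> provides for both purposes: the kernel
  with its size bound, and the log with the array \<open>s\<close> for the lift.\<close>

definition kernel_ok :: "nat \<Rightarrow> store \<Rightarrow> bool" where
  "kernel_ok f s \<longleftrightarrow> regs s ''n'' = n \<and> out_set ''V'' s = nz (arrs s ''kf'') \<and> nz (arrs s ''kf'') \<subseteq> {0..<n} \<and>
     rds_instance (nz (arrs s ''kf'')) (out_edges s) (out_set ''W'' s) \<and>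
     reduction {0..<n} E {} (nz (arrs s ''kf'')) (out_edges s) (out_set ''W'' s)
       (\<lambda>D. foldr lstep (lgs s) D \<union> nz (arrs s ''s'')) \<and>
     nz (arrs s ''s'') \<subseteq> {0..<n} \<and> card (nz (arrs s ''kf'')) + card (out_edges s) \<le> 200 * f"

lemma wp_output:
  assumes b: "binv A W F H s" and F: "feedback_edge_set E F" and AH: "A - nz (arrs s ''vis'') = H"
    and W: "W = nz (arrs s ''w'')" and d: "\<And>v. v \<in> A \<Longrightarrow> 2 \<le> card (N v \<inter> A)"
    and red: "reduction {0..<n} E {} A (ind E A) W (\<lambda>D. D \<union> nz (arrs s ''s''))"
    and S: "nz (arrs s ''s'') \<subseteq> {0..<n}" and z: "regs s ''V'' = 0" "regs s ''W'' = 0"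
    and k: "8 * length es + 14 * n + 4 \<le> k"
  shows "wp HubEdges (wp OutV (\<lambda>k' s'. kernel_ok (card F) s')) k s"
proof -
  let ?Vis = "nz (arrs s ''vis'')" and ?K = "nz (arrs s ''kf'')"
  interpret c0: core n es A W H "arrs s ''lb''" using b by (simp add: binv_def)
  have ok: "adj_ok s" and al: "alive s = A" and h3: "hubs3 A \<subseteq> H"
    and kv: "kinv E A W H ?Vis ?K (arrs s ''lf'') (out_edges s) (lgs s)"
    and cF: "card (H - hubs3 A) \<le> card {f \<in> F. f \<subseteq> ?Vis \<union> H}"
    using b by (auto simp: binv_def)
  obtain w where w: "card ?K \<le> 10 * w" "regs s ''E'' \<le> w" "w \<le> (\<Sum>v\<in>H. card (N v \<inter> A))"
    using b by (auto simp: binv_def)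
  have kb: "kbase A H ?Vis ?K (arrs s ''lf'') (out_edges s)"
    and r2: "reduction A (ind E A) W (curV A ?Vis ?K) (curE E A ?Vis ?K (arrs s ''lf'') (out_edges s)) W (foldr lstep (lgs s))"
    using kv by (auto simp: kinv_def)
  note kb' = kbaseD[OF kb]
  have hub: "hubset s = H"
    unfolding hubset_def al using c0.lab c0.HA by (auto simp: labels_def split: if_splits)
  \<comment> \<open>Only hubs are unvisited after the second pass, so the current graph consists of
    them and the kept vertices.\<close>
  have V': "curV A ?Vis ?K = ?K \<union> H" using AH by (auto simp: curV_def)
  have E': "curE E A ?Vis ?K (arrs s ''lf'') (out_edges s) =
      out_edges s \<union> {e \<in> E. e \<subseteq> H} \<union> (\<lambda>x. {x, arrs s ''lf'' x}) ` ?K"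
  proof -
    have "{e \<in> ind E A. e \<inter> ?Vis = {}} = {e \<in> E. e \<subseteq> H}" using AH c0.HA by (auto simp: ind_def)
    then show ?thesis unfolding curE_def by auto
  qed
  have fA: "finite A" by (rule c0.finA)
  have KA: "?K \<subseteq> A" using kb' by blast
  have fF: "finite F" using F simple_graph_finite[OF sg] finite_subset by (auto simp: feedback_edge_set_def)
  have "card {f \<in> F. f \<subseteq> ?Vis \<union> H} \<le> card F" by (rule card_mono) (use fF in auto)
  then have "card (H - hubs3 A) \<le> card F" using cF by linarith
  note sz = size_core[OF F c0.AV d h3 c0.HA this]
  let ?E' = "out_edges s \<union> {e \<in> E. e \<subseteq> H} \<union> (\<lambda>x. {x, arrs s ''lf'' x}) ` ?K"
  \<comment> \<open>With \<open>f = card F\<close> and \<open>w\<close> at most \<open>8 f\<close>: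
    at most \<open>80 f\<close> kept vertices and \<open>3 f\<close> hubs; at most
    \<open>8 f\<close> closing edges, \<open>8 f\<close> edges between hubs and \<open>80 f\<close>
    predecessor edges. The total \<open>179 f\<close> is below \<open>200 f\<close>.\<close>
  have size: "card (?K \<union> H) + card ?E' \<le> 200 * card F"
  proof -
    have "card (?K \<union> H) \<le> card ?K + card H" by (rule card_Un_le)
    moreover have "card ?E' \<le> card (out_edges s) + card {e \<in> E. e \<subseteq> H} + card ((\<lambda>x. {x, arrs s ''lf'' x}) ` ?K)"
      using card_Un_le[of "out_edges s \<union> {e \<in> E. e \<subseteq> H}" "(\<lambda>x. {x, arrs s ''lf'' x}) ` ?K"]
        card_Un_le[of "out_edges s" "{e \<in> E. e \<subseteq> H}"] by linarith
    moreover have "card (out_edges s) \<le> regs s ''E''"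
      unfolding out_edges_def by (rule order_trans[OF card_image_le]) auto
    moreover have "card ((\<lambda>x. {x, arrs s ''lf'' x}) ` ?K) \<le> card ?K"
      by (rule card_image_le[OF finite_subset[OF KA fA]])
    ultimately show ?thesis using w sz card_hub_edges[OF c0.AV c0.HA] by linarith
  qed
  have sg': "simple_graph (?K \<union> H) ?E'"
    unfolding simple_graph_def
  proof (intro conjI ballI)
    show "finite (?K \<union> H)" using finite_subset[OF KA fA] finite_subset[OF c0.HA fA] by simp
    fix e assume "e \<in> ?E'"
    then consider "e \<in> out_edges s" | "e \<in> E" "e \<subseteq> H" | y where "y \<in> ?K" "e = {y, arrs s ''lf'' y}" by blast
    then show "e \<subseteq> ?K \<union> H" "card e = 2"
    proof (atomize(full), cases)
      case 1
      then show "e \<subseteq> ?K \<union> H \<and> card e = 2" using kb'(5) by blast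
    next
      case 2
      then show "e \<subseteq> ?K \<union> H \<and> card e = 2" using sg unfolding simple_graph_def by blast
    next
      case (3 y)
      have "arrs s ''lf'' y \<in> ?K \<union> H" "y \<noteq> arrs s ''lf'' y" using kb'(4)[OF 3(1)] by auto
      then show "e \<subseteq> ?K \<union> H \<and> card e = 2" using 3 by simp
    qed
  qed
  have KH: "?K \<union> H \<subseteq> {0..<n}" using KA c0.HA c0.AV by blast
  have rd: "reduction {0..<n} E {} (?K \<union> H) ?E' ((?K \<union> H) \<inter> W) (\<lambda>D. foldr lstep (lgs s) D \<union> nz (arrs s ''s''))"
    using reduction_cong_free[OF reduction_trans[OF red r2], of "(?K \<union> H) \<inter> W"] unfolding V' E' by blast
  show ?thesis
  proof (rule wp_HubEdges[OF ok, where c = "14 * n + 2"])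
    fix k1 s1 assume k1: "14 * n + 2 \<le> k1" and e1: "out_edges s1 = out_edges s \<union> {e \<in> E. e \<subseteq> hubset s}"
      and f: "\<And>x. x \<notin> {''i'', ''u'', ''v'', ''E''} \<Longrightarrow> regs s1 x = regs s x"
      and g: "\<And>a. a \<notin> {''E1'', ''E2''} \<Longrightarrow> arrs s1 a = arrs s a"
    have al1: "alive s1 = A" using alive_cong[of s1 s] g al by simp
    have hub1: "hubset s1 = H" using hub al al1 g by (simp add: hubset_def)
    show "wp OutV (\<lambda>k' s'. kernel_ok (card F) s') k1 s1"
    proof (rule wp_OutV[where c = 0])
      show "nz (arrs s1 ''kf'') \<subseteq> alive s1 - hubset s1" unfolding al1 hub1 using kb' g by auto
      show "arrs s1 ''lb'' v < 2" if "v \<in> alive s1 - hubset s1" for v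
        using that c0.L2[of v] g unfolding al1 hub1 by simp
      fix k2 s2
      assume a: "nz (arrs s2 ''kf'') = nz (arrs s1 ''kf'') \<union> hubset s1"
        "out_set ''V'' s2 = nz (arrs s1 ''kf'') \<union> hubset s1"
        "out_set ''W'' s2 = (nz (arrs s1 ''kf'') \<union> hubset s1) \<inter> nz (arrs s1 ''w'')"
        "out_edges s2 = out_edges s1 \<union> (\<lambda>x. {x, arrs s1 ''lf'' x}) ` nz (arrs s1 ''kf'')"
        and f2: "\<And>x. x \<notin> {''i'', ''V'', ''W'', ''E''} \<Longrightarrow> regs s2 x = regs s1 x"
        and g2: "\<And>a. a \<notin> {''kf'', ''V'', ''W'', ''E1'', ''E2''} \<Longrightarrow> arrs s2 a = arrs s1 a"
      have kf: "nz (arrs s2 ''kf'') = ?K \<union> H" "out_set ''V'' s2 = ?K \<union> H" "out_set ''W'' s2 = (?K \<union> H) \<inter> W"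
        "out_edges s2 = ?E'" using a e1 hub hub1 g W by simp_all
      have lg: "lgs s2 = lgs s" by (rule lgs_cong) (auto simp: f f2 g g2)
      have s: "arrs s2 ''s'' = arrs s ''s''" "regs s2 ''n'' = n" using f f2 g g2 ok by (simp_all add: adj_ok_def)
      show "kernel_ok (card F) s2" unfolding kernel_ok_def kf lg s
        using KH sg' rd S size by (simp add: rds_instance_def)
    qed (use k1 f z ok in \<open>simp_all add: adj_ok_def\<close>)
  qed (use k in simp)
qed

text \<open>The phases together need at most \<open>109 n + 142 m + 19\<close> steps, where
  \<open>m\<close> is the length of \<open>es\<close>.\<close>

lemma wp_Kernelize:
  assumes F: "feedback_edge_set E F" and k: "150 * (n + length es) + 150 \<le> k"
  shows "wp Kernelize (\<lambda>k' s'. kernel_ok (card F) s') k (input n es [])"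
  unfolding Kernelize_def seqs.simps wp_Seq_fun
proof (rule wp_Build[OF refl])
  let ?s0 = "input n es []"
  show "14 * length es + 3 \<le> k" using k by simp
  fix k1 s1 assume k1: "k \<le> k1 + 14 * length es + 3" and ok1: "adj_ok s1" and dg1: "\<forall>v. arrs s1 ''dg'' v = length (nb v)"
    and f1: "\<And>x. x \<notin> wregs Build \<Longrightarrow> regs s1 x = regs ?s0 x" "\<And>a. a \<notin> warrs Build \<Longrightarrow> arrs s1 a = arrs ?s0 a"
  have z1: "arrs s1 a = (\<lambda>_. 0)" if "a \<in> {''x'', ''w'', ''s'', ''vis'', ''kf''}" for a
    using f1(2)[of a] that by (auto simp: Build_def Loop_def input_def)
  have r1: "regs s1 x = 0" if "x \<in> {''E'', ''ln'', ''V'', ''W''}" for x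
    using f1(1)[of x] that by (auto simp: Build_def Loop_def input_def)
  show "wp Strip (wp Label (wp PassA (wp PassB (wp HubEdges (wp OutV (\<lambda>k' s'. kernel_ok (card F) s')))))) k1 s1"
  proof (rule wp_Strip[OF ok1 dg1])
    show "20 * n + 20 * length es + 6 \<le> k1" using k k1 by simp
    fix k2 s2 assume k2: "k1 \<le> k2 + (20 * n + 20 * length es + 6)" and inv: "sinv s2"
      and d: "\<forall>v\<in>alive s2. 2 \<le> card (N v \<inter> alive s2)"
      and f2: "\<And>x. x \<notin> wregs Strip \<Longrightarrow> regs s2 x = regs s1 x" "\<And>a. a \<notin> warrs Strip \<Longrightarrow> arrs s2 a = arrs s1 a"
    define A W where "A = alive s2" and "W = nz (arrs s2 ''w'')"
    have z2: "arrs s2 a = (\<lambda>_. 0)" if "a \<in> {''vis'', ''kf''}" for a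
      using f2(2)[of a] z1[of a] that by (auto simp: Strip_def StripB_def Kill_def KillB_def mark_def ForNb_def Loop_def)
    have r2: "regs s2 x = 0" if "x \<in> {''E'', ''ln'', ''V'', ''W''}" for x
      using f2(1)[of x] r1[of x] that by (auto simp: Strip_def StripB_def Kill_def KillB_def mark_def ForNb_def Loop_def)
    have AV: "A \<subseteq> {0..<n}" by (auto simp: A_def alive_def)
    let ?c = "8 * length es + 14 * n + 4"
    have pwle: "pwA A {} \<le> 50 * n + 20 * length es"
    proof -
      have "pwA A {} \<le> (\<Sum>v\<in>{0..<n}. 50 + 10 * length (nb v))"
        unfolding pwA_def by (rule sum_mono2) (use AV in auto)
      also have "\<dots> = 50 * n + 10 * (\<Sum>v\<in>{0..<n}. length (nb v))"
        by (simp add: sum.distrib sum_distrib_left)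
      finally show ?thesis using sum_nb by linarith
    qed
    show "wp Label (wp PassA (wp PassB (wp HubEdges (wp OutV (\<lambda>k' s'. kernel_ok (card F) s'))))) k2 s2"
    proof (rule wp_Label[OF inv, where c = "pwA A {} + pot2 0 + 2 + (pot2 0 + 2 + ?c)"])
      show "5 * n + 2 + (pwA A {} + pot2 0 + 2 + (pot2 0 + 2 + ?c)) \<le> k2"
        using k[unfolded distrib_left] k1 k2 pwle pot2_le by linarith
      fix k3 s3 assume k3: "pwA A {} + pot2 0 + 2 + (pot2 0 + 2 + ?c) \<le> k3"
        and lb: "\<forall>v\<in>alive s2. arrs s3 ''lb'' v = (if v \<in> hubs3 (alive s2) then 2 else arrs s2 ''w'' v)"
        and f3: "\<And>x. x \<noteq> ''i'' \<Longrightarrow> regs s3 x = regs s2 x" "\<And>a. a \<noteq> ''lb'' \<Longrightarrow> arrs s3 a = arrs s2 a"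
      have w1: "arrs s2 ''w'' v \<le> 1" for v using inv by (simp add: sinv_def)
      have wv: "arrs s2 ''w'' v = (if v \<in> W then 1 else 0)" for v
        using w1[of v] by (simp add: W_def nz_def)
      interpret c0: core n es A W "hubs3 A" "arrs s3 ''lb''"
      proof
        show "A \<subseteq> {0..<n}" by (rule AV)
        show "hubs3 A \<subseteq> A" by (auto simp: hubs3_def)
        show "labels A (hubs3 A) W (arrs s3 ''lb'')" using lb wv by (simp add: labels_def A_def)
        fix v assume v: "v \<in> A" "v \<notin> hubs3 A"
        have "2 \<le> card (N v \<inter> A)" using d v by (simp add: A_def)
        then show "card (N v \<inter> A) = 2" using v by (simp add: hubs3_def)
      qed
      have pw: "c0.pw = pwA A" by (simp add: fun_eq_iff c0.pw_def pwA_def)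
      have nz0: "nz (\<lambda>_. 0) = {}" by (simp add: nz_def)
      have vis3: "nz (arrs s3 ''vis'') = {}" "nz (arrs s3 ''kf'') = {}" using f3 z2 nz0 by simp_all
      have al3: "alive s3 = A" using alive_cong[of s3 s2] f3 by (simp add: A_def)
      have ok3: "adj_ok s3"
      proof -
        have "adj_ok s2" using inv by (simp add: sinv_def)
        then show ?thesis by (rule adj_ok_cong) (auto simp: f3)
      qed
      have oe: "out_edges s3 = {}" "lgs s3 = []" using f3 r2 by (simp_all add: out_edges_def lgs_def lg_def)
      show "wp PassA (wp PassB (wp HubEdges (wp OutV (\<lambda>k' s'. kernel_ok (card F) s')))) k3 s3"
      proof (rule wp_frame[OF c0.wp_PassA[where Q = "\<lambda>k' s'. c0.wok s' \<and> c0.kst s' \<and>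
            (\<exists>w. c0.kcnt s' w \<and> w \<le> (\<Sum>v\<in>hubs3 A. card (N v \<inter> A))) \<and>
            (\<forall>v\<in>hubs3 A. N v \<inter> A \<subseteq> nz (arrs s' ''vis'') \<union> hubs3 A) \<and>
            c0.pw (nz (arrs s' ''vis'')) + (pot2 0 + 2 + ?c) \<le> k'"]])
        show "c0.wok s3" using ok3 al3 by (simp add: c0.wok_def)
        show "c0.kst s3" using kinv_init[OF c0.HA] by (simp add: c0.kst_def vis3 oe)
        show "c0.kcnt s3 0" using vis3 f3 r2 by (simp add: c0.kcnt_def)
        show "c0.pw (nz (arrs s3 ''vis'')) + pot2 0 + 2 + (pot2 0 + 2 + ?c) \<le> k3" using k3 by (simp add: vis3 pw)
      next
        fix k4 s4 assume a: "c0.wok s4 \<and> c0.kst s4 \<and> (\<exists>w. c0.kcnt s4 w \<and> w \<le> (\<Sum>v\<in>hubs3 A. card (N v \<inter> A))) \<and>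
            (\<forall>v\<in>hubs3 A. N v \<inter> A \<subseteq> nz (arrs s4 ''vis'') \<union> hubs3 A) \<and>
            c0.pw (nz (arrs s4 ''vis'')) + (pot2 0 + 2 + ?c) \<le> k4"
          and f4: "\<And>x. x \<notin> wregs PassA \<Longrightarrow> regs s4 x = regs s3 x" "\<And>a. a \<notin> warrs PassA \<Longrightarrow> arrs s4 a = arrs s3 a"
        have b4: "binv A W F (hubs3 A) s4"
          unfolding binv_def using a c0.core_axioms by (auto simp: c0.wok_def c0.kst_def c0.kcnt_def)
        show "wp PassB (wp HubEdges (wp OutV (\<lambda>k' s'. kernel_ok (card F) s'))) k4 s4"
        proof (rule wp_frame[OF wp_PassB[OF b4 F, where c = ?c and Q = "\<lambda>k' s'. ?c \<le> k' \<and>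
            (\<exists>H. binv A W F H s' \<and> A - nz (arrs s' ''vis'') = H)"]])
          show "pwA A (nz (arrs s4 ''vis'')) + pot2 0 + 2 + ?c \<le> k4" using a by (simp add: pw)
        next
          fix k5 s5 assume a5: "?c \<le> k5 \<and> (\<exists>H. binv A W F H s5 \<and> A - nz (arrs s5 ''vis'') = H)"
            and f5: "\<And>x. x \<notin> wregs PassB \<Longrightarrow> regs s5 x = regs s4 x" "\<And>a. a \<notin> warrs PassB \<Longrightarrow> arrs s5 a = arrs s4 a"
          obtain H where H: "binv A W F H s5" "A - nz (arrs s5 ''vis'') = H" using a5 by blast
          note defs = PassA_def PassB_def ProcHub_def Walk_def WalkB_def FindNext_def PrePop_def Push_def
            PostPop_def Del_def Log_def ForNb_def Loop_def
          have e: "arrs s5 a = arrs s2 a" if "a \<in> {''w'', ''s''}" for a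
            using f5(2)[of a] f4(2)[of a] f3(2)[of a] that by (auto simp: defs)
          have r5: "regs s5 x = 0" if "x \<in> {''V'', ''W''}" for x
            using f5(1)[of x] f4(1)[of x] f3(1)[of x] r2[of x] that by (auto simp: defs)
          show "wp HubEdges (wp OutV (\<lambda>k' s'. kernel_ok (card F) s')) k5 s5"
          proof (rule wp_output[OF H(1) F H(2)])
            show "W = nz (arrs s5 ''w'')" using e by (simp add: W_def)
            show "2 \<le> card (N v \<inter> A)" if "v \<in> A" for v using d that by (simp add: A_def)
            show "reduction {0..<n} E {} A (ind E A) W (\<lambda>D. D \<union> nz (arrs s5 ''s''))"
              using inv e by (simp add: sinv_def A_def W_def)
            show "nz (arrs s5 ''s'') \<subseteq> {0..<n}" using inv e by (simp add: sinv_def)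
          qed (use r5 a5 in auto)
        qed blast
      qed blast
    qed
  qed (use z1 in auto)
qed


section \<open>Lifting a dominating set of the kernel\<close>

lemma wp_MarkD:
  assumes d: "regs s ''d'' = length ds" "arrs s ''D'' = array_of ds" and t: "arrs s ''t'' = (\<lambda>_. 0)"
    and k: "3 * length ds + 2 + c \<le> k"
    and Q: "\<And>k' s'. c \<le> k' \<Longrightarrow> nz (arrs s' ''t'') = set ds \<Longrightarrow>
      (\<And>x. x \<noteq> ''i'' \<Longrightarrow> regs s' x = regs s x) \<Longrightarrow> (\<And>a. a \<noteq> ''t'' \<Longrightarrow> arrs s' a = arrs s a) \<Longrightarrow> Q k' s'"
  shows "wp MarkD Q k s"
proof -
  let ?I = "\<lambda>i k' s'. 3 * (length ds - i) + 1 + c \<le> k' \<and> arrs s' ''D'' = array_of ds \<and> nz (arrs s' ''t'') = set (take i ds)"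
  have "wp MarkD (\<lambda>k' s'. c \<le> k' \<and> nz (arrs s' ''t'') = set ds) k s"
    unfolding MarkD_def
  proof (rule wp_Loop[where I = ?I and N = "length ds"])
    fix i k' s' assume I: "?I i k' s'" and i: "regs s' ''i'' = i" "i < length ds"
    obtain r where r: "k' = 4 + 3 * (length ds - Suc i) + c + r"
    proof -
      have "3 * (length ds - i) = 3 + 3 * (length ds - Suc i)" using i by simp
      then have "4 + 3 * (length ds - Suc i) + c \<le> k'" using I by linarith
      then show ?thesis using that le_Suc_ex by blast
    qed
    have "set (take (Suc i) ds) = insert (ds ! i) (set (take i ds))"
      using take_Suc_conv_app_nth[OF i(2)] by simp
    then show "2 \<le> k' \<and> wp (Store ''t'' (Arr ''D'' (Reg ''i'')) (Const 1)) (?I (Suc i)) (k' - 2) s'"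
      using I i r by (simp add: array_of_def)
  qed (use d t k in \<open>auto simp: nz_def\<close>)
  then show ?thesis
  proof (rule wp_frame, goal_cases)
    case (1 k' s')
    show ?case
    proof (rule Q)
      show "regs s' x = regs s x" if "x \<noteq> ''i''" for x
        using 1(2)[of x] that by (auto simp: MarkD_def Loop_def)
      show "arrs s' x = arrs s x" if "x \<noteq> ''t''" for x
        using 1(3)[of x] that by (auto simp: MarkD_def Loop_def)
    qed (use 1(1) in auto)
  qed
qed

text \<open>The record at position \<open>ln - 1\<close> is the innermost one of
  \<open>foldr\<close>; a round applies it to the set marked in \<open>t\<close> and shortens the
  log.\<close>

lemma wp_Undo:
  assumes D: "nz (arrs s ''t'') = D" and k: "5 * regs s ''ln'' + 1 + c \<le> k"
    and Q: "\<And>k' s'. c \<le> k' \<Longrightarrow> nz (arrs s' ''t'') = foldr lstep (lgs s) D \<Longrightarrow>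
      (\<And>x. x \<noteq> ''ln'' \<Longrightarrow> regs s' x = regs s x) \<Longrightarrow> (\<And>a. a \<noteq> ''t'' \<Longrightarrow> arrs s' a = arrs s a) \<Longrightarrow> Q k' s'"
  shows "wp Undo Q k s"
proof -
  let ?b = "Seq (Assign ''ln'' (Dec (Reg ''ln'')))
     (Cond (Less (Const 0) (Arr ''t'' (Arr ''lp'' (Reg ''ln'')))) (Store ''t'' (Arr ''la'' (Reg ''ln'')) (Const 1))
       (Cond (Less (Const 0) (Arr ''t'' (Arr ''lz'' (Reg ''ln'')))) (Store ''t'' (Arr ''lB'' (Reg ''ln'')) (Const 1))
         (Store ''t'' (Arr ''lc'' (Reg ''ln'')) (Const 1))))"
  let ?l = "\<lambda>s. lg (arrs s ''lp'') (arrs s ''lz'') (arrs s ''la'') (arrs s ''lB'') (arrs s ''lc'') (regs s ''ln'')"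
  let ?J = "\<lambda>k' s'. 5 * regs s' ''ln'' + 1 + c \<le> k' \<and> foldr lstep (?l s') (nz (arrs s' ''t'')) = foldr lstep (lgs s) D"
  have "wp Undo (\<lambda>k' s'. c \<le> k' \<and> nz (arrs s' ''t'') = foldr lstep (lgs s) D) k s"
    unfolding Undo_def
  proof (rule wp_While[where I = ?J])
    show "?J k s" using D k by (simp add: lgs_def)
  next
    fix k' s' assume J: "?J k' s'" and "eval_test (Less (Const 0) (Reg ''ln'')) s'"
    then obtain j where j: "regs s' ''ln'' = Suc j" by (auto simp: gr0_conv_Suc)
    obtain r where r: "k' = 6 + 5 * j + c + r"
    proof -
      have "6 + 5 * j + c \<le> k'" using J j by simp
      then show ?thesis using that le_Suc_ex by blast
    qed
    let ?t = "arrs s' ''t''"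
    have m: "x \<in> nz ?t \<longleftrightarrow> 0 < ?t x" for x by (simp add: nz_def)
    have "?l s' = lg (arrs s' ''lp'') (arrs s' ''lz'') (arrs s' ''la'') (arrs s' ''lB'') (arrs s' ''lc'') j @
        [(arrs s' ''lp'' j, arrs s' ''lz'' j, arrs s' ''la'' j, arrs s' ''lB'' j, arrs s' ''lc'' j)]"
      using j by (simp add: lg_def)
    then have "foldr lstep (lg (arrs s' ''lp'') (arrs s' ''lz'') (arrs s' ''la'') (arrs s' ''lB'') (arrs s' ''lc'') j)
        (insert (if 0 < ?t (arrs s' ''lp'' j) then arrs s' ''la'' j else if 0 < ?t (arrs s' ''lz'' j) then arrs s' ''lB'' j
          else arrs s' ''lc'' j) (nz ?t)) = foldr lstep (lgs s) D"
      using J m by (cases "0 < ?t (arrs s' ''lp'' j)"; cases "0 < ?t (arrs s' ''lz'' j)") simp_all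
    then show "wp ?b ?J (k' - 1) s'"
      using j r by (cases "0 < ?t (arrs s' ''lp'' j)"; cases "0 < ?t (arrs s' ''lz'' j)") simp_all
  next
    fix k' s' assume "?J k' s'" "\<not> eval_test (Less (Const 0) (Reg ''ln'')) s'"
    then show "c \<le> k' - 1 \<and> nz (arrs s' ''t'') = foldr lstep (lgs s) D" by (auto simp: lg_def)
  qed simp
  then show ?thesis
  proof (rule wp_frame, goal_cases)
    case (1 k' s')
    show ?case
    proof (rule Q)
      show "regs s' x = regs s x" if "x \<noteq> ''ln''" for x
        using 1(2)[of x] that by (auto simp: Undo_def)
      show "arrs s' x = arrs s x" if "x \<noteq> ''t''" for x
        using 1(3)[of x] that by (auto simp: Undo_def)
    qed (use 1(1) in auto)
  qed
qed

lemma wp_OutS: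
  assumes n: "regs s ''n'' = n" and z: "regs s ''S'' = 0" and k: "6 * n + 2 \<le> k"
  shows "wp OutS (\<lambda>k' s'. out_set ''S'' s' =
    {v. v < n \<and> v \<notin> nz (arrs s ''kf'') \<and> v \<in> nz (arrs s ''s'') \<union> nz (arrs s ''t'')}) k s"
proof -
  define R where "R = {v. v \<notin> nz (arrs s ''kf'') \<and> v \<in> nz (arrs s ''s'') \<union> nz (arrs s ''t'')}"
  define kf sl t where "kf = arrs s ''kf''" and "sl = arrs s ''s''" and "t = arrs s ''t''"
  have m: "v \<in> R \<longleftrightarrow> kf v = 0 \<and> (sl v \<noteq> 0 \<or> t v \<noteq> 0)" for v
    by (auto simp: R_def nz_def kf_def sl_def t_def)
  let ?I = "\<lambda>i k' s'. 6 * (n - i) + 1 \<le> k' \<and> arrs s' ''kf'' = kf \<and> arrs s' ''s'' = sl \<and> arrs s' ''t'' = t \<and>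
    out_set ''S'' s' = {v \<in> R. v < i}"
  have "wp OutS (\<lambda>k' s'. out_set ''S'' s' = {v \<in> R. v < n}) k s"
    unfolding OutS_def
  proof (rule wp_Loop[where I = ?I and N = n])
    fix i k' s' assume I: "?I i k' s'" and i: "regs s' ''i'' = i" "i < n"
    obtain r where r: "k' = 7 + 6 * (n - Suc i) + r"
    proof -
      have "6 * (n - i) = 6 + 6 * (n - Suc i)" using i by simp
      then have "7 + 6 * (n - Suc i) \<le> k'" using I by linarith
      then show ?thesis using that le_Suc_ex by blast
    qed
    have RS: "{v \<in> R. v < Suc i} = (if i \<in> R then insert i {v \<in> R. v < i} else {v \<in> R. v < i})"
      by (auto simp: less_Suc_eq)
    let ?s = "setr ''S'' (Suc (regs s' ''S'')) (seta ''S'' (regs s' ''S'') i s')"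
    have o: "out_set ''S'' ?s = insert i (out_set ''S'' s')" by (rule out_set_snoc) auto
    show "2 \<le> k' \<and> wp (Cond (Conj (EqT (Arr ''kf'' (Reg ''i'')) (Const 0))
     (Neg (Conj (EqT (Arr ''s'' (Reg ''i'')) (Const 0)) (EqT (Arr ''t'' (Reg ''i'')) (Const 0)))))
     (Append ''S'') Skip) (?I (Suc i)) (k' - 2) s'"
    proof (cases "i \<in> R")
      case True
      then have "kf i = 0 \<and> (sl i \<noteq> 0 \<or> t i \<noteq> 0)" using m by blast
      then show ?thesis using I i r o RS True unfolding Append_def by auto
    next
      case False
      then consider "kf i \<noteq> 0" | "sl i = 0" "t i = 0" using m[of i] by metis
      then show ?thesis by cases (use I i r RS False in simp_all)
    qed
  next
    fix i k' s' x assume I: "?I i k' s'"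
    have "out_set ''S'' (setr ''i'' x s') = out_set ''S'' s'" by (rule out_set_cong) auto
    then show "?I i k' (setr ''i'' x s')" using I by simp
  qed (use n z k in \<open>auto simp: kf_def sl_def t_def out_set_def Append_def\<close>)
  moreover have "{v \<in> R. v < n} = {v. v < n \<and> v \<notin> nz (arrs s ''kf'') \<and> v \<in> nz (arrs s ''s'') \<union> nz (arrs s ''t'')}"
    by (auto simp: R_def)
  ultimately show ?thesis by simp
qed

end

section \<open>Joining the kernel and the lift\<close>

lemmas prog_defs = Kernelize_def Build_def Strip_def StripB_def Kill_def KillB_def mark_def Label_def PassA_def PassB_def
  ProcHub_def Walk_def WalkB_def FindNext_def PrePop_def Push_def PostPop_def Del_def Log_def Lab_def EqT_def
  HubEdges_def OutV_def Emit_def Append_def ForNb_def Loop_def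

text \<open>The given dominating set neither influences \<open>Kernelize\<close> nor is overwritten
  by it, the log is no longer than the run, and \<open>t\<close> and \<open>S\<close> are still
  fresh afterwards.\<close>

lemma Kernelize_ignores:
  "rregs Kernelize \<inter> {''d''} = {}" "rarrs Kernelize \<inter> {''D''} = {}" "only_inc ''ln'' Kernelize"
  "''d'' \<notin> wregs Kernelize" "''D'' \<notin> warrs Kernelize" "''t'' \<notin> warrs Kernelize" "''S'' \<notin> wregs Kernelize"
  by (simp_all add: prog_defs)

theorem theorem33:
  "\<exists>(P :: prog) (Q :: prog) (a :: nat) (c :: nat).
     \<forall>(n :: nat) (es :: (nat \<times> nat) list) (k :: nat).
       graph_code n es \<and> feedback_edge_set_number (edges_of es) = k \<longrightarrow>
       (\<exists>V' E' W'.
          kernelizes P (a * (n + length es) + a) n es V' E' W' \<and>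
          reduces_to Q (a * (n + length es) + a) n es V' E' W' \<and>
          card V' + card E' \<le> c * k)"
proof (rule exI[of _ Kernelize], rule exI[of _ Complete], rule exI[of _ 1000], rule exI[of _ 200],
    intro allI impI, elim conjE)
  fix n es k assume g: "graph_code n es" and num: "feedback_edge_set_number (edges_of es) = k"
  interpret graph_input n es by unfold_locales (rule g)
  let ?T = "150 * (n + length es) + 150" and ?T2 = "1000 * (n + length es) + 1000"
  \<comment> \<open>Deleting all edges leaves a forest, so the minimum in the definition of
    \<open>k\<close> is attained by some \<open>F\<close>.\<close>
  have "feedback_edge_set E E" by (auto simp: feedback_edge_set_def forest_def is_cycle_def intro!: exI[of _ 0])
  then have "\<exists>k F. feedback_edge_set E F \<and> card F = k" by blast
  then obtain F where F: "feedback_edge_set E F" "card F = k"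
    using LeastI_ex[of "\<lambda>k. \<exists>F. feedback_edge_set E F \<and> card F = k"] num
    unfolding feedback_edge_set_number_def by blast
  obtain t s where ex: "exec Kernelize (input n es []) t s" "t \<le> ?T" and K: "kernel_ok k s"
    using wp_Kernelize[OF F(1) order_refl] F(2) unfolding wp_def by auto
  let ?V = "out_set ''V'' s" and ?E = "out_edges s" and ?W = "out_set ''W'' s"
  have V: "?V = nz (arrs s ''kf'')" "?V \<subseteq> {0..<n}" and inst: "rds_instance ?V ?E ?W"
    and red: "reduction {0..<n} E {} ?V ?E ?W (\<lambda>D. foldr lstep (lgs s) D \<union> nz (arrs s ''s''))"
    and size: "card ?V + card ?E \<le> 200 * k" and sn: "regs s ''n'' = n"
    using K by (auto simp: kernel_ok_def)
  have ln: "regs s ''ln'' \<le> ?T"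
    using exec_only_inc[OF ex(1) Kernelize_ignores(3)] ex(2) by (simp add: input_def)
  have "kernelizes Kernelize ?T2 n es ?V ?E ?W"
    unfolding kernelizes_def using ex by (intro exI[of _ t] exI[of _ s]) auto
  moreover have "reduces_to Complete ?T2 n es ?V ?E ?W"
    unfolding reduces_to_def
  proof (intro conjI allI impI)
    show "rds_instance ?V ?E ?W" "?V \<subseteq> {0..<n}" by (fact inst, fact V(2))
    fix ds assume "distinct ds \<and> minimum_dominating ?V ?E ?W (set ds)"
    then have ds: "distinct ds" and mds: "minimum_dominating ?V ?E ?W (set ds)" by auto
    let ?L = "foldr lstep (lgs s) (set ds) \<union> nz (arrs s ''s'')"
    have m: "minimum_dominating {0..<n} E {} ?L" "?L \<inter> ?V = set ds" using reduction_minimum[OF red mds] by auto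
    have LV: "?L \<subseteq> {0..<n}" using m(1) by (simp add: minimum_dominating_def dominating_def)
    have "set ds \<subseteq> {0..<n}" using mds V(2) by (auto simp: minimum_dominating_def dominating_def)
    then have dn: "length ds \<le> n"
      using distinct_card[OF ds] card_mono[of "{0..<n}" "set ds"] by simp
    \<comment> \<open>The two initial memories differ only in register \<open>d\<close> and array
      \<open>D\<close>, which \<open>Kernelize\<close> does not read.\<close>
    have "agree {''d''} {''D''} (input n es []) (input n es ds)" by (auto simp: agree_def input_def)
    then obtain s2 where s2: "exec Kernelize (input n es ds) t s2" "agree {''d''} {''D''} s s2"
      using exec_agree[OF ex(1) _ Kernelize_ignores(1,2)] by blast
    note fr = exec_frame[OF s2(1)]
    have r: "regs s2 x = regs s x" if "x \<noteq> ''d''" for x using s2(2) that by (simp add: agree_def)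
    have a: "arrs s2 x = arrs s x" if "x \<noteq> ''D''" for x using s2(2) that by (simp add: agree_def)
    have i2: "regs s2 ''d'' = length ds" "arrs s2 ''D'' = array_of ds" "arrs s2 ''t'' = (\<lambda>_. 0)" "regs s2 ''S'' = 0"
      using fr Kernelize_ignores(4-7) by (auto simp: input_def)
    let ?S = "{v. v < n \<and> v \<notin> ?V \<and> v \<in> ?L}"
    have lg2: "lgs s2 = lgs s" by (rule lgs_cong) (auto simp: r a)
    have "wp (Seq MarkD (Seq Undo OutS)) (\<lambda>k' s'. out_set ''S'' s' = ?S) (?T2 - t) s2"
      unfolding wp_Seq_fun
    proof (rule wp_MarkD[OF i2(1-3), where c = "5 * ?T + 1 + (6 * n + 2)"])
      \<comment> \<open>The factor 1000 leaves room for 150 of the repeated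
        \<open>Kernelize\<close>, 5 times 150 for undoing a log no longer than that run, and 3 + 6
        for reading \<open>ds\<close> and writing \<open>S\<close>.\<close>
      show "3 * length ds + 2 + (5 * ?T + 1 + (6 * n + 2)) \<le> ?T2 - t"
        using ex(2) dn by (simp add: distrib_left)
      fix k3 s3 assume k3: "5 * ?T + 1 + (6 * n + 2) \<le> k3" and t3: "nz (arrs s3 ''t'') = set ds"
        and f3: "\<And>x. x \<noteq> ''i'' \<Longrightarrow> regs s3 x = regs s2 x" "\<And>a. a \<noteq> ''t'' \<Longrightarrow> arrs s3 a = arrs s2 a"
      have lg3: "lgs s3 = lgs s" unfolding lg2[symmetric] by (rule lgs_cong) (auto simp: f3)
      show "wp Undo (wp OutS (\<lambda>k' s'. out_set ''S'' s' = ?S)) k3 s3"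
      proof (rule wp_Undo[OF t3, where c = "6 * n + 2"])
        show "5 * regs s3 ''ln'' + 1 + (6 * n + 2) \<le> k3" using k3 ln f3(1) r by simp
        fix k4 s4 assume k4: "6 * n + 2 \<le> k4" and t4: "nz (arrs s4 ''t'') = foldr lstep (lgs s3) (set ds)"
          and f4: "\<And>x. x \<noteq> ''ln'' \<Longrightarrow> regs s4 x = regs s3 x" "\<And>a. a \<noteq> ''t'' \<Longrightarrow> arrs s4 a = arrs s3 a"
        have e: "arrs s4 ''kf'' = arrs s ''kf''" "arrs s4 ''s'' = arrs s ''s''" "regs s4 ''n'' = n" "regs s4 ''S'' = 0"
          using f3 f4 r a i2 sn by simp_all
        have S: "?S = {v. v < n \<and> v \<notin> nz (arrs s4 ''kf'') \<and> v \<in> nz (arrs s4 ''s'') \<union> nz (arrs s4 ''t'')}"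
          unfolding V(1) e t4 lg3 by auto
        show "wp OutS (\<lambda>k' s'. out_set ''S'' s' = ?S) k4 s4"
          unfolding S by (rule wp_OutS[OF e(3,4) k4])
      qed
    qed
    then obtain t' s' where x: "exec (Seq MarkD (Seq Undo OutS)) s2 t' s'" "t' \<le> ?T2 - t" "out_set ''S'' s' = ?S"
      unfolding wp_def by blast
    have "exec Complete (input n es ds) (t + t') s'"
      unfolding Complete_def using exec.Seq[OF s2(1) x(1)] by simp
    moreover have "t + t' \<le> ?T2" using x(2) ex(2) by simp
    \<comment> \<open>The lifted set meets the kernel exactly in \<open>set ds\<close>, so its part
      outside the kernel is all that has to be output.\<close>
    moreover have "?S \<union> set ds = ?L" using m(2) LV by auto
    moreover have "?S \<subseteq> {0..<n} - ?V" by auto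
    ultimately show "\<exists>t s'. exec Complete (input n es ds) t s' \<and> t \<le> ?T2 \<and> out_set ''S'' s' \<subseteq> {0..<n} - ?V \<and>
        minimum_dominating {0..<n} E {} (out_set ''S'' s' \<union> set ds)"
      using m(1) x(3) by (intro exI[of _ "t + t'"] exI[of _ s']) simp
  qed
  ultimately show "\<exists>V' E' W'. kernelizes Kernelize ?T2 n es V' E' W' \<and> reduces_to Complete ?T2 n es V' E' W' \<and>
      card V' + card E' \<le> 200 * k"
    using size by blast
qed

end
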